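(* Let $\mathbb{K}$ be a field and let $A$ be a profinite $\mathbb{K}$-algebra which is left semiartinian (i.e. $A$ is semilocal and its Jacobson radical $\mathrm{Jac}(A)$ is right T-nilpotent). Then $J=\mathrm{Jac}(A)$ is nilpotent, $A/J$ is semisimple and finite dimensional over $\mathbb{K}$, and $A$ is right semiartinian too.
   Context: A profinite algebra over a field $\mathbb{K}$ is an inverse limit of finite dimensional (associative, unital) $\mathbb{K}$-algebras; equivalently, an algebra isomorphic to the dual algebra $C^*$ (with convolution product) of a $\mathbb{K}$-coalgebra $C$. For a module $M$ over a ring, the Loewy series is defined by transfinite induction: $M_0$ is the socle of $M$ (the sum of all simple submodules); for a successor ordinal $\alpha=\beta+1$, $M_\alpha$ is the submodule with $M_\alpha/M_\beta$ equal to the socle of $M/M_\beta$; for a limit ordinal $\alpha$, $M_\alpha=\bigcup_{\beta<\alpha}M_\beta$. The module $M$ is semiartinian if $M=M_\gamma$ for some ordinal $\gamma$. A ring $R$ is left (right) semiartinian if it is semiartinian as a left (right) module over itself. A ring $R$ is semilocal if $R/\mathrm{Jac}(R)$ is semisimple artinian. An ideal $I$ of a ring is right T-nilpotent if for every sequence $(x_n)_{n\ge 1}$ of elements of $I$ there is $k$ such that $x_kx_{k-1}\cdots x_1=0$. For profinite algebras the paper regards "left semiartinian" and "semilocal with right T-nilpotent Jacobson radical" as equivalent conditions. *)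

theory Defs
  imports "HOL-Algebra.Module" "HOL-Algebra.QuotRing" "HOL-Algebra.Ideal_Product" "HOL-Algebra.Generated_Groups"
begin

section \<open>Modules over a noncommutative ring\<close>

text \<open>
  The library locale \<^locale>\<open>module\<close> asks for a commutative ring of scalars, but the record
  \<^typ>\<open>('r, 'a) module\<close> and the locale \<^locale>\<open>submodule\<close> do not; they are used below
  for left modules over arbitrary rings.  A right \<open>R\<close>-module is a left module over \<open>opposite_ring R\<close>.
\<close>

definition opposite_ring :: "('a, 'c) ring_scheme \<Rightarrow> ('a, 'c) ring_scheme" where
  "opposite_ring R = R\<lparr>monoid.mult := \<lambda>x y. y \<otimes>\<^bsub>R\<^esub> x\<rparr>"

definition regular_module :: "('a, 'c) ring_scheme \<Rightarrow> ('a, 'a) module" where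
  "regular_module R = ring.extend (ring.truncate R) (module.fields (\<lambda>a x. a \<otimes>\<^bsub>R\<^esub> x))"

text \<open>
  For a submodule \<open>N\<close> this is the quotient module \<open>M/N\<close>, whose elements are cosets.  The
  multiplicative part of the record is meaningful only if \<open>M\<close> is a ring and \<open>N\<close> an ideal.
\<close>
definition quot_module :: "('r, 'a, 'c) module_scheme \<Rightarrow> 'a set \<Rightarrow> ('r, 'a set) module" where
  "quot_module M N =
     ring.extend (M Quot N) (module.fields (\<lambda>a C. \<Union>x\<in>C. N +>\<^bsub>M\<^esub> (a \<odot>\<^bsub>M\<^esub> x)))"

definition simple_submodule ::
    "'a set \<Rightarrow> ('r, 'c) ring_scheme \<Rightarrow> ('r, 'a, 'd) module_scheme \<Rightarrow> bool" where
  "simple_submodule S R M \<longleftrightarrow>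
     submodule S R M \<and> S \<noteq> {\<zero>\<^bsub>M\<^esub>} \<and>
     (\<forall>N. submodule N R M \<and> N \<subseteq> S \<longrightarrow> N = {\<zero>\<^bsub>M\<^esub>} \<or> N = S)"

text \<open>The sum of a family of submodules is the additive subgroup generated by their union.\<close>
definition socle :: "('r, 'c) ring_scheme \<Rightarrow> ('r, 'a, 'd) module_scheme \<Rightarrow> 'a set" where
  "socle R M = generate (add_monoid M) (\<Union>{S. simple_submodule S R M})"

definition semisimple_module ::
    "('r, 'c) ring_scheme \<Rightarrow> ('r, 'a, 'd) module_scheme \<Rightarrow> bool" where
  "semisimple_module R M \<longleftrightarrow> socle R M = carrier M"


section \<open>The Loewy series\<close>

text \<open>
  A Loewy series \<open>L\<close> indexed by a well-order \<open>r\<close>: the elements of \<open>Field r\<close> play the role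
  of the ordinals below the order type of \<open>r\<close>, the least one being the ordinal 0.  The second
  clause concerns \<open>\<alpha> = \<beta> + 1\<close>: the elements strictly below \<open>\<alpha>\<close> are those weakly below \<open>\<beta>\<close>.
  The three clauses determine \<open>L\<close> on \<open>Field r\<close>.
\<close>
definition loewy_series ::
    "('r, 'c) ring_scheme \<Rightarrow> ('r, 'a, 'd) module_scheme \<Rightarrow> 'i rel \<Rightarrow> ('i \<Rightarrow> 'a set) \<Rightarrow> bool" where
  "loewy_series R M r L \<longleftrightarrow>
     (\<forall>\<alpha>\<in>Field r.
        (underS r \<alpha> = {} \<longrightarrow> L \<alpha> = socle R M) \<and>
        (\<forall>\<beta>\<in>Field r. underS r \<alpha> = under r \<beta> \<longrightarrow>
           submodule (L \<alpha>) R M \<and> L \<beta> \<subseteq> L \<alpha> \<and>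
           (\<lambda>x. L \<beta> +>\<^bsub>M\<^esub> x) ` L \<alpha> = socle R (quot_module M (L \<beta>))) \<and>
        (underS r \<alpha> \<noteq> {} \<and> (\<forall>\<beta>\<in>Field r. underS r \<alpha> \<noteq> under r \<beta>) \<longrightarrow>
           L \<alpha> = (\<Union>\<beta>\<in>underS r \<alpha>. L \<beta>)))"

text \<open>
  Well-orders of subsets of the type \<^typ>\<open>'a set\<close> suffice to express ``for some ordinal \<open>\<gamma>\<close>'':
  the Loewy series increases strictly until it becomes stationary, so the least \<open>\<gamma>\<close>
  with \<open>M\<^sub>\<gamma> = M\<close>, if there is one, has at most as many predecessors as \<open>M\<close> has elements.
\<close>
definition semiartinian_module ::
    "('r, 'c) ring_scheme \<Rightarrow> ('r, 'a, 'd) module_scheme \<Rightarrow> bool" where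
  "semiartinian_module R M \<longleftrightarrow>
     (\<exists>(r :: 'a set rel) L. Well_order r \<and> loewy_series R M r L \<and>
        (\<exists>\<gamma>\<in>Field r. L \<gamma> = carrier M))"

definition left_semiartinian :: "('a, 'c) ring_scheme \<Rightarrow> bool" where
  "left_semiartinian R \<longleftrightarrow> semiartinian_module R (regular_module R)"

definition right_semiartinian :: "('a, 'c) ring_scheme \<Rightarrow> bool" where
  "right_semiartinian R \<longleftrightarrow>
     semiartinian_module (opposite_ring R) (regular_module (opposite_ring R))"


section \<open>The Jacobson radical, semisimple rings, nilpotent ideals\<close>

definition maximal_left_ideal :: "'a set \<Rightarrow> ('a, 'c) ring_scheme \<Rightarrow> bool" where
  "maximal_left_ideal I R \<longleftrightarrow>
     submodule I R (regular_module R) \<and> I \<noteq> carrier R \<and>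
     (\<forall>N. submodule N R (regular_module R) \<and> I \<subseteq> N \<longrightarrow> N = I \<or> N = carrier R)"

text \<open>The intersection with the carrier matters only for the zero ring.\<close>
definition Jac :: "('a, 'c) ring_scheme \<Rightarrow> 'a set" where
  "Jac R = carrier R \<inter> \<Inter>{I. maximal_left_ideal I R}"

text \<open>For unital rings, a semisimple ring is automatically artinian.\<close>
definition semisimple_ring :: "('a, 'c) ring_scheme \<Rightarrow> bool" where
  "semisimple_ring R \<longleftrightarrow> semisimple_module R (regular_module R)"

primrec ideal_power :: "('a, 'c) ring_scheme \<Rightarrow> 'a set \<Rightarrow> nat \<Rightarrow> 'a set" where
  "ideal_power R I 0 = carrier R"
| "ideal_power R I (Suc n) = ideal_power R I n \<cdot>\<^bsub>R\<^esub> I"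

definition nilpotent_ideal :: "'a set \<Rightarrow> ('a, 'c) ring_scheme \<Rightarrow> bool" where
  "nilpotent_ideal I R \<longleftrightarrow> (\<exists>n. ideal_power R I n = {\<zero>\<^bsub>R\<^esub>})"


section \<open>Profinite algebras\<close>

definition finite_dimensional ::
    "('k, 'c) ring_scheme \<Rightarrow> ('k, 'v, 'd) module_scheme \<Rightarrow> bool" where
  "finite_dimensional K V \<longleftrightarrow>
     (\<exists>S. finite S \<and> S \<subseteq> carrier V \<and>
        (\<forall>v\<in>carrier V. \<exists>c\<in>S \<rightarrow> carrier K. v = (\<Oplus>\<^bsub>V\<^esub>s\<in>S. c s \<odot>\<^bsub>V\<^esub> s)))"

text \<open>
  Associative unital algebras, not necessarily commutative (unlike the library locale
  \<^locale>\<open>algebra\<close>).  The zero algebra is allowed.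
\<close>
locale assoc_algebra = module K A + A?: ring A for K (structure) and A (structure) +
  assumes smult_mult_left:
    "\<lbrakk>a \<in> carrier K; x \<in> carrier A; y \<in> carrier A\<rbrakk> \<Longrightarrow>
       (a \<odot>\<^bsub>A\<^esub> x) \<otimes>\<^bsub>A\<^esub> y = a \<odot>\<^bsub>A\<^esub> (x \<otimes>\<^bsub>A\<^esub> y)"
  and smult_mult_right:
    "\<lbrakk>a \<in> carrier K; x \<in> carrier A; y \<in> carrier A\<rbrakk> \<Longrightarrow>
       x \<otimes>\<^bsub>A\<^esub> (a \<odot>\<^bsub>A\<^esub> y) = a \<odot>\<^bsub>A\<^esub> (x \<otimes>\<^bsub>A\<^esub> y)"

definition algebra_hom ::
    "('k, 'c) ring_scheme \<Rightarrow> ('k, 'a, 'd) module_scheme \<Rightarrow> ('k, 'b, 'e) module_scheme \<Rightarrow>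
     ('a \<Rightarrow> 'b) set" where
  "algebra_hom K A B =
     {h \<in> ring_hom A B. \<forall>a\<in>carrier K. \<forall>x\<in>carrier A. h (a \<odot>\<^bsub>A\<^esub> x) = a \<odot>\<^bsub>B\<^esub> h x}"

text \<open>
  An inverse system of finite dimensional algebras over a nonempty directed poset \<open>(I, r)\<close>, with
  transition maps \<open>f i j : B\<^sub>j \<rightarrow> B\<^sub>i\<close> for \<open>i \<le> j\<close>.
\<close>
locale fd_inverse_system =
  fixes K :: "('k, 'c) ring_scheme"
    and I :: "'i set" and r :: "'i rel"
    and B :: "'i \<Rightarrow> ('k, 'b) module"
    and f :: "'i \<Rightarrow> 'i \<Rightarrow> 'b \<Rightarrow> 'b"
  assumes poset: "partial_order_on I r"
    and nonempty: "I \<noteq> {}"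
    and directed: "\<lbrakk>i \<in> I; j \<in> I\<rbrakk> \<Longrightarrow> \<exists>k\<in>I. (i, k) \<in> r \<and> (j, k) \<in> r"
    and fd_algebra: "i \<in> I \<Longrightarrow> assoc_algebra K (B i) \<and> finite_dimensional K (B i)"
    and transition_hom: "(i, j) \<in> r \<Longrightarrow> f i j \<in> algebra_hom K (B j) (B i)"
    and transition_id: "\<lbrakk>i \<in> I; x \<in> carrier (B i)\<rbrakk> \<Longrightarrow> f i i x = x"
    and transition_comp:
      "\<lbrakk>(i, j) \<in> r; (j, k) \<in> r; x \<in> carrier (B k)\<rbrakk> \<Longrightarrow> f i j (f j k x) = f i k x"

definition inverse_limit ::
    "'i set \<Rightarrow> 'i rel \<Rightarrow> ('i \<Rightarrow> ('k, 'b) module) \<Rightarrow> ('i \<Rightarrow> 'i \<Rightarrow> 'b \<Rightarrow> 'b) \<Rightarrow>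
     ('k, 'i \<Rightarrow> 'b) module" where
  "inverse_limit I r B f =
     \<lparr>carrier = {x \<in> (\<Pi>\<^sub>E i\<in>I. carrier (B i)). \<forall>(i, j)\<in>r. f i j (x j) = x i},
      monoid.mult = \<lambda>x y. \<lambda>i\<in>I. x i \<otimes>\<^bsub>B i\<^esub> y i,
      one = \<lambda>i\<in>I. \<one>\<^bsub>B i\<^esub>,
      zero = \<lambda>i\<in>I. \<zero>\<^bsub>B i\<^esub>,
      add = \<lambda>x y. \<lambda>i\<in>I. x i \<oplus>\<^bsub>B i\<^esub> y i,
      smult = \<lambda>a x. \<lambda>i\<in>I. a \<odot>\<^bsub>B i\<^esub> x i\<rparr>"

text \<open>
  The type arguments are the types of the indices and of the elements of the finite dimensional
  algebras \<open>B\<^sub>i\<close>; results on profinite algebras are to be stated for arbitrary such types, since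
  HOL cannot quantify over types inside a formula.  That all \<open>B\<^sub>i\<close> share one element type is no
  restriction, as they are given by carrier sets.
\<close>
definition profinite_algebra ::
    "'i itself \<Rightarrow> 'b itself \<Rightarrow> ('k, 'c) ring_scheme \<Rightarrow> ('k, 'a, 'd) module_scheme \<Rightarrow> bool" where
  "profinite_algebra _ _ K A \<longleftrightarrow>
     assoc_algebra K A \<and>
     (\<exists>(I :: 'i set) r (B :: 'i \<Rightarrow> ('k, 'b) module) f h.
        fd_inverse_system K I r B f \<and>
        h \<in> algebra_hom K A (inverse_limit I r B f) \<and>
        bij_betw h (carrier A) (carrier (inverse_limit I r B f)))"

end

theory Submission
  imports Defs "HOL-Library.Infinite_Set"
begin

text \<open>
  Let \<open>J\<close> be the radical of the profinite algebra \<open>A\<close>, and let the \<open>U i\<close> be the kernels of the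
  projections of \<open>A\<close> to the finite dimensional algebras in an inverse system with limit \<open>A\<close>. They
  are a base of a complete Hausdorff linear topology, and the quotients \<open>A / U i\<close> have finite
  length on both sides. By a maximal filter argument \<open>A\<close> is then linearly compact: cosets of open
  left ideals with the finite intersection property have a common element (\<open>linearly_compact\<close>).
  Left semiartinianness enters in one form only: for every left ideal \<open>N \<noteq> A\<close> the module \<open>A / N\<close>
  contains a simple submodule (\<open>left_semiartinian_simple_over\<close>).

  \<^emph>\<open>The radical is open.\<close> Suppose there were infinitely many open maximal ideals \<open>P 0, P 1, \<dots>\<close>. By
  the Chinese remainder theorem and compactness, every set \<open>S\<close> of natural numbers has an element
  \<open>e\<close> of \<open>A\<close> that is 1 modulo \<open>P n\<close> for \<open>n \<in> S\<close> and 0 modulo the others. Let \<open>F\<close> consist of the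
  elements that lie in almost all \<open>P n\<close>. If \<open>y\<close> generates a simple submodule of \<open>A / F\<close>, split the
  infinite set of all \<open>n\<close> with \<open>y \<notin> P n\<close> into two infinite halves and let \<open>e\<close> be the element for
  one of them: then \<open>e y \<notin> F\<close>, but \<open>y\<close> is not in \<open>A e y + F\<close>, which contradicts simplicity. So the
  intersection \<open>Q\<close> of the open maximal ideals is open. As annihilators of simple modules over
  \<open>A / U i\<close> are maximal ideals, \<open>Q\<close> kills all these modules and is nilpotent modulo each \<open>U i\<close>; by
  compactness \<open>1 - q\<close> is then left invertible for \<open>q \<in> Q\<close>. Hence \<open>Q \<subseteq> J\<close>, and \<open>J\<close> contains some
  \<open>U i\<close> (\<open>Jac_open\<close>).

  \<^emph>\<open>The radical is nilpotent.\<close> \<open>J\<close> is T-nilpotent, because it kills simple modules. If no power of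
  any \<open>U i\<close> vanished, one could construct, as in the proof of the Baire category theorem, a
  sequence in \<open>J\<close> whose partial products are all nonzero: stay within smaller and smaller
  neighbourhoods, and at each step perturb the sequence so that one more product becomes nonzero.
  A perturbation exists because a product that vanishes on a box \<open>x + U i\<close> vanishes on \<open>U i\<close>, by
  multilinearity (\<open>desc_prod_polarization\<close>). So some \<open>U i\<close> is nilpotent (\<open>small_ideal_nilpotent\<close>),
  and so is \<open>J\<close>, which is nilpotent modulo \<open>U i\<close>.

  \<^emph>\<open>The remaining claims.\<close> \<open>A / J\<close> is a quotient of \<open>A / U i\<close>, so it is finite dimensional, and
  \<open>J\<close> is a finite intersection of maximal left ideals. This makes \<open>1\<close> a sum of elements that are
  simple modulo \<open>J\<close>; hence \<open>A / J\<close> is semisimple, and in any left module the elements killed by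
  \<open>J\<close> lie in the socle. The same holds on the right, as \<open>J\<close> is also the radical of the opposite
  ring and right ideals are subspaces too. Since \<open>J\<^sup>n = 0\<close>, the right Loewy series of \<open>A\<close> reaches
  \<open>A\<close> after finitely many steps (\<open>semiartinian_if_Jac_nilpotent\<close>).
\<close>

section \<open>Modules over a noncommutative ring\<close>

locale left_module = R?: ring R + M?: abelian_group M for R (structure) and M (structure) +
  assumes smult_closed [simp, intro]:
      "\<lbrakk>a \<in> carrier R; x \<in> carrier M\<rbrakk> \<Longrightarrow> a \<odot>\<^bsub>M\<^esub> x \<in> carrier M"
    and smult_l_distr:
      "\<lbrakk>a \<in> carrier R; b \<in> carrier R; x \<in> carrier M\<rbrakk> \<Longrightarrow>
       (a \<oplus> b) \<odot>\<^bsub>M\<^esub> x = a \<odot>\<^bsub>M\<^esub> x \<oplus>\<^bsub>M\<^esub> b \<odot>\<^bsub>M\<^esub> x"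
    and smult_r_distr:
      "\<lbrakk>a \<in> carrier R; x \<in> carrier M; y \<in> carrier M\<rbrakk> \<Longrightarrow>
       a \<odot>\<^bsub>M\<^esub> (x \<oplus>\<^bsub>M\<^esub> y) = a \<odot>\<^bsub>M\<^esub> x \<oplus>\<^bsub>M\<^esub> a \<odot>\<^bsub>M\<^esub> y"
    and smult_assoc:
      "\<lbrakk>a \<in> carrier R; b \<in> carrier R; x \<in> carrier M\<rbrakk> \<Longrightarrow>
       (a \<otimes> b) \<odot>\<^bsub>M\<^esub> x = a \<odot>\<^bsub>M\<^esub> (b \<odot>\<^bsub>M\<^esub> x)"
    and smult_one [simp]: "x \<in> carrier M \<Longrightarrow> \<one> \<odot>\<^bsub>M\<^esub> x = x"

lemma (in abelian_group) diff_eq_zero_iff: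
  assumes "x \<in> carrier G" "y \<in> carrier G" shows "x \<ominus> y = \<zero> \<longleftrightarrow> x = y"
proof
  assume *: "x \<ominus> y = \<zero>"
  have "x = (x \<ominus> y) \<oplus> y" using assms by (simp add: minus_eq a_assoc l_neg)
  then show "x = y" using assms * by simp
qed (use assms in \<open>simp add: minus_eq r_neg\<close>)

context left_module
begin

lemma smult_l_null [simp]:
  assumes "x \<in> carrier M" shows "\<zero> \<odot>\<^bsub>M\<^esub> x = \<zero>\<^bsub>M\<^esub>"
proof -
  have "\<zero> \<odot>\<^bsub>M\<^esub> x \<oplus>\<^bsub>M\<^esub> \<zero> \<odot>\<^bsub>M\<^esub> x = \<zero> \<odot>\<^bsub>M\<^esub> x"
    using smult_l_distr[of \<zero> \<zero> x] assms by simp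
  then show ?thesis using assms by (metis M.add.r_cancel_one' R.zero_closed smult_closed)
qed

lemma smult_r_null [simp]:
  assumes "a \<in> carrier R" shows "a \<odot>\<^bsub>M\<^esub> \<zero>\<^bsub>M\<^esub> = \<zero>\<^bsub>M\<^esub>"
proof -
  have "a \<odot>\<^bsub>M\<^esub> \<zero>\<^bsub>M\<^esub> \<oplus>\<^bsub>M\<^esub> a \<odot>\<^bsub>M\<^esub> \<zero>\<^bsub>M\<^esub> = a \<odot>\<^bsub>M\<^esub> \<zero>\<^bsub>M\<^esub>"
    using smult_r_distr[of a "\<zero>\<^bsub>M\<^esub>" "\<zero>\<^bsub>M\<^esub>"] assms by simp
  then show ?thesis using assms by (metis M.add.r_cancel_one' M.zero_closed smult_closed)
qed

lemma smult_l_minus: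
  assumes "a \<in> carrier R" "x \<in> carrier M" shows "(\<ominus> a) \<odot>\<^bsub>M\<^esub> x = \<ominus>\<^bsub>M\<^esub> (a \<odot>\<^bsub>M\<^esub> x)"
proof -
  have "(\<ominus> a) \<odot>\<^bsub>M\<^esub> x \<oplus>\<^bsub>M\<^esub> a \<odot>\<^bsub>M\<^esub> x = \<zero>\<^bsub>M\<^esub>"
    using smult_l_distr[of "\<ominus> a" a x] assms by (simp add: R.l_neg)
  then show ?thesis using assms by (simp add: M.minus_equality)
qed

lemma smult_r_minus:
  assumes "a \<in> carrier R" "x \<in> carrier M" shows "a \<odot>\<^bsub>M\<^esub> (\<ominus>\<^bsub>M\<^esub> x) = \<ominus>\<^bsub>M\<^esub> (a \<odot>\<^bsub>M\<^esub> x)"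
proof -
  have "a \<odot>\<^bsub>M\<^esub> (\<ominus>\<^bsub>M\<^esub> x) \<oplus>\<^bsub>M\<^esub> a \<odot>\<^bsub>M\<^esub> x = \<zero>\<^bsub>M\<^esub>"
    using smult_r_distr[of a "\<ominus>\<^bsub>M\<^esub> x" x] assms by (simp add: M.l_neg)
  then show ?thesis using assms by (simp add: M.minus_equality)
qed

lemma smult_r_diff:
  assumes "a \<in> carrier R" "x \<in> carrier M" "y \<in> carrier M"
  shows "a \<odot>\<^bsub>M\<^esub> (x \<ominus>\<^bsub>M\<^esub> y) = a \<odot>\<^bsub>M\<^esub> x \<ominus>\<^bsub>M\<^esub> a \<odot>\<^bsub>M\<^esub> y"
  using assms by (simp add: M.minus_eq smult_r_distr smult_r_minus)

lemma smult_l_diff: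
  assumes "a \<in> carrier R" "b \<in> carrier R" "x \<in> carrier M"
  shows "(a \<ominus> b) \<odot>\<^bsub>M\<^esub> x = a \<odot>\<^bsub>M\<^esub> x \<ominus>\<^bsub>M\<^esub> b \<odot>\<^bsub>M\<^esub> x"
  using assms by (simp add: M.minus_eq R.minus_eq smult_l_distr smult_l_minus)

lemma submodule_iff:
  "submodule H R M \<longleftrightarrow> H \<subseteq> carrier M \<and> \<zero>\<^bsub>M\<^esub> \<in> H \<and> (\<forall>x\<in>H. \<forall>y\<in>H. x \<oplus>\<^bsub>M\<^esub> y \<in> H)
     \<and> (\<forall>a\<in>carrier R. \<forall>x\<in>H. a \<odot>\<^bsub>M\<^esub> x \<in> H)" (is "_ \<longleftrightarrow> ?r")
proof
  assume "submodule H R M"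
  then interpret submodule H R M .
  show ?r using subset m_closed one_closed smult_closed by auto
next
  assume r: ?r
  have "\<ominus>\<^bsub>M\<^esub> x \<in> H" if "x \<in> H" for x
    using r that smult_l_minus[of \<one> x] by (metis R.a_inv_closed R.one_closed smult_one subsetD)
  then show "submodule H R M"
    using r unfolding submodule_def submodule_axioms_def
    by (auto intro!: M.add.subgroupI simp: a_inv_def[symmetric])
qed

lemma submoduleI:
  assumes "H \<subseteq> carrier M" "\<zero>\<^bsub>M\<^esub> \<in> H" "\<And>x y. x \<in> H \<Longrightarrow> y \<in> H \<Longrightarrow> x \<oplus>\<^bsub>M\<^esub> y \<in> H"
    "\<And>a x. a \<in> carrier R \<Longrightarrow> x \<in> H \<Longrightarrow> a \<odot>\<^bsub>M\<^esub> x \<in> H"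
  shows "submodule H R M"
  using assms by (simp add: submodule_iff)

context
  fixes H assumes H: "submodule H R M"
begin

lemma sub_subset: "H \<subseteq> carrier M" and sub_zero: "\<zero>\<^bsub>M\<^esub> \<in> H"
  and sub_add: "x \<in> H \<Longrightarrow> y \<in> H \<Longrightarrow> x \<oplus>\<^bsub>M\<^esub> y \<in> H"
  and sub_smult: "a \<in> carrier R \<Longrightarrow> x \<in> H \<Longrightarrow> a \<odot>\<^bsub>M\<^esub> x \<in> H"
  using H by (auto simp: submodule_iff)

lemma sub_carr: "x \<in> H \<Longrightarrow> x \<in> carrier M" using sub_subset by auto

lemma sub_neg: "x \<in> H \<Longrightarrow> \<ominus>\<^bsub>M\<^esub> x \<in> H"
  using sub_smult[of "\<ominus> \<one>" x] smult_l_minus[of \<one> x] sub_carr by simp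

lemma sub_diff: "x \<in> H \<Longrightarrow> y \<in> H \<Longrightarrow> x \<ominus>\<^bsub>M\<^esub> y \<in> H"
  by (simp add: M.minus_eq sub_add sub_neg)

lemma sub_diff_swap: "x \<in> carrier M \<Longrightarrow> y \<in> carrier M \<Longrightarrow> x \<ominus>\<^bsub>M\<^esub> y \<in> H \<Longrightarrow> y \<ominus>\<^bsub>M\<^esub> x \<in> H"
proof -
  assume c: "x \<in> carrier M" "y \<in> carrier M" and d: "x \<ominus>\<^bsub>M\<^esub> y \<in> H"
  have "\<ominus>\<^bsub>M\<^esub> (x \<ominus>\<^bsub>M\<^esub> y) = \<ominus>\<^bsub>M\<^esub> x \<oplus>\<^bsub>M\<^esub> y" using c by (simp add: M.minus_eq M.minus_add)
  also have "\<dots> = y \<ominus>\<^bsub>M\<^esub> x" using c by (simp add: M.minus_eq M.a_comm)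
  finally show ?thesis using sub_neg[OF d] by simp
qed

lemma sub_diff_trans:
  assumes c: "x \<in> carrier M" "y \<in> carrier M" "z \<in> carrier M"
    and "x \<ominus>\<^bsub>M\<^esub> y \<in> H" "y \<ominus>\<^bsub>M\<^esub> z \<in> H"
  shows "x \<ominus>\<^bsub>M\<^esub> z \<in> H"
proof -
  have "(x \<ominus>\<^bsub>M\<^esub> y) \<oplus>\<^bsub>M\<^esub> (y \<ominus>\<^bsub>M\<^esub> z) = x \<ominus>\<^bsub>M\<^esub> z"
    using c by (simp add: M.minus_eq M.a_assoc M.r_neg2 M.r_neg1)
  then show ?thesis using sub_add assms(4,5) by metis
qed

lemma sub_diff_left:
  assumes c: "x \<in> carrier M" "y \<in> carrier M" and "x \<ominus>\<^bsub>M\<^esub> y \<in> H" "y \<in> H"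
  shows "x \<in> H"
proof -
  have "(x \<ominus>\<^bsub>M\<^esub> y) \<oplus>\<^bsub>M\<^esub> y = x" using c by (simp add: M.minus_eq M.a_assoc M.l_neg)
  then show ?thesis using sub_add assms(3,4) by metis
qed

lemma sub_diff_right:
  assumes c: "x \<in> carrier M" "y \<in> carrier M" and "x \<ominus>\<^bsub>M\<^esub> y \<in> H" "x \<in> H"
  shows "y \<in> H"
  using sub_diff_left[OF c(2,1) sub_diff_swap] assms by blast

lemma sub_abelian: "abelian_subgroup H M"
proof -
  interpret submodule H R M by (rule H)
  show ?thesis
    by (rule abelian_subgroupI3) (auto simp: additive_subgroup_def subgroup_axioms M.abelian_group_axioms)
qed

lemma coset_eq_iff:
  assumes "x \<in> carrier M" "y \<in> carrier M"
  shows "H +>\<^bsub>M\<^esub> x = H +>\<^bsub>M\<^esub> y \<longleftrightarrow> x \<ominus>\<^bsub>M\<^esub> y \<in> H"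
proof -
  interpret abelian_subgroup H M by (rule sub_abelian)
  have "H +>\<^bsub>M\<^esub> x = H +>\<^bsub>M\<^esub> y \<longleftrightarrow> x \<in> H +>\<^bsub>M\<^esub> y"
    using a_repr_independence[OF _ assms(2)] a_rcos_self[OF assms(1)]
    by (metis a_subgroup)
  then show ?thesis using a_rcos_module_minus[of y x] assms M.abelian_group_axioms
    by (simp add: M.abelian_group_axioms a_rcos_module M.minus_eq)
qed

lemma coset_mem_iff:
  assumes "x \<in> carrier M" "y \<in> carrier M"
  shows "y \<in> H +>\<^bsub>M\<^esub> x \<longleftrightarrow> y \<ominus>\<^bsub>M\<^esub> x \<in> H"
proof -
  interpret abelian_subgroup H M by (rule sub_abelian)
  show ?thesis using assms by (simp add: a_rcos_module M.minus_eq)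
qed

lemma coset_zero_iff:
  assumes x: "x \<in> carrier M" shows "H +>\<^bsub>M\<^esub> x = H \<longleftrightarrow> x \<in> H"
proof -
  have "H +>\<^bsub>M\<^esub> x = H \<longleftrightarrow> x \<ominus>\<^bsub>M\<^esub> \<zero>\<^bsub>M\<^esub> \<in> H"
    using coset_eq_iff[OF x M.zero_closed] M.a_coset_add_zero[OF sub_subset] by metis
  also have "\<dots> \<longleftrightarrow> x \<in> H"
    using sub_diff_left[OF x M.zero_closed _ sub_zero] sub_diff[OF _ sub_zero] by metis
  finally show ?thesis .
qed

lemma coset_rep: "C \<in> a_rcosets\<^bsub>M\<^esub> H \<Longrightarrow> \<exists>x\<in>carrier M. C = H +>\<^bsub>M\<^esub> x"
  by (auto simp: A_RCOSETS_def')

lemma quot_simps [simp]: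
  "carrier (quot_module M H) = a_rcosets\<^bsub>M\<^esub> H" "\<zero>\<^bsub>quot_module M H\<^esub> = H"
  "C \<oplus>\<^bsub>quot_module M H\<^esub> D = C <+>\<^bsub>M\<^esub> D"
  by (simp_all add: quot_module_def ring.defs module.defs FactRing_def)

lemma quot_smult:
  assumes "a \<in> carrier R" "x \<in> carrier M"
  shows "a \<odot>\<^bsub>quot_module M H\<^esub> (H +>\<^bsub>M\<^esub> x) = H +>\<^bsub>M\<^esub> (a \<odot>\<^bsub>M\<^esub> x)"
proof -
  interpret abelian_subgroup H M by (rule sub_abelian)
  have "H +>\<^bsub>M\<^esub> (a \<odot>\<^bsub>M\<^esub> y) = H +>\<^bsub>M\<^esub> (a \<odot>\<^bsub>M\<^esub> x)" if "y \<in> H +>\<^bsub>M\<^esub> x" for y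
  proof -
    have y: "y \<in> carrier M" using that assms a_elemrcos_carrier by auto
    have "y \<ominus>\<^bsub>M\<^esub> x \<in> H" using that coset_mem_iff assms y by auto
    then have "a \<odot>\<^bsub>M\<^esub> y \<ominus>\<^bsub>M\<^esub> a \<odot>\<^bsub>M\<^esub> x \<in> H"
      using sub_smult[OF assms(1)] smult_r_diff assms y by metis
    then show ?thesis using coset_eq_iff assms y by auto
  qed
  moreover have "x \<in> H +>\<^bsub>M\<^esub> x" using a_rcos_self assms by auto
  ultimately have "(\<Union>y\<in>H +>\<^bsub>M\<^esub> x. H +>\<^bsub>M\<^esub> (a \<odot>\<^bsub>M\<^esub> y)) = H +>\<^bsub>M\<^esub> (a \<odot>\<^bsub>M\<^esub> x)"
    by (intro SUP_eq_const) blast+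
  then show ?thesis by (simp add: quot_module_def ring.defs module.defs FactRing_def)
qed

lemma coset_add:
  assumes "x \<in> carrier M" "y \<in> carrier M"
  shows "(H +>\<^bsub>M\<^esub> x) <+>\<^bsub>M\<^esub> (H +>\<^bsub>M\<^esub> y) = H +>\<^bsub>M\<^esub> (x \<oplus>\<^bsub>M\<^esub> y)"
proof -
  interpret abelian_subgroup H M by (rule sub_abelian)
  show ?thesis using a_rcos_sum assms by simp
qed

lemma coset_in_quot: "x \<in> carrier M \<Longrightarrow> H +>\<^bsub>M\<^esub> x \<in> a_rcosets\<^bsub>M\<^esub> H"
  by (auto simp: A_RCOSETS_def')

lemma abelian_group_quot: "abelian_group (quot_module M H)"
proof -
  interpret abelian_subgroup H M by (rule sub_abelian)
  have H0: "H +>\<^bsub>M\<^esub> \<zero>\<^bsub>M\<^esub> = H" using coset_zero_iff sub_zero by simp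
  have neg: "\<exists>y\<in>a_rcosets\<^bsub>M\<^esub> H. y <+>\<^bsub>M\<^esub> x = H" if x: "x \<in> a_rcosets\<^bsub>M\<^esub> H" for x
  proof -
    obtain u where u: "u \<in> carrier M" "x = H +>\<^bsub>M\<^esub> u" using coset_rep x by blast
    show ?thesis using u H0
      by (intro bexI[of _ "H +>\<^bsub>M\<^esub> (\<ominus>\<^bsub>M\<^esub> u)"]) (auto simp: coset_add M.l_neg coset_in_quot)
  qed
  show ?thesis
  proof (rule abelian_groupI; simp)
    show "\<And>x y. x \<in> a_rcosets\<^bsub>M\<^esub> H \<Longrightarrow> y \<in> a_rcosets\<^bsub>M\<^esub> H \<Longrightarrow> x <+>\<^bsub>M\<^esub> y \<in> a_rcosets\<^bsub>M\<^esub> H"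
      using coset_rep coset_add coset_in_quot by (metis M.a_closed)
    show "H \<in> a_rcosets\<^bsub>M\<^esub> H" using H0 coset_in_quot[of "\<zero>\<^bsub>M\<^esub>"] by simp
    show "\<And>x y z. x \<in> a_rcosets\<^bsub>M\<^esub> H \<Longrightarrow> y \<in> a_rcosets\<^bsub>M\<^esub> H \<Longrightarrow> z \<in> a_rcosets\<^bsub>M\<^esub> H \<Longrightarrow>
        x <+>\<^bsub>M\<^esub> y <+>\<^bsub>M\<^esub> z = x <+>\<^bsub>M\<^esub> (y <+>\<^bsub>M\<^esub> z)"
      by (drule coset_rep)+ (auto simp: coset_add M.a_assoc)
    show "\<And>x y. x \<in> a_rcosets\<^bsub>M\<^esub> H \<Longrightarrow> y \<in> a_rcosets\<^bsub>M\<^esub> H \<Longrightarrow> x <+>\<^bsub>M\<^esub> y = y <+>\<^bsub>M\<^esub> x"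
      by (drule coset_rep)+ (auto simp: coset_add M.a_comm)
    show "\<And>x. x \<in> a_rcosets\<^bsub>M\<^esub> H \<Longrightarrow> H <+>\<^bsub>M\<^esub> x = x"
      using H0 coset_add[of "\<zero>\<^bsub>M\<^esub>"] by (auto dest!: coset_rep)
  qed (use neg in auto)
qed

lemma left_module_quot: "left_module R (quot_module M H)"
proof (intro left_module.intro left_module_axioms.intro R.ring_axioms abelian_group_quot; simp)
  show "\<And>a x. a \<in> carrier R \<Longrightarrow> x \<in> a_rcosets\<^bsub>M\<^esub> H \<Longrightarrow> a \<odot>\<^bsub>quot_module M H\<^esub> x \<in> a_rcosets\<^bsub>M\<^esub> H"
    by (auto dest!: coset_rep simp: quot_smult coset_in_quot)
  show "\<And>a b x. a \<in> carrier R \<Longrightarrow> b \<in> carrier R \<Longrightarrow> x \<in> a_rcosets\<^bsub>M\<^esub> H \<Longrightarrow>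
      (a \<oplus> b) \<odot>\<^bsub>quot_module M H\<^esub> x = a \<odot>\<^bsub>quot_module M H\<^esub> x <+>\<^bsub>M\<^esub> b \<odot>\<^bsub>quot_module M H\<^esub> x"
    by (auto dest!: coset_rep simp: quot_smult coset_add smult_l_distr)
  show "\<And>a x y. a \<in> carrier R \<Longrightarrow> x \<in> a_rcosets\<^bsub>M\<^esub> H \<Longrightarrow> y \<in> a_rcosets\<^bsub>M\<^esub> H \<Longrightarrow>
      a \<odot>\<^bsub>quot_module M H\<^esub> (x <+>\<^bsub>M\<^esub> y) = a \<odot>\<^bsub>quot_module M H\<^esub> x <+>\<^bsub>M\<^esub> a \<odot>\<^bsub>quot_module M H\<^esub> y"
    by (auto dest!: coset_rep simp: quot_smult coset_add smult_r_distr)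
  show "\<And>a b x. a \<in> carrier R \<Longrightarrow> b \<in> carrier R \<Longrightarrow> x \<in> a_rcosets\<^bsub>M\<^esub> H \<Longrightarrow>
      (a \<otimes> b) \<odot>\<^bsub>quot_module M H\<^esub> x = a \<odot>\<^bsub>quot_module M H\<^esub> (b \<odot>\<^bsub>quot_module M H\<^esub> x)"
    by (auto dest!: coset_rep simp: quot_smult smult_assoc)
  show "\<And>x. x \<in> a_rcosets\<^bsub>M\<^esub> H \<Longrightarrow> \<one> \<odot>\<^bsub>quot_module M H\<^esub> x = x"
    by (auto dest!: coset_rep simp: quot_smult)
qed

end

section \<open>Socles\<close>

lemma socle_subset: "socle R M \<subseteq> carrier M"
  unfolding socle_def
  by (rule M.add.generate_incl) (auto simp: simple_submodule_def dest: sub_carr)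

lemma submodule_socle: "submodule (socle R M) R M"
proof (rule submoduleI)
  show "socle R M \<subseteq> carrier M" by (rule socle_subset)
  show "\<zero>\<^bsub>M\<^esub> \<in> socle R M"
    unfolding socle_def using generate.one[of "add_monoid M"] by simp
  show "x \<oplus>\<^bsub>M\<^esub> y \<in> socle R M" if "x \<in> socle R M" "y \<in> socle R M" for x y
    using that unfolding socle_def using generate.eng[of _ "add_monoid M"] by simp
  show "a \<odot>\<^bsub>M\<^esub> x \<in> socle R M" if a: "a \<in> carrier R" and x: "x \<in> socle R M" for a x
    using x unfolding socle_def
  proof (induction rule: generate.induct)
    case one
    then show ?case using a generate.one[of "add_monoid M"] by simp
  next
    case (incl h)
    then show ?case using sub_smult[OF _ a] by (auto simp: simple_submodule_def intro!: generate.incl)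
  next
    case (inv h)
    then obtain S where S: "simple_submodule S R M" "h \<in> S" by auto
    then have sub: "submodule S R M" by (simp add: simple_submodule_def)
    have "a \<odot>\<^bsub>M\<^esub> (\<ominus>\<^bsub>M\<^esub> h) \<in> S" using sub_smult[OF sub a] sub_neg[OF sub] S by auto
    then show ?case unfolding a_inv_def[symmetric] using S by (auto intro!: generate.incl)
  next
    case (eng h1 h2)
    then have "h1 \<in> carrier M" "h2 \<in> carrier M"
      using socle_subset by (auto simp: socle_def)
    then show ?case using eng generate.eng[of _ "add_monoid M"] by (simp add: a smult_r_distr)
  qed
qed

lemma submodule_cyclic:
  assumes "v \<in> carrier M" shows "submodule ((\<lambda>a. a \<odot>\<^bsub>M\<^esub> v) ` carrier R) R M"
proof (rule submoduleI)
  show "\<zero>\<^bsub>M\<^esub> \<in> (\<lambda>a. a \<odot>\<^bsub>M\<^esub> v) ` carrier R" using assms by (metis R.zero_closed imageI smult_l_null)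
qed (use assms in \<open>auto simp: smult_l_distr[symmetric] smult_assoc[symmetric]\<close>)

text \<open>
  The hypothesis says that \<open>R v\<close> is simple or zero, in terms of multiples of \<open>v\<close>.
\<close>
lemma simple_generator_in_socle:
  assumes v: "v \<in> carrier M"
    and ret: "\<And>a. a \<in> carrier R \<Longrightarrow> a \<odot>\<^bsub>M\<^esub> v = \<zero>\<^bsub>M\<^esub> \<or> (\<exists>b\<in>carrier R. b \<odot>\<^bsub>M\<^esub> (a \<odot>\<^bsub>M\<^esub> v) = v)"
  shows "v \<in> socle R M"
proof (cases "v = \<zero>\<^bsub>M\<^esub>")
  case True
  then show ?thesis using sub_zero[OF submodule_socle] by simp
next
  case False
  let ?S = "(\<lambda>a. a \<odot>\<^bsub>M\<^esub> v) ` carrier R"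
  have vS: "v \<in> ?S" using v by (metis R.one_closed imageI smult_one)
  have "N = {\<zero>\<^bsub>M\<^esub>} \<or> N = ?S" if N: "submodule N R M" "N \<subseteq> ?S" for N
  proof (cases "N = {\<zero>\<^bsub>M\<^esub>}")
    case False
    then obtain w where "w \<in> N" "w \<noteq> \<zero>\<^bsub>M\<^esub>" using sub_zero[OF N(1)] by auto
    moreover obtain a where "a \<in> carrier R" "w = a \<odot>\<^bsub>M\<^esub> v" using \<open>w \<in> N\<close> N(2) by blast
    ultimately obtain b where "b \<in> carrier R" "b \<odot>\<^bsub>M\<^esub> w = v" using ret by blast
    then have "v \<in> N" using sub_smult[OF N(1) _ \<open>w \<in> N\<close>] by blast
    then show ?thesis using N(2) sub_smult[OF N(1)] by blast
  qed simp
  then have "simple_submodule ?S R M"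
    using vS False submodule_cyclic[OF v] by (auto simp: simple_submodule_def)
  then show ?thesis using vS by (auto simp: socle_def intro: generate.incl)
qed

text \<open>
  The socle is the smallest submodule that contains all simple ones, so some simple submodule has
  an element \<open>y\<close> outside \<open>N\<close>; every nonzero multiple of \<open>y\<close> generates that submodule.
\<close>
lemma simple_outside_submodule:
  assumes N: "submodule N R M" and soc: "\<not> socle R M \<subseteq> N"
  shows "\<exists>y\<in>carrier M - N. \<forall>a\<in>carrier R. a \<odot>\<^bsub>M\<^esub> y \<in> N \<or> (\<exists>b\<in>carrier R. b \<odot>\<^bsub>M\<^esub> (a \<odot>\<^bsub>M\<^esub> y) = y)"
proof -
  interpret N: submodule N R M by (rule N)
  have "socle R M \<subseteq> N" if "\<Union>{S. simple_submodule S R M} \<subseteq> N"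
    unfolding socle_def
    by (rule M.add.generate_subgroup_incl[OF that N.subgroup_axioms])
  then obtain S y where S: "simple_submodule S R M" and y: "y \<in> S" "y \<notin> N" using soc by blast
  have sub: "submodule S R M" using S by (simp add: simple_submodule_def)
  have yc: "y \<in> carrier M" using sub_carr[OF sub y(1)] .
  have "\<exists>b\<in>carrier R. b \<odot>\<^bsub>M\<^esub> (a \<odot>\<^bsub>M\<^esub> y) = y" if a: "a \<in> carrier R" and n: "a \<odot>\<^bsub>M\<^esub> y \<notin> N" for a
  proof -
    let ?T = "(\<lambda>b. b \<odot>\<^bsub>M\<^esub> (a \<odot>\<^bsub>M\<^esub> y)) ` carrier R"
    have ay: "a \<odot>\<^bsub>M\<^esub> y \<in> S" using sub_smult[OF sub] a y by auto
    have T: "submodule ?T R M" "?T \<subseteq> S"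
      using submodule_cyclic a yc sub_smult[OF sub _ ay] by auto
    have "a \<odot>\<^bsub>M\<^esub> y \<in> ?T" using a yc by (metis R.one_closed imageI smult_one smult_closed)
    moreover have "a \<odot>\<^bsub>M\<^esub> y \<noteq> \<zero>\<^bsub>M\<^esub>" using n sub_zero[OF N] by auto
    ultimately have "?T = S" using S T unfolding simple_submodule_def by blast
    then obtain b where "b \<in> carrier R" "y = b \<odot>\<^bsub>M\<^esub> (a \<odot>\<^bsub>M\<^esub> y)" using y by blast
    then show ?thesis by metis
  qed
  then show ?thesis using y yc by blast
qed

text \<open>
  This is \<open>simple_outside_submodule\<close> for \<open>M / L\<close> and \<open>N / L\<close>, stated with representatives.
\<close>
lemma simple_outside_submodule_quot:
  assumes L: "submodule L R M" and N: "submodule N R M" and LN: "L \<subseteq> N"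
    and soc: "\<not> (\<forall>x\<in>carrier M. L +>\<^bsub>M\<^esub> x \<in> socle R (quot_module M L) \<longrightarrow> x \<in> N)"
  shows "\<exists>y\<in>carrier M - N. \<forall>a\<in>carrier R. a \<odot>\<^bsub>M\<^esub> y \<in> N \<or>
           (\<exists>b\<in>carrier R. b \<odot>\<^bsub>M\<^esub> (a \<odot>\<^bsub>M\<^esub> y) \<ominus>\<^bsub>M\<^esub> y \<in> N)"
proof -
  interpret Q: left_module R "quot_module M L" by (rule left_module_quot[OF L])
  let ?N = "(\<lambda>x. L +>\<^bsub>M\<^esub> x) ` N"
  have mem: "L +>\<^bsub>M\<^esub> x \<in> ?N \<longleftrightarrow> x \<in> N" if "x \<in> carrier M" for x
  proof
    assume "L +>\<^bsub>M\<^esub> x \<in> ?N"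
    then obtain n where n: "n \<in> N" "L +>\<^bsub>M\<^esub> x = L +>\<^bsub>M\<^esub> n" by auto
    then have "x \<ominus>\<^bsub>M\<^esub> n \<in> N" using coset_eq_iff[OF L that] sub_carr[OF N] LN by auto
    then show "x \<in> N" using sub_diff_left[OF N that] sub_carr[OF N] n by auto
  qed auto
  have subN: "submodule ?N R (quot_module M L)"
  proof (rule Q.submoduleI)
    show "?N \<subseteq> carrier (quot_module M L)" using coset_in_quot[OF L] sub_carr[OF N] by (auto simp: L)
    show "\<zero>\<^bsub>quot_module M L\<^esub> \<in> ?N"
      using coset_zero_iff[OF L, of "\<zero>\<^bsub>M\<^esub>"] sub_zero[OF L] sub_zero[OF N] by (auto simp: L image_iff)
  qed (use sub_carr[OF N] in \<open>auto simp: L coset_add quot_smult sub_add[OF N] sub_smult[OF N]\<close>)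
  have "\<not> socle R (quot_module M L) \<subseteq> ?N" using soc mem by blast
  from Q.simple_outside_submodule[OF subN this] obtain Y where
    Y: "Y \<in> carrier (quot_module M L) - ?N" and
    simp: "\<forall>a\<in>carrier R. a \<odot>\<^bsub>quot_module M L\<^esub> Y \<in> ?N \<or>
        (\<exists>b\<in>carrier R. b \<odot>\<^bsub>quot_module M L\<^esub> (a \<odot>\<^bsub>quot_module M L\<^esub> Y) = Y)" by blast
  obtain y where y: "y \<in> carrier M" "Y = L +>\<^bsub>M\<^esub> y" using Y coset_rep[OF L] by (auto simp: L)
  show ?thesis
  proof (intro bexI[of _ y] ballI)
    show "y \<in> carrier M - N" using y Y by auto
    fix a assume a: "a \<in> carrier R"
    from simp[rule_format, OF a]
    show "a \<odot>\<^bsub>M\<^esub> y \<in> N \<or> (\<exists>b\<in>carrier R. b \<odot>\<^bsub>M\<^esub> (a \<odot>\<^bsub>M\<^esub> y) \<ominus>\<^bsub>M\<^esub> y \<in> N)"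
      using y a mem LN by (auto simp: quot_smult[OF L] coset_eq_iff[OF L])
  qed
qed

end

section \<open>Left ideals and the Jacobson radical\<close>

abbreviation left_ideal :: "'a set \<Rightarrow> ('a, 'c) ring_scheme \<Rightarrow> bool" where
  "left_ideal N R \<equiv> submodule N R (regular_module R)"

lemma regular_module_simps [simp]:
  "carrier (regular_module R) = carrier R" "\<zero>\<^bsub>regular_module R\<^esub> = \<zero>\<^bsub>R\<^esub>"
  "add (regular_module R) = add R" "x \<odot>\<^bsub>regular_module R\<^esub> y = x \<otimes>\<^bsub>R\<^esub> y"
  by (simp_all add: regular_module_def ring.defs module.defs)

lemma a_inv_regular_module [simp]: "\<ominus>\<^bsub>regular_module R\<^esub> x = \<ominus>\<^bsub>R\<^esub> x"
  by (simp add: a_inv_def m_inv_def)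

lemma a_minus_regular_module [simp]: "x \<ominus>\<^bsub>regular_module R\<^esub> y = x \<ominus>\<^bsub>R\<^esub> y"
  by (simp add: a_minus_def)

lemma a_r_coset_regular_module [simp]: "N +>\<^bsub>regular_module R\<^esub> x = N +>\<^bsub>R\<^esub> x"
  by (simp add: a_r_coset_def')

lemma (in ring) left_module_regular: "left_module R (regular_module R)"
proof (intro left_module.intro left_module_axioms.intro ring_axioms)
  show "abelian_group (regular_module R)"
    by (rule abelian_groupI) (use l_neg in \<open>auto simp: a_assoc intro: a_comm bexI[of _ "\<ominus> _"]\<close>)
qed (auto simp: l_distr r_distr m_assoc)

context ring
begin

interpretation reg: left_module R "regular_module R" by (rule left_module_regular)

lemma left_idealI:
  assumes "N \<subseteq> carrier R" "\<zero> \<in> N" "\<And>x y. x \<in> N \<Longrightarrow> y \<in> N \<Longrightarrow> x \<oplus> y \<in> N"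
    "\<And>a x. a \<in> carrier R \<Longrightarrow> x \<in> N \<Longrightarrow> a \<otimes> x \<in> N"
  shows "left_ideal N R"
  using reg.submoduleI[of N] assms by simp

lemma l_diff_distr: "x \<in> carrier R \<Longrightarrow> y \<in> carrier R \<Longrightarrow> z \<in> carrier R \<Longrightarrow> (x \<ominus> y) \<otimes> z = x \<otimes> z \<ominus> y \<otimes> z"
  by (simp add: minus_eq l_distr l_minus)

lemma r_diff_distr: "x \<in> carrier R \<Longrightarrow> y \<in> carrier R \<Longrightarrow> z \<in> carrier R \<Longrightarrow> z \<otimes> (x \<ominus> y) = z \<otimes> x \<ominus> z \<otimes> y"
  by (simp add: minus_eq r_distr r_minus)

lemma diff_self [simp]: "x \<in> carrier R \<Longrightarrow> x \<ominus> x = \<zero>"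
  by (simp add: minus_eq r_neg)

lemma diff_zero [simp]: "x \<in> carrier R \<Longrightarrow> x \<ominus> \<zero> = x"
  using minus_eq by simp

context
  fixes N assumes N: "left_ideal N R"
begin

text \<open>
  The facts on submodules, for left ideals and in terms of the operations of the ring; the prefix
  stands for left ideal.
\<close>
lemmas li_rewrites = regular_module_simps a_inv_regular_module a_minus_regular_module

lemmas li_subset = reg.sub_subset[OF N, unfolded li_rewrites]
lemmas li_carr = reg.sub_carr[OF N, unfolded li_rewrites]
lemmas li_zero = reg.sub_zero[OF N, unfolded li_rewrites]
lemmas li_add = reg.sub_add[OF N, unfolded li_rewrites]
lemmas li_mult = reg.sub_smult[OF N, unfolded li_rewrites]
lemmas li_neg = reg.sub_neg[OF N, unfolded li_rewrites]
lemmas li_diff = reg.sub_diff[OF N, unfolded li_rewrites]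
lemmas li_diff_swap = reg.sub_diff_swap[OF N, unfolded li_rewrites]
lemmas li_diff_trans = reg.sub_diff_trans[OF N, unfolded li_rewrites]
lemmas li_diff_left = reg.sub_diff_left[OF N, unfolded li_rewrites]
lemmas li_diff_right = reg.sub_diff_right[OF N, unfolded li_rewrites]

lemma li_one: "\<one> \<in> N \<Longrightarrow> N = carrier R"
  using li_mult[of _ \<one>] li_subset by auto

lemma li_subgroup: "subgroup N (add_monoid R)"
  using li_subset li_zero li_add li_neg
  by (intro subgroup.intro) (auto simp: a_inv_def[symmetric])

lemma left_ideal_colon:
  assumes "y \<in> carrier R" shows "left_ideal {a \<in> carrier R. a \<otimes> y \<in> N} R"
  by (rule left_idealI) (use assms in \<open>auto simp: li_zero l_distr m_assoc intro: li_add li_mult\<close>)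

end

lemma left_ideal_Int: "left_ideal N R \<Longrightarrow> left_ideal N' R \<Longrightarrow> left_ideal (N \<inter> N') R"
  by (rule left_idealI) (auto intro: li_zero li_add li_mult dest: li_carr)

lemma left_ideal_carrier: "left_ideal (carrier R) R"
  by (rule left_idealI) auto

lemma left_ideal_zero: "left_ideal {\<zero>} R"
  by (rule left_idealI) auto

lemma left_ideal_sum:
  assumes "left_ideal N R" "left_ideal N' R"
  shows "left_ideal {x \<oplus> y | x y. x \<in> N \<and> y \<in> N'} R"
proof (rule left_idealI)
  show "{x \<oplus> y |x y. x \<in> N \<and> y \<in> N'} \<subseteq> carrier R" using assms li_carr by blast
  show "\<zero> \<in> {x \<oplus> y |x y. x \<in> N \<and> y \<in> N'}" using assms li_zero by force
  fix u v assume "u \<in> {x \<oplus> y |x y. x \<in> N \<and> y \<in> N'}" "v \<in> {x \<oplus> y |x y. x \<in> N \<and> y \<in> N'}"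
  then obtain a b c d where *: "u = a \<oplus> b" "v = c \<oplus> d" "a \<in> N" "b \<in> N'" "c \<in> N" "d \<in> N'" by blast
  then have "u \<oplus> v = (a \<oplus> c) \<oplus> (b \<oplus> d)" using assms li_carr by (simp add: a_ac)
  then show "u \<oplus> v \<in> {x \<oplus> y |x y. x \<in> N \<and> y \<in> N'}" using * assms li_add by blast
next
  fix a u assume a: "a \<in> carrier R" and "u \<in> {x \<oplus> y |x y. x \<in> N \<and> y \<in> N'}"
  then obtain x y where *: "u = x \<oplus> y" "x \<in> N" "y \<in> N'" by blast
  then have "a \<otimes> u = a \<otimes> x \<oplus> a \<otimes> y" using assms li_carr a by (simp add: r_distr)
  then show "a \<otimes> u \<in> {x \<oplus> y |x y. x \<in> N \<and> y \<in> N'}" using * assms li_mult a by blast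
qed

lemma left_ideal_principal:
  assumes "v \<in> carrier R" shows "left_ideal ((\<lambda>a. a \<otimes> v) ` carrier R) R"
  using reg.submodule_cyclic[of v] assms by simp

lemma ideal_left_ideal: "ideal I R \<Longrightarrow> left_ideal I R"
  by (rule left_idealI)
    (auto dest: ideal.Icarr intro: ideal.I_l_closed additive_subgroup.zero_closed additive_subgroup.a_closed
       ideal.axioms(1))

lemma left_ideal_idealI:
  assumes "left_ideal I R" "\<And>x a. x \<in> I \<Longrightarrow> a \<in> carrier R \<Longrightarrow> x \<otimes> a \<in> I"
  shows "ideal I R"
  by (rule idealI) (use assms ring_axioms li_subgroup li_mult in auto)

text \<open>
  Zorn's lemma. With \<open>P = {1}\<close> it gives maximal left ideals; T-nilpotence of the radical uses it
  with the set of partial products of a sequence.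
\<close>
lemma left_ideal_maximal_avoiding:
  assumes N: "left_ideal N R" and P: "N \<inter> P = {}"
  obtains M where "left_ideal M R" "N \<subseteq> M" "M \<inter> P = {}"
    "\<And>L. left_ideal L R \<Longrightarrow> M \<subset> L \<Longrightarrow> L \<inter> P \<noteq> {}"
proof -
  let ?S = "{M. left_ideal M R \<and> N \<subseteq> M \<and> M \<inter> P = {}}"
  have "\<exists>M\<in>?S. \<forall>X\<in>?S. M \<subseteq> X \<longrightarrow> X = M"
  proof (rule subset_Zorn_nonempty)
    show "?S \<noteq> {}" using N P by auto
    fix C assume C: "C \<noteq> {}" "subset.chain ?S C"
    have li: "left_ideal M R" "N \<subseteq> M" "M \<inter> P = {}" if "M \<in> C" for M
      using that C(2) by (auto simp: subset.chain_def)
    have tot: "M \<subseteq> M' \<or> M' \<subseteq> M" if "M \<in> C" "M' \<in> C" for M M'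
    proof -
      have "\<forall>x\<in>C. \<forall>y\<in>C. x \<subset> y \<or> x = y \<or> y \<subset> x \<or> y = x" using C(2) unfolding subset.chain_def by simp
      from this[rule_format, OF that] have "M \<subset> M' \<or> M = M' \<or> M' \<subset> M \<or> M' = M" .
      then show ?thesis by blast
    qed
    have "left_ideal (\<Union>C) R"
    proof (rule left_idealI)
      show "\<Union>C \<subseteq> carrier R" using li(1) li_subset by blast
      obtain M where "M \<in> C" using C(1) by blast
      then show "\<zero> \<in> \<Union>C" using li_zero[OF li(1)] by blast
      show "a \<otimes> x \<in> \<Union>C" if a: "a \<in> carrier R" and x: "x \<in> \<Union>C" for a x
      proof -
        obtain M where M: "M \<in> C" "x \<in> M" using x by blast
        then show ?thesis using li_mult[OF li(1)[OF M(1)] a M(2)] by blast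
      qed
      fix x y assume "x \<in> \<Union>C" "y \<in> \<Union>C"
      then obtain M M' where M: "M \<in> C" "x \<in> M" "M' \<in> C" "y \<in> M'" by blast
      obtain L where L: "L \<in> C" "x \<in> L" "y \<in> L"
        using tot[OF M(1,3)] M by (elim disjE) (use M in blast)+
      then show "x \<oplus> y \<in> \<Union>C" using li_add[OF li(1)[OF L(1)]] by blast
    qed
    then show "\<Union>C \<in> ?S" using li C(1) by blast
  qed
  then obtain M where "M \<in> ?S" "\<forall>X\<in>?S. M \<subseteq> X \<longrightarrow> X = M" by blast
  then show ?thesis by (intro that[of M]) blast+
qed

text \<open>
  The submodule of \<open>R / N\<close> generated by the class of \<open>y\<close> is simple or zero.
\<close>
definition simple_over :: "'a set \<Rightarrow> 'a \<Rightarrow> bool" where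
  "simple_over N y \<longleftrightarrow> y \<in> carrier R \<and>
     (\<forall>a\<in>carrier R. a \<otimes> y \<in> N \<or> (\<exists>b\<in>carrier R. b \<otimes> (a \<otimes> y) \<ominus> y \<in> N))"

lemma colon_simple_over_maximal:
  assumes N: "left_ideal N R" and y: "simple_over N y" "y \<notin> N"
  shows "maximal_left_ideal {a \<in> carrier R. a \<otimes> y \<in> N} R"
  unfolding maximal_left_ideal_def
proof (intro conjI allI impI)
  let ?m = "{a \<in> carrier R. a \<otimes> y \<in> N}"
  have yc: "y \<in> carrier R" using y by (simp add: simple_over_def)
  show "left_ideal ?m R" using left_ideal_colon N yc .
  show "?m \<noteq> carrier R"
  proof
    assume "?m = carrier R"
    then have "\<one> \<in> ?m" by simp
    then show False using yc y by simp
  qed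
  fix L assume L: "left_ideal L R \<and> ?m \<subseteq> L"
  show "L = ?m \<or> L = carrier R"
  proof (cases "L = ?m")
    case False
    then obtain a where a: "a \<in> L" "a \<otimes> y \<notin> N" "a \<in> carrier R" using L li_carr by blast
    then obtain b where b: "b \<in> carrier R" "b \<otimes> (a \<otimes> y) \<ominus> y \<in> N" using y by (auto simp: simple_over_def)
    have "(b \<otimes> a \<ominus> \<one>) \<otimes> y = b \<otimes> (a \<otimes> y) \<ominus> y" using a b yc by (simp add: l_diff_distr m_assoc)
    then have "b \<otimes> a \<ominus> \<one> \<in> L" using L a b by auto
    moreover have "b \<otimes> a \<in> L" using L a b li_mult by blast
    ultimately have "\<one> \<in> L" using li_diff_right[of L "b \<otimes> a" \<one>] L a b by blast
    then show ?thesis using L li_one by blast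
  qed simp
qed

text \<open>
  \<open>R / m\<close> is simple, so each of its nonzero elements generates it.
\<close>
lemma simple_over_maximal:
  assumes m: "maximal_left_ideal m R" and r: "r \<in> carrier R"
  shows "simple_over m r"
  unfolding simple_over_def
proof (intro conjI ballI r)
  fix a assume a: "a \<in> carrier R"
  have li: "left_ideal m R" using m by (simp add: maximal_left_ideal_def)
  let ?v = "a \<otimes> r"
  have v: "?v \<in> carrier R" using a r by simp
  let ?L = "{x \<oplus> y | x y. x \<in> m \<and> y \<in> (\<lambda>b. b \<otimes> ?v) ` carrier R}"
  have L: "left_ideal ?L R" using left_ideal_sum[OF li left_ideal_principal[OF v]] .
  have mem: "x \<oplus> b \<otimes> ?v \<in> ?L" if "x \<in> m" "b \<in> carrier R" for x b using that by blast
  have ar: "?v \<in> ?L" using mem[OF li_zero[OF li] one_closed] v by simp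
  have "x \<in> ?L" if x: "x \<in> m" for x
    using mem[OF x zero_closed] li_carr[OF li x] v by simp
  then have "m \<subseteq> ?L" by blast
  with m L have "?L = m \<or> ?L = carrier R" unfolding maximal_left_ideal_def by blast
  then show "a \<otimes> r \<in> m \<or> (\<exists>b\<in>carrier R. b \<otimes> (a \<otimes> r) \<ominus> r \<in> m)"
  proof
    assume "?L = m" then show ?thesis using ar by blast
  next
    assume "?L = carrier R"
    then obtain x b where xb: "x \<in> m" "b \<in> carrier R" "r = x \<oplus> b \<otimes> (a \<otimes> r)" using r by blast
    have xc: "x \<in> carrier R" using li_carr[OF li] xb by blast
    define c where "c = b \<otimes> (a \<otimes> r)"
    have c: "c \<in> carrier R" using xb a r by (simp add: c_def)
    have "c \<ominus> (x \<oplus> c) = \<ominus> x" using xc c by (simp add: minus_eq minus_add a_ac r_neg r_neg1 r_neg2)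
    then have "b \<otimes> (a \<otimes> r) \<ominus> r \<in> m" using xb li_neg[OF li] by (metis c_def)
    then show ?thesis using xb by blast
  qed
qed

lemma Jac_subset: "Jac R \<subseteq> carrier R"
  by (simp add: Jac_def)

text \<open>
  The radical kills simple modules: the annihilator of \<open>y\<close> modulo \<open>N\<close> is a maximal left ideal.
\<close>
lemma Jac_mult_simple:
  assumes N: "left_ideal N R" and y: "simple_over N y" and j: "j \<in> Jac R"
  shows "j \<otimes> y \<in> N"
proof (cases "y \<in> N")
  case True
  then show ?thesis using li_mult[OF N] j Jac_subset by blast
next
  case False
  then show ?thesis using colon_simple_over_maximal[OF N y] j by (auto simp: Jac_def)
qed

lemma ideal_Jac: "ideal (Jac R) R"
proof (rule left_ideal_idealI)
  have li: "left_ideal m R" if "maximal_left_ideal m R" for m using that by (simp add: maximal_left_ideal_def)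
  show "left_ideal (Jac R) R"
    by (rule left_idealI) (auto simp: Jac_def intro: li_zero li_add li_mult dest: li)
  show "x \<otimes> a \<in> Jac R" if "x \<in> Jac R" "a \<in> carrier R" for x a
    using that Jac_mult_simple[OF li simple_over_maximal] Jac_subset by (auto simp: Jac_def)
qed

lemma Jac_left_inverse:
  assumes "x \<in> Jac R" obtains b where "b \<in> carrier R" "b \<otimes> (\<one> \<ominus> x) = \<one>"
proof -
  have x: "x \<in> carrier R" using assms Jac_subset by blast
  let ?N = "(\<lambda>b. b \<otimes> (\<one> \<ominus> x)) ` carrier R"
  have N: "left_ideal ?N R" using left_ideal_principal x by simp
  have "\<one> \<in> ?N"
  proof (rule ccontr)
    assume "\<one> \<notin> ?N"
    then have "?N \<inter> {\<one>} = {}" by simp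
    then obtain m where m: "left_ideal m R" "?N \<subseteq> m" "m \<inter> {\<one>} = {}"
      "\<And>L. left_ideal L R \<Longrightarrow> m \<subset> L \<Longrightarrow> L \<inter> {\<one>} \<noteq> {}"
      using left_ideal_maximal_avoiding[OF N] by blast
    have "maximal_left_ideal m R"
      unfolding maximal_left_ideal_def using m li_one by blast
    then have "x \<in> m" using assms by (auto simp: Jac_def)
    moreover have "\<one> \<ominus> x \<in> ?N" using x by (intro image_eqI[of _ _ \<one>]) simp_all
    ultimately have "\<one> \<in> m" using li_diff_left[OF m(1), of \<one> x] x m(2) by blast
    then show False using m(3) by blast
  qed
  then obtain b where "b \<in> carrier R" "\<one> = b \<otimes> (\<one> \<ominus> x)" by blast
  then show ?thesis using that by metis
qed

text \<open>
  If \<open>x \<in> X\<close> were not in a maximal left ideal \<open>m\<close>, then \<open>1 - b x \<in> m\<close> for some \<open>b\<close>, which is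
  impossible for a left invertible element.
\<close>
lemma left_quasiregular_subset_Jac:
  assumes X: "left_ideal X R" and inv: "\<And>x. x \<in> X \<Longrightarrow> \<exists>b\<in>carrier R. b \<otimes> (\<one> \<ominus> x) = \<one>"
  shows "X \<subseteq> Jac R"
proof -
  have "x \<in> m" if x: "x \<in> X" and m: "maximal_left_ideal m R" for x m
  proof (rule ccontr)
    assume "x \<notin> m"
    have li: "left_ideal m R" and ne: "m \<noteq> carrier R" using m by (auto simp: maximal_left_ideal_def)
    have xc: "x \<in> carrier R" using li_carr[OF X x] .
    obtain b where b: "b \<in> carrier R" "b \<otimes> (x \<otimes> \<one>) \<ominus> \<one> \<in> m"
      using simple_over_maximal[OF m, of \<one>] xc \<open>x \<notin> m\<close> by (auto simp: simple_over_def)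
    then have "\<one> \<ominus> b \<otimes> x \<in> m" using li_diff_swap[OF li] xc by simp
    moreover obtain c where "c \<in> carrier R" "c \<otimes> (\<one> \<ominus> b \<otimes> x) = \<one>"
      using inv[of "b \<otimes> x"] li_mult[OF X b(1) x] by blast
    ultimately have "\<one> \<in> m" using li_mult[OF li] by metis
    then show False using li_one[OF li] ne by blast
  qed
  then show ?thesis using li_subset[OF X] by (auto simp: Jac_def)
qed

end

section \<open>The opposite ring\<close>

lemma opposite_ring_simps [simp]:
  "carrier (opposite_ring R) = carrier R" "\<zero>\<^bsub>opposite_ring R\<^esub> = \<zero>\<^bsub>R\<^esub>" "\<one>\<^bsub>opposite_ring R\<^esub> = \<one>\<^bsub>R\<^esub>"
  "add (opposite_ring R) = add R" "x \<otimes>\<^bsub>opposite_ring R\<^esub> y = y \<otimes>\<^bsub>R\<^esub> x"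
  by (simp_all add: opposite_ring_def)

lemma add_monoid_opposite_ring [simp]: "add_monoid (opposite_ring R) = add_monoid R"
  by simp

lemma a_inv_opposite_ring [simp]: "\<ominus>\<^bsub>opposite_ring R\<^esub> x = \<ominus>\<^bsub>R\<^esub> x"
  by (simp add: a_inv_def)

lemma a_minus_opposite_ring [simp]: "x \<ominus>\<^bsub>opposite_ring R\<^esub> y = x \<ominus>\<^bsub>R\<^esub> y"
  by (simp add: a_minus_def)

lemma opposite_opposite_ring [simp]: "opposite_ring (opposite_ring R) = R"
  by (simp add: opposite_ring_def)

lemma ring_opposite_ring:
  fixes R (structure)
  assumes "ring R" shows "ring (opposite_ring R)"
proof -
  interpret ring R by fact
  show ?thesis
    by (rule ringI, rule abelian_groupI)
      (use l_neg in \<open>auto simp: a_assoc m_assoc l_distr r_distr intro: a_comm bexI[of _ "\<ominus> _"] intro!: monoid.intro\<close>)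
qed

lemma ideal_opposite_ring:
  fixes R (structure)
  assumes "ring R" "ideal I (opposite_ring R)" shows "ideal I R"
proof -
  interpret ring R by fact
  interpret I: ideal I "opposite_ring R" by fact
  show ?thesis
    by (rule idealI) (use ring_axioms I.a_subgroup I.I_l_closed I.I_r_closed in auto)
qed

text \<open>
  For \<open>x\<close> in the right radical, \<open>1 - x\<close> has a right inverse \<open>c = 1 + x c\<close>. Since \<open>- x c\<close> is in the
  right radical as well, \<open>c\<close> also has a right inverse, which has to be \<open>1 - x\<close>. So \<open>c\<close> is a
  two-sided inverse.
\<close>
lemma Jac_opposite_ring_subset:
  fixes R (structure)
  assumes "ring R" shows "Jac (opposite_ring R) \<subseteq> Jac R"
proof -
  interpret ring R by fact
  interpret op: ring "opposite_ring R" by (rule ring_opposite_ring) fact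
  let ?J = "Jac (opposite_ring R)"
  have id: "ideal ?J R" using ideal_opposite_ring assms op.ideal_Jac by blast
  have li: "left_ideal ?J R" using ideal_left_ideal id .
  show ?thesis
  proof (rule left_quasiregular_subset_Jac[OF li])
    fix x assume x: "x \<in> ?J"
    have xc: "x \<in> carrier R" using op.Jac_subset x by auto
    obtain c where c: "c \<in> carrier R" "(\<one> \<ominus> x) \<otimes> c = \<one>" using op.Jac_left_inverse[OF x] by auto
    have xJ: "\<ominus> (x \<otimes> c) \<in> ?J" using li_neg[OF li] ideal.I_r_closed[OF id x c(1)] by blast
    have "c \<ominus> x \<otimes> c = \<one>" using c xc by (simp add: l_diff_distr)
    moreover have "(c \<ominus> x \<otimes> c) \<oplus> x \<otimes> c = c" using c xc by (simp add: minus_eq a_assoc l_neg)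
    ultimately have "\<one> \<ominus> \<ominus> (x \<otimes> c) = c" using c xc by (simp add: minus_eq)
    then obtain d where d: "d \<in> carrier R" "c \<otimes> d = \<one>" using op.Jac_left_inverse[OF xJ] by auto
    have "d = ((\<one> \<ominus> x) \<otimes> c) \<otimes> d" using c d by simp
    also have "\<dots> = (\<one> \<ominus> x) \<otimes> (c \<otimes> d)" using c(1) d(1) xc by (simp add: m_assoc)
    also have "\<dots> = \<one> \<ominus> x" using d xc by simp
    finally show "\<exists>b\<in>carrier R. b \<otimes> (\<one> \<ominus> x) = \<one>" using d c by blast
  qed
qed

lemma Jac_opposite_ring: assumes "ring R" shows "Jac (opposite_ring R) = Jac R"
  using Jac_opposite_ring_subset[OF assms] Jac_opposite_ring_subset[OF ring_opposite_ring[OF assms]] by simp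

section \<open>Families of subsets of bounded length\<close>

text \<open>
  Finite length, witnessed by a bounded strictly monotone rank. It yields both chain conditions,
  and it passes to subfamilies, hence from subspaces to left and to right ideals.
\<close>
definition bounded_length :: "'a set set \<Rightarrow> bool" where
  "bounded_length \<N> \<longleftrightarrow> (\<exists>(l :: 'a set \<Rightarrow> nat) d.
     \<forall>N\<in>\<N>. l N \<le> d \<and> (\<forall>N'\<in>\<N>. N \<subset> N' \<longrightarrow> l N < l N'))"

lemma bounded_length_minimal:
  assumes "bounded_length \<N>" "\<M> \<subseteq> \<N>" "\<M> \<noteq> {}"
  obtains M where "M \<in> \<M>" "\<And>N. N \<in> \<M> \<Longrightarrow> \<not> N \<subset> M"
proof -
  obtain l d where ld: "\<forall>N\<in>\<N>. l N \<le> d \<and> (\<forall>N'\<in>\<N>. N \<subset> N' \<longrightarrow> l N < (l N' :: nat))"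
    using assms(1) unfolding bounded_length_def by blast
  obtain M where "M \<in> \<M>" "\<forall>N\<in>\<M>. l M \<le> l N"
    using ex_has_least_nat[of "\<lambda>N. N \<in> \<M>" _ l] assms(3) by blast
  then have "\<not> N \<subset> M" if "N \<in> \<M>" for N using that ld assms(2) by (metis linorder_not_less subsetD)
  with \<open>M \<in> \<M>\<close> show ?thesis using that by blast
qed

lemma bounded_length_maximal:
  assumes "bounded_length \<N>" "\<M> \<subseteq> \<N>" "\<M> \<noteq> {}"
  obtains M where "M \<in> \<M>" "\<And>N. N \<in> \<M> \<Longrightarrow> \<not> M \<subset> N"
proof -
  obtain l d where ld: "\<forall>N\<in>\<N>. l N \<le> d \<and> (\<forall>N'\<in>\<N>. N \<subset> N' \<longrightarrow> l N < (l N' :: nat))"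
    using assms(1) unfolding bounded_length_def by blast
  obtain M0 where M0: "M0 \<in> \<M>" using assms(3) by blast
  have "\<forall>N. N \<in> \<M> \<longrightarrow> l N < Suc d" using ld assms(2) by (auto simp: less_Suc_eq_le)
  from ex_has_greatest_nat[of "\<lambda>N. N \<in> \<M>", OF M0 this]
  obtain M where "M \<in> \<M>" "\<forall>N\<in>\<M>. l N \<le> l M" by blast
  then have "\<not> M \<subset> N" if "N \<in> \<M>" for N using that ld assms(2) by (metis linorder_not_less subsetD)
  with \<open>M \<in> \<M>\<close> show ?thesis using that by blast
qed

lemma bounded_length_image:
  assumes bl: "bounded_length \<N>'" and f: "\<And>N. N \<in> \<N> \<Longrightarrow> f N \<in> \<N>'"
    and mono: "\<And>N N'. N \<in> \<N> \<Longrightarrow> N' \<in> \<N> \<Longrightarrow> N \<subset> N' \<Longrightarrow> f N \<subset> f N'"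
  shows "bounded_length \<N>"
proof -
  obtain l d where ld: "\<forall>N\<in>\<N>'. l N \<le> d \<and> (\<forall>N'\<in>\<N>'. N \<subset> N' \<longrightarrow> l N < (l N' :: nat))"
    using bl unfolding bounded_length_def by blast
  have "l (f N) \<le> d \<and> (\<forall>N'\<in>\<N>. N \<subset> N' \<longrightarrow> l (f N) < l (f N'))" if N: "N \<in> \<N>" for N
    using ld[rule_format, OF f[OF N]] f mono[OF N] by simp
  then show ?thesis unfolding bounded_length_def by (intro exI[of _ "\<lambda>N. l (f N)"] exI[of _ d]) simp
qed

lemma bounded_length_subset: "bounded_length \<N>' \<Longrightarrow> \<N> \<subseteq> \<N>' \<Longrightarrow> bounded_length \<N>"
  using bounded_length_image[of \<N>' \<N> "\<lambda>N. N"] by blast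

section \<open>Semisimplicity modulo the radical\<close>

lemma generate_additive_map:
  assumes "abelian_group R" "abelian_group M"
    and f: "\<And>x. x \<in> carrier R \<Longrightarrow> f x \<in> carrier M"
      "\<And>x y. x \<in> carrier R \<Longrightarrow> y \<in> carrier R \<Longrightarrow> f (x \<oplus>\<^bsub>R\<^esub> y) = f x \<oplus>\<^bsub>M\<^esub> f y"
    and T: "T \<subseteq> carrier R" and H: "subgroup H (add_monoid M)" "f ` T \<subseteq> H"
    and x: "x \<in> generate (add_monoid R) T"
  shows "f x \<in> H"
proof -
  interpret R: abelian_group R by fact
  interpret M: abelian_group M by fact
  interpret group_hom "add_monoid R" "add_monoid M" f
    using f by (intro group_hom.intro group_hom_axioms.intro R.a_group M.a_group) (auto simp: hom_def)
  interpret subgroup H "add_monoid M" by fact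
  have T': "\<And>h. h \<in> T \<Longrightarrow> h \<in> carrier R" using T by blast
  have gc: "generate (add_monoid R) T \<subseteq> carrier R" using R.add.generate_incl T by simp
  show ?thesis using x
  proof (induction rule: generate.induct)
    case one then show ?case using hom_one one_closed by simp
  next
    case (incl h) then show ?case using H by auto
  next
    case (inv h)
    then show ?case using hom_inv[of h] T' H m_inv_closed[of "f h"] by auto
  next
    case (eng h1 h2)
    then have "h1 \<in> carrier R" "h2 \<in> carrier R" using gc by blast+
    then show ?case using eng f m_closed[of "f h1" "f h2"] by auto
  qed
qed

context ring
begin

lemma simple_over_carrier: "Collect (simple_over N) \<subseteq> carrier R"
  by (auto simp: simple_over_def)

text \<open>
  If \<open>D\<close> is not contained in \<open>m\<close>, then \<open>1 = a + b\<close> with \<open>a \<in> D\<close> and \<open>b \<in> m\<close>, and \<open>R / (D \<inter> m)\<close> is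
  the direct sum of \<open>R b\<close>, a copy of \<open>R / D\<close>, and \<open>R a\<close>, a copy of \<open>R / m\<close>. So \<open>b\<close> is a sum of
  simple elements \<open>t b\<close>, with \<open>t\<close> simple modulo \<open>D\<close>, and \<open>a\<close> is simple.
\<close>
lemma one_in_simple_sum_Int:
  assumes D: "left_ideal D R" and gen: "\<one> \<in> generate (add_monoid R) (Collect (simple_over D))"
    and m: "maximal_left_ideal m R"
  shows "\<one> \<in> generate (add_monoid R) (Collect (simple_over (D \<inter> m)))"
proof (cases "D \<subseteq> m")
  case True
  then show ?thesis using gen by (simp add: Int_absorb2)
next
  case False
  then obtain x where x: "x \<in> D" "x \<notin> m" by blast
  have lm: "left_ideal m R" using m by (simp add: maximal_left_ideal_def)
  have xc: "x \<in> carrier R" using li_carr[OF D] x by blast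
  obtain c where c: "c \<in> carrier R" "c \<otimes> (x \<otimes> \<one>) \<ominus> \<one> \<in> m"
    using simple_over_maximal[OF m, of \<one>] xc x by (auto simp: simple_over_def)
  define a b where "a = c \<otimes> x" and "b = \<one> \<ominus> a"
  have a: "a \<in> D" "a \<in> carrier R" using li_mult[OF D] c x xc by (auto simp: a_def)
  have b: "b \<in> m" "b \<in> carrier R" using li_diff_swap[OF lm, of "c \<otimes> x" \<one>] c xc by (auto simp: a_def b_def)
  have split: "r \<otimes> b = r \<ominus> r \<otimes> a" if "r \<in> carrier R" for r using that a by (simp add: b_def r_diff_distr)
  have rb: "r \<otimes> b \<in> D \<inter> m \<longleftrightarrow> r \<in> D" if r: "r \<in> carrier R" for r
  proof -
    have "r \<otimes> a \<in> D" "r \<otimes> b \<in> m" using li_mult[OF D r a(1)] li_mult[OF lm r b(1)] by auto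
    then show ?thesis using split[OF r] li_diff[OF D, of r "r \<otimes> a"] li_diff_left[OF D r, of "r \<otimes> a"] r a
      by auto
  qed
  let ?G = "generate (add_monoid R) (Collect (simple_over (D \<inter> m)))"
  interpret G: subgroup ?G "add_monoid R"
    by (rule add.generate_is_subgroup) (simp add: simple_over_carrier)
  have "simple_over (D \<inter> m) (t \<otimes> b)" if t: "simple_over D t" for t
    unfolding simple_over_def
  proof (intro conjI ballI)
    have tc: "t \<in> carrier R" using t by (simp add: simple_over_def)
    show "t \<otimes> b \<in> carrier R" using tc b by simp
    fix r assume r: "r \<in> carrier R"
    show "r \<otimes> (t \<otimes> b) \<in> D \<inter> m \<or> (\<exists>s\<in>carrier R. s \<otimes> (r \<otimes> (t \<otimes> b)) \<ominus> t \<otimes> b \<in> D \<inter> m)"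
    proof (cases "r \<otimes> t \<in> D")
      case True
      moreover have "r \<otimes> t \<in> carrier R" using r tc by simp
      ultimately have "(r \<otimes> t) \<otimes> b \<in> D \<inter> m" using rb by blast
      then show ?thesis using r tc b by (simp add: m_assoc)
    next
      case False
      then obtain s where s: "s \<in> carrier R" "s \<otimes> (r \<otimes> t) \<ominus> t \<in> D" using t r by (auto simp: simple_over_def)
      moreover have "s \<otimes> (r \<otimes> t) \<ominus> t \<in> carrier R" using s r tc by simp
      ultimately have "(s \<otimes> (r \<otimes> t) \<ominus> t) \<otimes> b \<in> D \<inter> m" using rb by blast
      then have "s \<otimes> (r \<otimes> (t \<otimes> b)) \<ominus> t \<otimes> b \<in> D \<inter> m" using r s tc b by (simp add: m_assoc l_diff_distr)
      then show ?thesis using s by blast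
    qed
  qed
  then have "(\<lambda>t. t \<otimes> b) ` Collect (simple_over D) \<subseteq> ?G" by (auto intro: generate.incl)
  then have "\<one> \<otimes> b \<in> ?G"
    using b by (intro generate_additive_map[OF abelian_group_axioms abelian_group_axioms _ _
      simple_over_carrier G.subgroup_axioms _ gen, of "\<lambda>t. t \<otimes> b"]) (simp_all add: l_distr)
  moreover have "simple_over (D \<inter> m) a"
    unfolding simple_over_def
  proof (intro conjI ballI a)
    fix r assume r: "r \<in> carrier R"
    show "r \<otimes> a \<in> D \<inter> m \<or> (\<exists>s\<in>carrier R. s \<otimes> (r \<otimes> a) \<ominus> a \<in> D \<inter> m)"
    proof (cases "r \<otimes> a \<in> m")
      case True
      then show ?thesis using li_mult[OF D r a(1)] by blast
    next
      case False
      then obtain s where s: "s \<in> carrier R" "s \<otimes> (r \<otimes> a) \<ominus> a \<in> m"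
        using simple_over_maximal[OF m a(2)] r by (auto simp: simple_over_def)
      moreover have "s \<otimes> (r \<otimes> a) \<ominus> a \<in> D" using a r s by (intro li_diff[OF D] li_mult[OF D])
      ultimately show ?thesis by blast
    qed
  qed
  then have "a \<in> ?G" by (auto intro: generate.incl)
  ultimately have "b \<oplus> a \<in> ?G" using G.m_closed[of b a] b by simp
  moreover have "b \<oplus> a = \<one>" using a by (simp add: b_def minus_eq a_assoc l_neg)
  ultimately show ?thesis by simp
qed

text \<open>
  An intersection of finitely many maximal left ideals, chosen minimal, lies in every maximal left
  ideal and thus equals the radical. The conclusion is semisimplicity of \<open>R / Jac R\<close> expressed
  inside \<open>R\<close>, so that it can be carried to any module by the additive map \<open>t \<mapsto> t x\<close>.
\<close>
lemma one_in_simple_sum_Jac: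
  assumes bl: "bounded_length {N. left_ideal N R \<and> Jac R \<subseteq> N}"
  shows "\<one> \<in> generate (add_monoid R) (Collect (simple_over (Jac R)))"
proof -
  \<comment> \<open>This family contains \<open>R\<close> and is closed under intersection with maximal left ideals.\<close>
  let ?\<D> = "{D. left_ideal D R \<and> Jac R \<subseteq> D \<and> \<one> \<in> generate (add_monoid R) (Collect (simple_over D))}"
  have "simple_over (carrier R) \<one>" by (auto simp: simple_over_def)
  then have "carrier R \<in> ?\<D>" using left_ideal_carrier Jac_subset by (auto intro: generate.incl)
  then obtain D where D: "D \<in> ?\<D>" "\<And>N. N \<in> ?\<D> \<Longrightarrow> \<not> N \<subset> D"
    using bounded_length_minimal[OF bl, of ?\<D>] by blast
  have "D \<subseteq> m" if m: "maximal_left_ideal m R" for m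
  proof -
    have "D \<inter> m \<in> ?\<D>"
      using m D one_in_simple_sum_Int[of D m] left_ideal_Int by (auto simp: maximal_left_ideal_def Jac_def)
    then show ?thesis using D(2) by blast
  qed
  then have "D = Jac R" using D(1) li_subset[of D] unfolding Jac_def by blast
  then show ?thesis using D by blast
qed

text \<open>
  Write \<open>1\<close> as a sum of elements \<open>t\<close> that are simple modulo the radical. Then \<open>x\<close> is the sum of
  the elements \<open>t x\<close>, each of which generates a simple or zero submodule.
\<close>
lemma annihilated_by_Jac_in_socle:
  assumes M: "left_module R M" and one: "\<one> \<in> generate (add_monoid R) (Collect (simple_over (Jac R)))"
    and x: "x \<in> carrier M" "\<And>j. j \<in> Jac R \<Longrightarrow> j \<odot>\<^bsub>M\<^esub> x = \<zero>\<^bsub>M\<^esub>"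
  shows "x \<in> socle R M"
proof -
  interpret M: left_module R M by (rule M)
  interpret S: submodule "socle R M" R M by (rule M.submodule_socle)
  have "t \<odot>\<^bsub>M\<^esub> x \<in> socle R M" if t: "simple_over (Jac R) t" for t
  proof (rule M.simple_generator_in_socle)
    have tc: "t \<in> carrier R" using t by (simp add: simple_over_def)
    then show "t \<odot>\<^bsub>M\<^esub> x \<in> carrier M" using x by simp
    fix a assume a: "a \<in> carrier R"
    show "a \<odot>\<^bsub>M\<^esub> (t \<odot>\<^bsub>M\<^esub> x) = \<zero>\<^bsub>M\<^esub> \<or> (\<exists>b\<in>carrier R. b \<odot>\<^bsub>M\<^esub> (a \<odot>\<^bsub>M\<^esub> (t \<odot>\<^bsub>M\<^esub> x)) = t \<odot>\<^bsub>M\<^esub> x)"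
    proof (cases "a \<otimes> t \<in> Jac R")
      case True
      then show ?thesis using x a tc by (simp flip: M.smult_assoc)
    next
      case False
      then obtain b where b: "b \<in> carrier R" "b \<otimes> (a \<otimes> t) \<ominus> t \<in> Jac R"
        using t a by (auto simp: simple_over_def)
      then have "(b \<otimes> (a \<otimes> t)) \<odot>\<^bsub>M\<^esub> x \<ominus>\<^bsub>M\<^esub> t \<odot>\<^bsub>M\<^esub> x = \<zero>\<^bsub>M\<^esub>"
        using x a tc by (simp flip: M.smult_l_diff)
      then have "b \<odot>\<^bsub>M\<^esub> (a \<odot>\<^bsub>M\<^esub> (t \<odot>\<^bsub>M\<^esub> x)) = t \<odot>\<^bsub>M\<^esub> x"
        using a b tc x by (simp add: M.smult_assoc M.diff_eq_zero_iff)
      then show ?thesis using b by blast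
    qed
  qed
  then have "\<one> \<odot>\<^bsub>M\<^esub> x \<in> socle R M"
    using x(1) by (intro generate_additive_map[OF abelian_group_axioms M.abelian_group_axioms _ _
      simple_over_carrier S.subgroup_axioms _ one, of "\<lambda>t. t \<odot>\<^bsub>M\<^esub> x"]) (auto simp: M.smult_l_distr)
  then show ?thesis using x by simp
qed

lemma semisimple_ring_quot_Jac:
  assumes one: "\<one> \<in> generate (add_monoid R) (Collect (simple_over (Jac R)))"
  shows "semisimple_ring (R Quot Jac R)"
proof -
  let ?J = "Jac R" let ?Q = "R Quot ?J"
  interpret J: ideal ?J R by (rule ideal_Jac)
  have li: "left_ideal ?J R" by (rule ideal_left_ideal[OF ideal_Jac])
  interpret reg: left_module R "regular_module R" by (rule left_module_regular)
  have z: "?J +> x = \<zero>\<^bsub>?Q\<^esub>" if "x \<in> carrier R" "x \<in> ?J" for x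
    using reg.coset_zero_iff[OF li, of x] that
    by (simp add: FactRing_def)
  have e: "?J +> x = ?J +> y" if "x \<in> carrier R" "y \<in> carrier R" "x \<ominus> y \<in> ?J" for x y
    using reg.coset_eq_iff[OF li, of x y] that by simp
  have car: "\<exists>x\<in>carrier R. C = ?J +> x" if "C \<in> carrier ?Q" for C
    using that by (auto simp: FactRing_def A_RCOSETS_def')
  interpret Q: ring ?Q by (rule J.quotient_is_ring)
  interpret MQ: left_module ?Q "regular_module ?Q" by (rule Q.left_module_regular)
  interpret pi: ring_hom_ring R ?Q "(+>) ?J" by (rule J.rcos_ring_hom_ring)
  interpret S: submodule "socle ?Q (regular_module ?Q)" ?Q "regular_module ?Q"
    by (rule MQ.submodule_socle)
  have simple: "?J +> t \<in> socle ?Q (regular_module ?Q)" if t: "simple_over ?J t" for t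
  proof (rule MQ.simple_generator_in_socle; simp)
    have tc: "t \<in> carrier R" using t by (simp add: simple_over_def)
    then show "?J +> t \<in> carrier ?Q" by simp
    fix C assume "C \<in> carrier ?Q"
    then obtain a where a: "a \<in> carrier R" "C = ?J +> a" using car by blast
    show "C \<otimes>\<^bsub>?Q\<^esub> (?J +> t) = \<zero>\<^bsub>?Q\<^esub> \<or> (\<exists>b\<in>carrier ?Q. b \<otimes>\<^bsub>?Q\<^esub> (C \<otimes>\<^bsub>?Q\<^esub> (?J +> t)) = ?J +> t)"
    proof (cases "a \<otimes> t \<in> ?J")
      case True
      then show ?thesis using a tc z[of "a \<otimes> t"] by simp
    next
      case False
      then obtain b where b: "b \<in> carrier R" "b \<otimes> (a \<otimes> t) \<ominus> t \<in> ?J"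
        using t a by (auto simp: simple_over_def)
      then have "(?J +> b) \<otimes>\<^bsub>?Q\<^esub> (C \<otimes>\<^bsub>?Q\<^esub> (?J +> t)) = ?J +> t"
        using a tc e[of "b \<otimes> (a \<otimes> t)" t] by simp
      then show ?thesis using pi.hom_closed[OF b(1)] by blast
    qed
  qed
  have "(?J +> \<one>) \<in> socle ?Q (regular_module ?Q)"
    using simple by (intro generate_additive_map[OF abelian_group_axioms MQ.M.abelian_group_axioms _ _
      simple_over_carrier S.subgroup_axioms _ one, of "(+>) ?J"]) auto
  then have "\<one>\<^bsub>?Q\<^esub> \<in> socle ?Q (regular_module ?Q)" by simp
  then have "socle ?Q (regular_module ?Q) = carrier ?Q"
    using Q.li_one MQ.submodule_socle by blast
  then show ?thesis by (simp add: semisimple_ring_def semisimple_module_def)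
qed

end

section \<open>Simple elements from a Loewy series\<close>

context left_module
begin

text \<open>
  Monotonicity is proved simultaneously, since at a limit ordinal the sum of two elements of the
  union has to be formed in one member of the series.
\<close>
lemma loewy_series_submodule:
  assumes r: "Well_order r" and L: "loewy_series R M r L"
  shows "\<alpha> \<in> Field r \<Longrightarrow> submodule (L \<alpha>) R M \<and> (\<forall>\<beta>\<in>underS r \<alpha>. L \<beta> \<subseteq> L \<alpha>)"
proof -
  have wf: "wf (r - Id)" using r by (simp add: well_order_on_def)
  show "\<alpha> \<in> Field r \<Longrightarrow> submodule (L \<alpha>) R M \<and> (\<forall>\<beta>\<in>underS r \<alpha>. L \<beta> \<subseteq> L \<alpha>)"
  proof (induction \<alpha> rule: wf_induct_rule[OF wf])
    case (1 \<alpha>)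
    note hyp = 1
    have IH: "submodule (L \<beta>) R M" "\<And>\<gamma>. \<gamma> \<in> underS r \<beta> \<Longrightarrow> L \<gamma> \<subseteq> L \<beta>" if "\<beta> \<in> underS r \<alpha>" for \<beta>
      using hyp that underS_Field[of \<beta> r \<alpha>] by (auto simp: underS_def)
    have tot: "\<beta> = \<gamma> \<or> \<beta> \<in> underS r \<gamma> \<or> \<gamma> \<in> underS r \<beta>" if "\<beta> \<in> Field r" "\<gamma> \<in> Field r" for \<beta> \<gamma>
      using that r by (auto simp: underS_def well_order_on_def linear_order_on_def total_on_def)
    consider "underS r \<alpha> = {}" | \<beta> where "\<beta> \<in> Field r" "underS r \<alpha> = under r \<beta>"
      | "underS r \<alpha> \<noteq> {}" "\<forall>\<beta>\<in>Field r. underS r \<alpha> \<noteq> under r \<beta>" by blast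
    then show ?case
    proof cases
      case 1
      then show ?thesis using L hyp submodule_socle by (simp add: loewy_series_def)
    next
      case (2 \<beta>)
      then have sub: "submodule (L \<alpha>) R M" "L \<beta> \<subseteq> L \<alpha>"
        using L hyp(2) by (auto simp: loewy_series_def)
      have "\<beta> \<in> underS r \<alpha>"
        using 2 r by (auto simp: under_def well_order_on_def linear_order_on_def partial_order_on_def
            preorder_on_def refl_on_def)
      then have "L \<gamma> \<subseteq> L \<beta>" if "\<gamma> \<in> underS r \<alpha>" for \<gamma>
        using IH(2)[of \<beta> \<gamma>] that 2(2) by (auto simp: underS_def under_def)
      then show ?thesis using sub by blast
    next
      case 3
      then have eq: "L \<alpha> = (\<Union>\<beta>\<in>underS r \<alpha>. L \<beta>)" using L hyp by (simp add: loewy_series_def)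
      have "submodule (L \<alpha>) R M"
      proof (rule submoduleI)
        show "L \<alpha> \<subseteq> carrier M" using eq IH(1) sub_subset by fastforce
        show "\<zero>\<^bsub>M\<^esub> \<in> L \<alpha>" using eq 3(1) IH(1) sub_zero by fastforce
        show "a \<odot>\<^bsub>M\<^esub> x \<in> L \<alpha>" if "a \<in> carrier R" "x \<in> L \<alpha>" for a x
          using that eq sub_smult[OF IH(1)] by fastforce
        fix x y assume "x \<in> L \<alpha>" "y \<in> L \<alpha>"
        then obtain \<beta> \<gamma> where *: "\<beta> \<in> underS r \<alpha>" "x \<in> L \<beta>" "\<gamma> \<in> underS r \<alpha>" "y \<in> L \<gamma>" using eq by blast
        have "\<beta> = \<gamma> \<or> \<beta> \<in> underS r \<gamma> \<or> \<gamma> \<in> underS r \<beta>" using tot[OF underS_Field[OF *(1)] underS_Field[OF *(3)]] .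
        then obtain \<delta> where "\<delta> \<in> underS r \<alpha>" "x \<in> L \<delta>" "y \<in> L \<delta>"
          using * IH(2)[OF *(1)] IH(2)[OF *(3)] by blast
        then show "x \<oplus>\<^bsub>M\<^esub> y \<in> L \<alpha>" using sub_add[OF IH(1)] eq by blast
      qed
      then show ?thesis using eq by blast
    qed
  qed
qed

end

context ring
begin

text \<open>
  At the least ordinal \<open>\<alpha>\<close> with \<open>L \<alpha>\<close> not contained in \<open>N\<close>, which is not a limit, the preceding
  member \<open>L \<beta>\<close> (or \<open>0\<close>) lies in \<open>N\<close>. Some simple submodule of \<open>R / L \<beta>\<close> has nonzero image in
  \<open>R / N\<close>.
\<close>
lemma left_semiartinian_simple_over:
  assumes semi: "left_semiartinian R" and N: "left_ideal N R" "N \<noteq> carrier R"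
  obtains y where "y \<in> carrier R" "y \<notin> N" "simple_over N y"
proof -
  interpret reg: left_module R "regular_module R" by (rule left_module_regular)
  obtain r :: "'a set rel" and L \<gamma> where r: "Well_order r" and L: "loewy_series R (regular_module R) r L"
    and \<gamma>: "\<gamma> \<in> Field r" "L \<gamma> = carrier R"
    using semi unfolding left_semiartinian_def semiartinian_module_def by auto
  have "\<exists>y\<in>carrier R - N. simple_over N y"
  proof (rule ccontr)
    assume no: "\<not> ?thesis"
    have wf: "wf (r - Id)" using r by (simp add: well_order_on_def)
    have "\<alpha> \<in> Field r \<Longrightarrow> L \<alpha> \<subseteq> N" for \<alpha>
    proof (induction \<alpha> rule: wf_induct_rule[OF wf])
      case (1 \<alpha>)
      note hyp = 1
      have IH: "L \<beta> \<subseteq> N" if "\<beta> \<in> underS r \<alpha>" for \<beta>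
        using hyp that underS_Field[of \<beta> r \<alpha>] by (auto simp: underS_def)
      consider "underS r \<alpha> = {}" | \<beta> where "\<beta> \<in> Field r" "underS r \<alpha> = under r \<beta>"
        | "underS r \<alpha> \<noteq> {}" "\<forall>\<beta>\<in>Field r. underS r \<alpha> \<noteq> under r \<beta>" by blast
      then show ?case
      proof cases
        case 1
        then have eq: "L \<alpha> = socle R (regular_module R)" using L hyp by (simp add: loewy_series_def)
        show ?thesis
        proof (rule ccontr)
          assume "\<not> L \<alpha> \<subseteq> N"
          then obtain y where y: "y \<in> carrier R - N"
            "\<forall>a\<in>carrier R. a \<otimes> y \<in> N \<or> (\<exists>b\<in>carrier R. b \<otimes> (a \<otimes> y) = y)"
            using reg.simple_outside_submodule[OF N(1)] eq by auto
          have "y \<ominus> y \<in> N" using y li_zero[OF N(1)] by simp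
          then have "simple_over N y" unfolding simple_over_def using y by (metis DiffD1)
          then show False using no y by blast
        qed
      next
        case (2 \<beta>)
        have "\<beta> \<in> underS r \<alpha>"
          using 2 r by (auto simp: under_def well_order_on_def linear_order_on_def partial_order_on_def
              preorder_on_def refl_on_def)
        then have sub: "L \<beta> \<subseteq> N" using IH by blast
        have sm: "submodule (L \<beta>) R (regular_module R)" "L \<alpha> \<subseteq> carrier R"
          using reg.loewy_series_submodule[OF r L] reg.sub_subset hyp(2) 2(1) by fastforce+
        have eq: "(\<lambda>x. L \<beta> +>\<^bsub>regular_module R\<^esub> x) ` L \<alpha> = socle R (quot_module (regular_module R) (L \<beta>))"
          using L 2 hyp(2) unfolding loewy_series_def by blast
        show ?thesis
        proof (rule ccontr)
          assume "\<not> L \<alpha> \<subseteq> N"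
          then obtain x where x: "x \<in> L \<alpha>" "x \<notin> N" by blast
          then have "L \<beta> +>\<^bsub>regular_module R\<^esub> x \<in> socle R (quot_module (regular_module R) (L \<beta>))"
            "x \<in> carrier (regular_module R)"
            using eq sm(2) by auto
          then have "\<not> (\<forall>x\<in>carrier (regular_module R).
              L \<beta> +>\<^bsub>regular_module R\<^esub> x \<in> socle R (quot_module (regular_module R) (L \<beta>)) \<longrightarrow> x \<in> N)"
            using x by blast
          from reg.simple_outside_submodule_quot[OF sm(1) N(1) sub this]
          show False using no by (auto simp: simple_over_def)
        qed
      next
        case 3
        then have "L \<alpha> = (\<Union>\<beta>\<in>underS r \<alpha>. L \<beta>)" using L hyp by (simp add: loewy_series_def)
        then show ?thesis using IH by blast
      qed
    qed
    then show False using \<gamma> N li_subset by blast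
  qed
  then show ?thesis using that by blast
qed

end

section \<open>Finite Loewy series\<close>

context left_module
begin

definition loewy_next :: "'c set \<Rightarrow> 'c set" where
  "loewy_next N = {x \<in> carrier M. N +>\<^bsub>M\<^esub> x \<in> socle R (quot_module M N)}"

primrec finite_loewy :: "nat \<Rightarrow> 'c set" where
  "finite_loewy 0 = socle R M"
| "finite_loewy (Suc n) = loewy_next (finite_loewy n)"

lemma loewy_next_successor:
  assumes N: "submodule N R M"
  shows "submodule (loewy_next N) R M" "N \<subseteq> loewy_next N"
    "(\<lambda>x. N +>\<^bsub>M\<^esub> x) ` loewy_next N = socle R (quot_module M N)"
proof -
  interpret Q: left_module R "quot_module M N" by (rule left_module_quot[OF N])
  have S: "submodule (socle R (quot_module M N)) R (quot_module M N)" by (rule Q.submodule_socle)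
  have N0: "N \<in> socle R (quot_module M N)" using Q.sub_zero[OF S] by (simp add: N)
  have eq: "N +>\<^bsub>M\<^esub> x = N" if "x \<in> N" for x
    using coset_zero_iff[OF N sub_carr[OF N that]] that by blast
  show "N \<subseteq> loewy_next N"
    using sub_carr[OF N] eq N0 by (auto simp: loewy_next_def)
  show "submodule (loewy_next N) R M"
  proof (rule submoduleI)
    show "loewy_next N \<subseteq> carrier M" by (auto simp: loewy_next_def)
    show "\<zero>\<^bsub>M\<^esub> \<in> loewy_next N" using \<open>N \<subseteq> loewy_next N\<close> sub_zero[OF N] by blast
    show "x \<oplus>\<^bsub>M\<^esub> y \<in> loewy_next N" if "x \<in> loewy_next N" "y \<in> loewy_next N" for x y
      using that Q.sub_add[OF S, of "N +>\<^bsub>M\<^esub> x" "N +>\<^bsub>M\<^esub> y"] by (simp add: loewy_next_def N coset_add)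
    show "a \<odot>\<^bsub>M\<^esub> x \<in> loewy_next N" if "a \<in> carrier R" "x \<in> loewy_next N" for a x
      using that Q.sub_smult[OF S, of a "N +>\<^bsub>M\<^esub> x"] by (simp add: loewy_next_def N quot_smult)
  qed
  have "C \<in> (\<lambda>x. N +>\<^bsub>M\<^esub> x) ` loewy_next N" if "C \<in> socle R (quot_module M N)" for C
  proof -
    have "C \<in> a_rcosets\<^bsub>M\<^esub> N" using Q.sub_carr[OF S that] by (simp add: N)
    then obtain x where "x \<in> carrier M" "C = N +>\<^bsub>M\<^esub> x" using coset_rep[OF N] by blast
    then show ?thesis using that by (auto simp: loewy_next_def)
  qed
  then show "(\<lambda>x. N +>\<^bsub>M\<^esub> x) ` loewy_next N = socle R (quot_module M N)"
    by (auto simp: loewy_next_def)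
qed

lemma submodule_finite_loewy: "submodule (finite_loewy n) R M"
  by (induction n) (auto simp: submodule_socle loewy_next_successor)

text \<open>
  Up to the first index \<open>m\<close> at which it reaches the module, the series increases strictly. Its
  members, ordered by inclusion, thus form a well-order of subsets of the module, and the identity
  on them is a Loewy series.
\<close>
lemma semiartinian_of_finite_loewy:
  assumes "finite_loewy n = carrier M"
  shows "semiartinian_module R M"
proof -
  define m where "m = (LEAST n. finite_loewy n = carrier M)"
  have m: "finite_loewy m = carrier M" unfolding m_def by (rule LeastI[of "\<lambda>n. finite_loewy n = carrier M", OF assms])
  have least: "finite_loewy k \<noteq> carrier M" if "k < m" for k using that unfolding m_def by (rule not_less_Least)
  let ?L = finite_loewy
  have stat: "?L (Suc k + i) = ?L k" if "?L (Suc k) = ?L k" for k i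
    using that by (induction i) simp_all
  have step: "?L k \<subset> ?L (Suc k)" if "k < m" for k
  proof -
    have "?L (Suc k) \<noteq> ?L k"
    proof
      assume "?L (Suc k) = ?L k"
      from stat[OF this, of "m - Suc k"] have "?L m = ?L k" using that by (simp del: finite_loewy.simps)
      then show False using m least[OF that] by simp
    qed
    then show ?thesis using loewy_next_successor(2)[OF submodule_finite_loewy[of k]] by auto
  qed
  have strict: "?L i \<subset> ?L j" if "i < j" "j \<le> m" for i j
    using that
  proof (induction j)
    case (Suc j)
    have "?L j \<subset> ?L (Suc j)" using step Suc.prems by simp
    moreover have "?L i \<subseteq> ?L j" using Suc by (cases "i = j") auto
    ultimately show ?case by blast
  qed simp
  have inj: "inj_on ?L {..m}"
  proof (rule inj_onI)
    fix i j assume "i \<in> {..m}" "j \<in> {..m}" "?L i = ?L j"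
    then show "i = j" using strict[of i j] strict[of j i] by (cases i j rule: linorder_cases) auto
  qed
  have eqI: "?L i = ?L j \<longleftrightarrow> i = j" if "i \<le> m" "j \<le> m" for i j using inj that by (auto dest: inj_onD)
  define r where "r = dir_image (natLeq_on (Suc m)) ?L"
  have r_iff: "(X, Y) \<in> r \<longleftrightarrow> (\<exists>i j. X = ?L i \<and> Y = ?L j \<and> i \<le> j \<and> j \<le> m)" for X Y
    unfolding r_def dir_image_def by fastforce
  have "Field (natLeq_on (Suc m)) = {..m}" using Field_natLeq_on by auto
  then have wo: "Well_order r"
    unfolding r_def by (intro Well_order_dir_image natLeq_on_Well_order) (use inj in simp)
  have field: "Field r = ?L ` {..m}" unfolding Field_def using r_iff by fastforce
  have under: "under r (?L j) = ?L ` {..j}" if "j \<le> m" for j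
    using that eqI by (fastforce simp: under_def r_iff)
  have underS: "underS r (?L j) = ?L ` {..<j}" if "j \<le> m" for j
  proof -
    have "underS r (?L j) = under r (?L j) - {?L j}" by (auto simp: underS_def under_def)
    also have "\<dots> = ?L ` {..<j}" using that eqI by (fastforce simp: under[OF that] less_le)
    finally show ?thesis .
  qed
  have succ: "j = Suc i" if "j \<le> m" "i \<le> m" "underS r (?L j) = under r (?L i)" for i j
  proof -
    have sub: "{..<j} \<subseteq> {..m}" "{..i} \<subseteq> {..m}" using that by auto
    have "?L ` {..<j} = ?L ` {..i}" using that under underS by simp
    then have "{..<j} = {..i}" using inj_on_image_eq_iff[OF inj sub] by blast
    then show ?thesis by (metis lessThan_Suc_atMost lessThan_eq_iff)
  qed
  have "loewy_series R M r (\<lambda>X. X)"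
    unfolding loewy_series_def
  proof (intro ballI conjI impI)
    fix \<alpha> assume "\<alpha> \<in> Field r"
    then obtain j where j: "\<alpha> = ?L j" "j \<le> m" using field by auto
    show "\<alpha> = socle R M" if "underS r \<alpha> = {}"
    proof -
      have "j = 0" using that underS[OF j(2)] j by auto
      then show ?thesis using j by simp
    qed
    {
      fix \<beta> assume "\<beta> \<in> Field r" "underS r \<alpha> = under r \<beta>"
      then obtain i where i: "\<beta> = ?L i" "i \<le> m" "j = Suc i" using field succ j by auto
      then have \<alpha>: "\<alpha> = loewy_next \<beta>" using j by simp
      have \<beta>: "submodule \<beta> R M" using i submodule_finite_loewy by simp
      show "submodule \<alpha> R M" "\<beta> \<subseteq> \<alpha>" "(+>\<^bsub>M\<^esub>) \<beta> ` \<alpha> = socle R (quot_module M \<beta>)"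
        using loewy_next_successor[OF \<beta>] \<alpha> by auto
    }
    assume lim: "underS r \<alpha> \<noteq> {} \<and> (\<forall>\<beta>\<in>Field r. underS r \<alpha> \<noteq> under r \<beta>)"
    then obtain i where i: "j = Suc i" using underS[OF j(2)] j(1) by (cases j) auto
    then have "underS r \<alpha> = under r (?L i)" using j under[of i] underS[of j] by (simp add: lessThan_Suc_atMost)
    moreover have "?L i \<in> Field r" using field i j by auto
    ultimately show "\<alpha> = (\<Union>\<beta>\<in>underS r \<alpha>. \<beta>)" using lim by blast
  qed
  moreover have "carrier M \<in> Field r" using field m by auto
  ultimately show ?thesis
    unfolding semiartinian_module_def using wo by (intro exI[of _ r] exI[of _ "\<lambda>X. X"]) blast
qed

end

section \<open>Rings with nilpotent radical\<close>

text \<open>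
  New factors enter on the left, as in right T-nilpotence.
\<close>
primrec desc_prod :: "('a, 'c) ring_scheme \<Rightarrow> (nat \<Rightarrow> 'a) \<Rightarrow> nat \<Rightarrow> 'a" where
  "desc_prod R z 0 = \<one>\<^bsub>R\<^esub>"
| "desc_prod R z (Suc n) = z n \<otimes>\<^bsub>R\<^esub> desc_prod R z n"

context ring
begin

lemma desc_prod_closed: "(\<And>i. z i \<in> carrier R) \<Longrightarrow> desc_prod R z n \<in> carrier R"
  by (induction n) auto

lemma desc_prod_add:
  assumes "\<And>i. z i \<in> carrier R"
  shows "desc_prod R z (m + n) = desc_prod R (\<lambda>i. z (m + i)) n \<otimes> desc_prod R z m"
  by (induction n) (use assms in \<open>auto simp: desc_prod_closed m_assoc\<close>)

lemma desc_prod_Suc_first: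
  assumes "\<And>i. z i \<in> carrier R"
  shows "desc_prod R z (Suc n) = desc_prod R (\<lambda>i. z (Suc i)) n \<otimes> z 0"
  using desc_prod_add[of z 1 n] assms by simp

lemma desc_prod_mult:
  assumes "\<And>i. z i \<in> carrier R"
  shows "desc_prod R z (m * k) = desc_prod R (\<lambda>b. desc_prod R (\<lambda>i. z (m * b + i)) m) k"
proof (induction k)
  case (Suc k)
  have "desc_prod R z (m * Suc k) = desc_prod R z (m * k + m)" by (simp add: add.commute)
  then show ?case using desc_prod_add[of z "m * k" m] assms Suc by simp
qed simp

lemma desc_prod_cong: "(\<And>i. i < n \<Longrightarrow> z i = w i) \<Longrightarrow> desc_prod R z n = desc_prod R w n"
  by (induction n) auto

lemma desc_prod_opposite_ring:
  assumes "\<And>i. z i \<in> carrier R"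
  shows "desc_prod (opposite_ring R) z n = desc_prod R (\<lambda>i. z (n - Suc i)) n"
proof (induction n)
  case (Suc n)
  have "desc_prod R (\<lambda>i. z (Suc n - Suc i)) (Suc n) = desc_prod R (\<lambda>i. z (n - Suc i)) n \<otimes> z n"
    using desc_prod_Suc_first[of "\<lambda>i. z (n - i)" n] assms by simp
  then show ?case using Suc by simp
qed simp

text \<open>
  An element of \<open>J\<^sup>k\<close> times a product of \<open>n - k\<close> elements of \<open>J\<close> vanishes; the case \<open>k = n\<close> is the
  claim.
\<close>
lemma nilpotent_idealI:
  assumes J: "ideal J R" and nil: "\<forall>z. (\<forall>j. z j \<in> J) \<longrightarrow> desc_prod R z n = \<zero>"
  shows "nilpotent_ideal J R"
proof -
  have Jc: "j \<in> carrier R" if "j \<in> J" for j using ideal.Icarr[OF J that] .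
  have id: "ideal (ideal_power R J k) R" for k
    by (induction k) (auto intro: oneideal ideal_prod_is_ideal J)
  have pc: "x \<in> carrier R" if "x \<in> ideal_power R J k" for x k using ideal.Icarr[OF id that] .
  have "x \<otimes> desc_prod R z t = \<zero>" if "x \<in> ideal_power R J k" "k + t = n" "\<And>j. z j \<in> J" for x k t z
    using that
  proof (induction k arbitrary: x t z)
    case 0
    then show ?case using nil by simp
  next
    case (Suc k)
    have P: "desc_prod R z t \<in> carrier R" using Suc.prems(3) Jc by (intro desc_prod_closed) blast
    have "x \<in> ideal_power R J k \<cdot>\<^bsub>R\<^esub> J" using Suc.prems(1) by simp
    then have "x \<in> carrier R \<and> x \<otimes> desc_prod R z t = \<zero>"
    proof (induction x rule: ideal_prod.induct)
      case (prod i j)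
      let ?w = "z(t := j)"
      have "desc_prod R ?w t = desc_prod R z t" by (rule desc_prod_cong) simp
      then have "desc_prod R ?w (Suc t) = j \<otimes> desc_prod R z t" by simp
      moreover have "i \<otimes> desc_prod R ?w (Suc t) = \<zero>"
        using prod Suc.prems by (intro Suc.IH) auto
      ultimately show ?case using pc[OF prod(1)] Jc[OF prod(2)] P by (simp add: m_assoc)
    next
      case (sum s1 s2)
      then show ?case using P by (simp add: l_distr)
    qed
    then show ?case by blast
  qed
  then have "x \<otimes> desc_prod R (\<lambda>_. \<zero>) 0 = \<zero>" if "x \<in> ideal_power R J n" for x
    using that additive_subgroup.zero_closed[OF ideal.axioms(1)[OF J]] by (metis add_0_right)
  then have "x = \<zero>" if "x \<in> ideal_power R J n" for x
    using that pc[OF that] by (metis desc_prod.simps(1) r_one)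
  moreover have "\<zero> \<in> ideal_power R J n" using additive_subgroup.zero_closed[OF ideal.axioms(1)[OF id]] .
  ultimately show ?thesis unfolding nilpotent_ideal_def by blast
qed

text \<open>
  By induction on \<open>k\<close>, every \<open>x\<close> with \<open>J\<^sup>k\<^sup>+\<^sup>1 x = 0\<close> lies in the \<open>k\<close>-th member of the finite
  Loewy series: modulo the preceding member \<open>x\<close> is killed by \<open>J\<close>, and therefore lies in the socle.
\<close>
lemma semiartinian_if_Jac_nilpotent:
  assumes M: "left_module R M"
    and one: "\<one> \<in> generate (add_monoid R) (Collect (simple_over (Jac R)))"
    and nil: "\<And>z. (\<And>i. z i \<in> Jac R) \<Longrightarrow> desc_prod R z n = \<zero>"
  shows "semiartinian_module R M"
proof -
  interpret M: left_module R M by (rule M)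
  have Jc: "j \<in> carrier R" if "j \<in> Jac R" for j using that Jac_subset by blast
  have key: "x \<in> M.finite_loewy k"
    if x: "x \<in> carrier M" and kill: "\<And>z. (\<And>i. z i \<in> Jac R) \<Longrightarrow> desc_prod R z (Suc k) \<odot>\<^bsub>M\<^esub> x = \<zero>\<^bsub>M\<^esub>" for k x
    using that
  proof (induction k arbitrary: x)
    case 0
    have "j \<odot>\<^bsub>M\<^esub> x = \<zero>\<^bsub>M\<^esub>" if "j \<in> Jac R" for j
      using "0.prems"(2)[of "\<lambda>_. j"] that Jc by simp
    then show ?case using annihilated_by_Jac_in_socle[OF M one] 0 by simp
  next
    case (Suc k)
    let ?N = "M.finite_loewy k"
    have N: "submodule ?N R M" by (rule M.submodule_finite_loewy)
    have jx: "j \<odot>\<^bsub>M\<^esub> x \<in> ?N" if j: "j \<in> Jac R" for j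
    proof (rule Suc.IH)
      show "j \<odot>\<^bsub>M\<^esub> x \<in> carrier M" using Suc.prems(1) Jc j by simp
      fix z :: "nat \<Rightarrow> 'a" assume z: "\<And>i. z i \<in> Jac R"
      let ?w = "case_nat j z"
      have w: "?w i \<in> Jac R" for i using z j by (cases i) auto
      have "desc_prod R ?w (Suc (Suc k)) = desc_prod R z (Suc k) \<otimes> j"
        using desc_prod_Suc_first[of ?w "Suc k"] w Jc by simp
      then show "desc_prod R z (Suc k) \<odot>\<^bsub>M\<^esub> (j \<odot>\<^bsub>M\<^esub> x) = \<zero>\<^bsub>M\<^esub>"
        using Suc.prems(2)[of ?w, OF w] Suc.prems(1) desc_prod_closed[of z "Suc k"] z Jc j
        by (simp add: M.smult_assoc del: desc_prod.simps)
    qed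
    have "?N +>\<^bsub>M\<^esub> x \<in> socle R (quot_module M ?N)"
    proof (rule annihilated_by_Jac_in_socle[OF M.left_module_quot[OF N] one])
      show "?N +>\<^bsub>M\<^esub> x \<in> carrier (quot_module M ?N)" using M.coset_in_quot[OF N Suc.prems(1)] by (simp add: N)
      fix j assume j: "j \<in> Jac R"
      then have "?N +>\<^bsub>M\<^esub> (j \<odot>\<^bsub>M\<^esub> x) = ?N"
        using M.coset_zero_iff[OF N, of "j \<odot>\<^bsub>M\<^esub> x"] jx Jc Suc.prems(1) by simp
      then show "j \<odot>\<^bsub>quot_module M ?N\<^esub> (?N +>\<^bsub>M\<^esub> x) = \<zero>\<^bsub>quot_module M ?N\<^esub>"
        using M.quot_smult[OF N Jc[OF j] Suc.prems(1)] by (simp add: N)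
    qed
    then show ?case using Suc.prems(1) by (simp add: M.loewy_next_def)
  qed
  have "x \<in> M.finite_loewy n" if x: "x \<in> carrier M" for x
  proof (rule key[OF x])
    fix z :: "nat \<Rightarrow> 'a" assume z: "\<And>i. z i \<in> Jac R"
    then show "desc_prod R z (Suc n) \<odot>\<^bsub>M\<^esub> x = \<zero>\<^bsub>M\<^esub>" using nil[of z] Jc x by simp
  qed
  then have "M.finite_loewy n = carrier M"
    using M.sub_subset[OF M.submodule_finite_loewy] by blast
  then show ?thesis by (rule M.semiartinian_of_finite_loewy)
qed

end

section \<open>Linear compactness\<close>

text \<open>
  The ideals \<open>U i\<close> are a base of neighbourhoods of \<open>0\<close> for a complete Hausdorff linear topology
  whose discrete quotients \<open>R / U i\<close> have finite left length. In the completeness axiom,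
  compatibility is tested along inclusions between the \<open>U i\<close>, which play the role of the order of
  the inverse system.
\<close>
locale profinite_ring = ring R for R (structure) +
  fixes I :: "'i set" and U :: "'i \<Rightarrow> 'a set"
  assumes ideal_U: "i \<in> I \<Longrightarrow> ideal (U i) R"
    and I_nonempty: "I \<noteq> {}"
    and directed: "\<lbrakk>i \<in> I; j \<in> I\<rbrakk> \<Longrightarrow> \<exists>k\<in>I. U k \<subseteq> U i \<and> U k \<subseteq> U j"
    and separated: "\<lbrakk>x \<in> carrier R; \<And>i. i \<in> I \<Longrightarrow> x \<in> U i\<rbrakk> \<Longrightarrow> x = \<zero>"
    and complete: "\<lbrakk>\<And>i. i \<in> I \<Longrightarrow> c i \<in> carrier R;
        \<And>i j. \<lbrakk>i \<in> I; j \<in> I; U j \<subseteq> U i\<rbrakk> \<Longrightarrow> c j \<ominus> c i \<in> U i\<rbrakk> \<Longrightarrow>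
        \<exists>y\<in>carrier R. \<forall>i\<in>I. y \<ominus> c i \<in> U i"
    and length_U: "i \<in> I \<Longrightarrow> bounded_length {N. left_ideal N R \<and> U i \<subseteq> N}"
begin

lemma li_U: "i \<in> I \<Longrightarrow> left_ideal (U i) R"
  using ideal_U ideal_left_ideal by blast

definition open_left_ideal :: "'a set \<Rightarrow> bool" where
  "open_left_ideal N \<longleftrightarrow> left_ideal N R \<and> (\<exists>i\<in>I. U i \<subseteq> N)"

lemma open_left_ideal_left_ideal: "open_left_ideal N \<Longrightarrow> left_ideal N R"
  by (simp add: open_left_ideal_def)

lemma open_left_ideal_U: "i \<in> I \<Longrightarrow> open_left_ideal (U i)"
  using li_U by (auto simp: open_left_ideal_def)

lemma open_left_ideal_Int:
  assumes "open_left_ideal N" "open_left_ideal N'" shows "open_left_ideal (N \<inter> N')"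
proof -
  obtain i j where ij: "i \<in> I" "U i \<subseteq> N" "j \<in> I" "U j \<subseteq> N'" using assms by (auto simp: open_left_ideal_def)
  obtain k where "k \<in> I" "U k \<subseteq> U i" "U k \<subseteq> U j" using directed[OF ij(1,3)] by blast
  then have "\<exists>k\<in>I. U k \<subseteq> N \<inter> N'" using ij by blast
  then show ?thesis using assms left_ideal_Int[of N N'] unfolding open_left_ideal_def by blast
qed

definition affine_coset :: "'a \<Rightarrow> 'a set \<Rightarrow> 'a set" where
  "affine_coset x N = {y \<in> carrier R. y \<ominus> x \<in> N}"

lemma affine_coset_eq:
  assumes N: "left_ideal N R" and x: "x \<in> carrier R" and y: "y \<in> affine_coset x N"
  shows "affine_coset x N = affine_coset y N"
proof -
  have yc: "y \<in> carrier R" "y \<ominus> x \<in> N" using y by (auto simp: affine_coset_def)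
  have xy: "x \<ominus> y \<in> N" using li_diff_swap[OF N yc(1) x yc(2)] .
  show ?thesis
    using li_diff_trans[OF N _ x yc(1) _ xy] li_diff_trans[OF N _ yc(1) x _ yc(2)]
    by (auto simp: affine_coset_def)
qed

definition open_cosets :: "'a set set" where
  "open_cosets = {affine_coset x N | x N. x \<in> carrier R \<and> open_left_ideal N}"

lemma affine_coset_Int:
  assumes "left_ideal N R" "left_ideal N' R" "x \<in> carrier R" "x' \<in> carrier R"
    and "z \<in> affine_coset x N" "z \<in> affine_coset x' N'"
  shows "affine_coset x N \<inter> affine_coset x' N' = affine_coset z (N \<inter> N')"
  using affine_coset_eq[OF assms(1,3,5)] affine_coset_eq[OF assms(2,4,6)] by (auto simp: affine_coset_def)

text \<open>
  The heart of linear compactness. The family contains a coset of each \<open>U i\<close>: choose a member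
  \<open>x + N\<close> with \<open>N + U i\<close> minimal. Shrinking it by another member \<open>D\<close> does not change \<open>N + U i\<close>, so
  \<open>x + U i\<close> meets \<open>D\<close>; hence it belongs to the family by maximality. These cosets are compatible,
  and completeness provides their common point.
\<close>
lemma maximal_family_has_point:
  assumes sub: "\<M> \<subseteq> open_cosets" and ne: "\<M> \<noteq> {}"
    and Int: "\<And>D E. D \<in> \<M> \<Longrightarrow> E \<in> \<M> \<Longrightarrow> D \<inter> E \<in> \<M>"
    and max: "\<And>C. C \<in> open_cosets \<Longrightarrow> (\<And>D. D \<in> \<M> \<Longrightarrow> C \<inter> D \<noteq> {}) \<Longrightarrow> C \<in> \<M>"
    and ne': "\<And>D. D \<in> \<M> \<Longrightarrow> D \<noteq> {}"
  shows "\<exists>y\<in>carrier R. \<forall>D\<in>\<M>. y \<in> D"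
proof -
  have rep: "\<exists>x N. x \<in> carrier R \<and> open_left_ideal N \<and> D = affine_coset x N" if "D \<in> \<M>" for D
  proof -
    have "D \<in> open_cosets" using that sub by (rule subsetD[rotated])
    then show ?thesis unfolding open_cosets_def by blast
  qed
  let ?plus = "\<lambda>N i. {x \<oplus> y | x y. x \<in> N \<and> y \<in> U i}"
  have "\<exists>x. x \<in> carrier R \<and> affine_coset x (U i) \<in> \<M>" if i: "i \<in> I" for i
  proof -
    have U: "left_ideal (U i) R" using li_U[OF i] .
    let ?\<N> = "{?plus N i | x N. x \<in> carrier R \<and> open_left_ideal N \<and> affine_coset x N \<in> \<M>}"
    have "?\<N> \<subseteq> {N. left_ideal N R \<and> U i \<subseteq> N}"
    proof
      fix L assume "L \<in> ?\<N>"
      then obtain N where N: "open_left_ideal N" and L: "L = ?plus N i" by blast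
      have lN: "left_ideal N R" using open_left_ideal_left_ideal[OF N] .
      have "u \<in> L" if "u \<in> U i" for u
      proof -
        have "u = \<zero> \<oplus> u" using li_carr[OF U that] by simp
        then show ?thesis unfolding L using li_zero[OF lN] that by blast
      qed
      then show "L \<in> {N. left_ideal N R \<and> U i \<subseteq> N}" using left_ideal_sum[OF lN U] L by blast
    qed
    moreover have "?\<N> \<noteq> {}"
    proof -
      obtain D where D: "D \<in> \<M>" using ne by blast
      obtain x N where "x \<in> carrier R" "open_left_ideal N" "D = affine_coset x N" using rep[OF D] by blast
      then have "?plus N i \<in> ?\<N>" using D by blast
      then show ?thesis by blast
    qed
    ultimately obtain L where L: "L \<in> ?\<N>" "\<And>L'. L' \<in> ?\<N> \<Longrightarrow> \<not> L' \<subset> L"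
      by (rule bounded_length_minimal[OF length_U[OF i]]) (rule that)
    from L(1) obtain x N where x: "x \<in> carrier R" and N: "open_left_ideal N" and xN: "affine_coset x N \<in> \<M>"
      and LN: "L = ?plus N i" by blast
    have lN: "left_ideal N R" using open_left_ideal_left_ideal[OF N] .
    have "affine_coset x (U i) \<inter> D \<noteq> {}" if D: "D \<in> \<M>" for D
    proof -
      obtain x' N' where x': "x' \<in> carrier R" and N': "open_left_ideal N'" and D': "D = affine_coset x' N'"
        using rep[OF D] by blast
      have lN': "left_ideal N' R" using open_left_ideal_left_ideal[OF N'] .
      have E: "affine_coset x N \<inter> D \<in> \<M>" using Int xN D by blast
      then obtain z where z: "z \<in> affine_coset x N" "z \<in> D" using ne' by blast
      have zc: "z \<in> carrier R" using z by (simp add: affine_coset_def)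
      have EZ: "affine_coset x N \<inter> D = affine_coset z (N \<inter> N')"
        unfolding D' using affine_coset_Int[OF lN lN' x x' z(1)] z(2) D' by blast
      have "affine_coset z (N \<inter> N') \<in> \<M>" using E EZ by simp
      then have "?plus (N \<inter> N') i \<in> ?\<N>" using zc open_left_ideal_Int[OF N N'] by blast
      moreover have "?plus (N \<inter> N') i \<subseteq> L" unfolding LN by (rule Collect_mono) blast
      ultimately have eq: "?plus (N \<inter> N') i = L" using L(2)[of "?plus (N \<inter> N') i"] by (simp add: psubset_eq)
      have zx: "z \<ominus> x \<in> N" using z by (simp add: affine_coset_def)
      have "z \<ominus> x = (z \<ominus> x) \<oplus> \<zero>" using zc x by simp
      then have "z \<ominus> x \<in> L" unfolding LN using zx li_zero[OF U] by blast
      then obtain n u where nu: "z \<ominus> x = n \<oplus> u" "n \<in> N \<inter> N'" "u \<in> U i" unfolding eq[symmetric] by blast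
      have c: "n \<in> carrier R" "u \<in> carrier R" using nu li_carr[OF lN] li_carr[OF U] by auto
      \<comment> \<open>\<open>z\<close> lies in both cosets; removing the part \<open>n \<in> N \<inter> N'\<close> of \<open>z - x = n + u\<close> moves it into
        \<open>x + U i\<close> without leaving \<open>D\<close>.\<close>
      define y where "y = z \<ominus> n"
      have yc: "y \<in> carrier R" using zc c by (simp add: y_def)
      have "z \<ominus> y = n" unfolding y_def using zc c by (simp add: minus_eq minus_add a_ac r_neg1 r_neg2 r_neg)
      then have "z \<ominus> y \<in> N \<inter> N'" using nu by simp
      then have "y \<ominus> z \<in> N \<inter> N'" using li_diff_swap[OF left_ideal_Int[OF lN lN'] zc yc] by blast
      then have "y \<in> affine_coset z (N \<inter> N')" using yc by (simp add: affine_coset_def)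
      then have yD: "y \<in> D" using EZ by blast
      have "y \<ominus> x = (z \<ominus> x) \<ominus> n" unfolding y_def using zc c x by (simp add: minus_eq a_ac)
      also have "\<dots> = (u \<oplus> n) \<ominus> n" using nu(1) a_comm[OF c] by simp
      also have "\<dots> = u" using c by (simp add: minus_eq a_assoc r_neg)
      finally have "y \<in> affine_coset x (U i)" using nu(3) yc by (simp add: affine_coset_def)
      then show ?thesis using yD by blast
    qed
    moreover have "affine_coset x (U i) \<in> open_cosets"
      using x open_left_ideal_U[OF i] by (auto simp: open_cosets_def)
    ultimately show ?thesis using max x by blast
  qed
  then obtain x where x: "\<And>i. i \<in> I \<Longrightarrow> x i \<in> carrier R" "\<And>i. i \<in> I \<Longrightarrow> affine_coset (x i) (U i) \<in> \<M>"
    by metis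
  have "x j \<ominus> x i \<in> U i" if ij: "i \<in> I" "j \<in> I" "U j \<subseteq> U i" for i j
  proof -
    have "affine_coset (x i) (U i) \<inter> affine_coset (x j) (U j) \<noteq> {}" using Int x ij ne' by blast
    then obtain w where w: "w \<in> carrier R" "w \<ominus> x i \<in> U i" "w \<ominus> x j \<in> U j" by (auto simp: affine_coset_def)
    then have "x j \<ominus> w \<in> U i" using li_diff_swap[OF li_U[OF ij(1)] w(1) x(1)[OF ij(2)]] ij by blast
    then show ?thesis using li_diff_trans[OF li_U[OF ij(1)] x(1)[OF ij(2)] w(1) x(1)[OF ij(1)] _ w(2)] by blast
  qed
  then obtain y where y: "y \<in> carrier R" "\<And>i. i \<in> I \<Longrightarrow> y \<ominus> x i \<in> U i"
    using complete[of x] x(1) by blast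
  have "y \<in> D" if D: "D \<in> \<M>" for D
  proof -
    obtain x' N where x': "x' \<in> carrier R" and N: "open_left_ideal N" and D': "D = affine_coset x' N"
      using rep[OF D] by blast
    have lN: "left_ideal N R" using open_left_ideal_left_ideal[OF N] .
    obtain i where i: "i \<in> I" "U i \<subseteq> N" using N by (auto simp: open_left_ideal_def)
    have "D \<inter> affine_coset (x i) (U i) \<noteq> {}" using Int x i ne' D by blast
    then obtain w where w: "w \<in> carrier R" "w \<ominus> x' \<in> N" "w \<ominus> x i \<in> U i" by (auto simp: affine_coset_def D')
    have "x i \<ominus> w \<in> N" using li_diff_swap[OF lN w(1) x(1)[OF i(1)]] w i by blast
    then have "x i \<ominus> x' \<in> N" using li_diff_trans[OF lN x(1)[OF i(1)] w(1) x' _ w(2)] by blast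
    have "y \<ominus> x i \<in> N" using y(2)[OF i(1)] i(2) by blast
    from li_diff_trans[OF lN y(1) x(1)[OF i(1)] x' this \<open>x i \<ominus> x' \<in> N\<close>] have "y \<ominus> x' \<in> N" .
    then show ?thesis using y(1) by (simp add: D' affine_coset_def)
  qed
  then show ?thesis using y(1) by blast
qed

text \<open>
  By Zorn's lemma the given cosets extend to a maximal family of open cosets with the finite
  intersection property, which is closed under intersections.
\<close>
theorem linearly_compact:
  assumes T: "\<And>t. t \<in> T \<Longrightarrow> a t \<in> carrier R" "\<And>t. t \<in> T \<Longrightarrow> open_left_ideal (N t)"
    and fip: "\<And>F. finite F \<Longrightarrow> F \<subseteq> T \<Longrightarrow> \<exists>y\<in>carrier R. \<forall>t\<in>F. y \<ominus> a t \<in> N t"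
  shows "\<exists>y\<in>carrier R. \<forall>t\<in>T. y \<ominus> a t \<in> N t"
proof -
  define fam where "fam = (\<lambda>t. affine_coset (a t) (N t)) ` T"
  define good where "good \<F> \<longleftrightarrow> (\<forall>\<G>. finite \<G> \<and> \<G> \<subseteq> \<F> \<longrightarrow> carrier R \<inter> \<Inter>\<G> \<noteq> {})" for \<F>
  define S where "S = {\<F>. fam \<subseteq> \<F> \<and> \<F> \<subseteq> open_cosets \<and> good \<F>}"
  have goodI: "good \<F>" if "\<And>\<G>. finite \<G> \<Longrightarrow> \<G> \<subseteq> \<F> \<Longrightarrow> carrier R \<inter> \<Inter>\<G> \<noteq> {}" for \<F>
    using that by (simp add: good_def)
  have goodD: "carrier R \<inter> \<Inter>\<G> \<noteq> {}" if "good \<F>" "finite \<G>" "\<G> \<subseteq> \<F>" for \<F> \<G>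
    using that by (simp add: good_def)
  have "good fam"
  proof (rule goodI)
    fix \<G> assume "finite \<G>" "\<G> \<subseteq> fam"
    then obtain F where F: "finite F" "F \<subseteq> T" "\<G> = (\<lambda>t. affine_coset (a t) (N t)) ` F"
      unfolding fam_def using finite_subset_image[of \<G> "\<lambda>t. affine_coset (a t) (N t)" T] by blast
    obtain y where "y \<in> carrier R" "\<forall>t\<in>F. y \<ominus> a t \<in> N t" using fip[OF F(1,2)] by blast
    then have "y \<in> carrier R \<inter> \<Inter>\<G>" using F by (auto simp: affine_coset_def)
    then show "carrier R \<inter> \<Inter>\<G> \<noteq> {}" by blast
  qed
  moreover have "fam \<subseteq> open_cosets" using T by (auto simp: open_cosets_def fam_def)
  ultimately have "fam \<in> S" by (simp add: S_def)
  have "\<exists>M\<in>S. \<forall>X\<in>S. M \<subseteq> X \<longrightarrow> X = M"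
  proof (rule subset_Zorn_nonempty)
    show "S \<noteq> {}" using \<open>fam \<in> S\<close> by blast
    fix C assume C: "C \<noteq> {}" "subset.chain S C"
    have CS: "\<F> \<in> S" if "\<F> \<in> C" for \<F> using that C(2) by (auto simp: subset.chain_def)
    have "good (\<Union>C)"
    proof (rule goodI)
      fix \<G> assume \<G>: "finite \<G>" "\<G> \<subseteq> \<Union>C"
      obtain \<F> where \<F>: "\<F> \<in> C" "\<G> \<subseteq> \<F>"
        using finite_subset_Union_chain[OF \<G> C] .
      have "good \<F>" using CS[OF \<F>(1)] by (simp add: S_def)
      then show "carrier R \<inter> \<Inter>\<G> \<noteq> {}" using goodD \<F>(2) \<G>(1) by simp
    qed
    moreover obtain \<F> where "\<F> \<in> C" using C(1) by blast
    then have "fam \<subseteq> \<Union>C" using CS[of \<F>] by (auto simp: S_def)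
    moreover have "\<Union>C \<subseteq> open_cosets"
    proof (rule Union_least)
      fix X assume "X \<in> C" then show "X \<subseteq> open_cosets" using CS[of X] by (simp add: S_def)
    qed
    ultimately show "\<Union>C \<in> S" by (simp add: S_def)
  qed
  then obtain \<M> where M: "\<M> \<in> S" and Mmax: "\<And>X. X \<in> S \<Longrightarrow> \<M> \<subseteq> X \<Longrightarrow> X = \<M>" by blast
  have M0: "fam \<subseteq> \<M>" and Mo: "\<M> \<subseteq> open_cosets" and Mgood: "good \<M>" using M by (simp_all add: S_def)
  note Mfip = goodD[OF Mgood]
  have max: "C \<in> \<M>" if C: "C \<in> open_cosets" "\<And>\<G>. finite \<G> \<Longrightarrow> \<G> \<subseteq> \<M> \<Longrightarrow> C \<inter> (carrier R \<inter> \<Inter>\<G>) \<noteq> {}" for C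
  proof -
    have "good (insert C \<M>)"
    proof (rule goodI)
      fix \<G> assume \<G>: "finite \<G>" "\<G> \<subseteq> insert C \<M>"
      have "C \<inter> (carrier R \<inter> \<Inter>(\<G> - {C})) \<noteq> {}" by (rule C(2)) (use \<G> in auto)
      moreover have "C \<inter> (carrier R \<inter> \<Inter>(\<G> - {C})) \<subseteq> carrier R \<inter> \<Inter>\<G>" by blast
      ultimately show "carrier R \<inter> \<Inter>\<G> \<noteq> {}" by blast
    qed
    then have "insert C \<M> \<in> S" using M0 Mo C(1) by (auto simp: S_def)
    then have "insert C \<M> = \<M>" using Mmax by blast
    then show ?thesis by blast
  qed
  have Int: "D \<inter> E \<in> \<M>" if DE: "D \<in> \<M>" "E \<in> \<M>" for D E
  proof (rule max)
    obtain x K x' K' where *: "x \<in> carrier R" "open_left_ideal K" "D = affine_coset x K"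
      "x' \<in> carrier R" "open_left_ideal K'" "E = affine_coset x' K'"
      using subsetD[OF Mo DE(1)] subsetD[OF Mo DE(2)] unfolding open_cosets_def by blast
    have "carrier R \<inter> \<Inter>{D, E} \<noteq> {}" using DE by (intro Mfip) simp_all
    then obtain z where z: "z \<in> D" "z \<in> E" by blast
    have "D \<inter> E = affine_coset z (K \<inter> K')"
      unfolding *(3,6) using z * by (intro affine_coset_Int open_left_ideal_left_ideal) simp_all
    moreover have "z \<in> carrier R" using z(1) *(3) by (simp add: affine_coset_def)
    ultimately show "D \<inter> E \<in> open_cosets" unfolding open_cosets_def using open_left_ideal_Int[OF *(2,5)] by blast
    fix \<G> assume "finite \<G>" "\<G> \<subseteq> \<M>"
    then have "carrier R \<inter> \<Inter>(insert D (insert E \<G>)) \<noteq> {}"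
      using Mfip[of "insert D (insert E \<G>)"] that by simp
    then show "D \<inter> E \<inter> (carrier R \<inter> \<Inter>\<G>) \<noteq> {}" by auto
  qed
  have all: "carrier R \<in> \<M>"
  proof (rule max)
    obtain i where i: "i \<in> I" using I_nonempty by blast
    have "U i \<subseteq> carrier R" using li_subset[OF li_U[OF i]] .
    then have "open_left_ideal (carrier R)" using left_ideal_carrier i by (auto simp: open_left_ideal_def)
    moreover have "affine_coset \<zero> (carrier R) = carrier R" by (auto simp: affine_coset_def)
    ultimately show "carrier R \<in> open_cosets" unfolding open_cosets_def using zero_closed by blast
    fix \<G> assume "finite \<G>" "\<G> \<subseteq> \<M>"
    then show "carrier R \<inter> (carrier R \<inter> \<Inter>\<G>) \<noteq> {}" using Mfip[of \<G>] by simp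
  qed
  have fin: "carrier R \<inter> \<Inter>\<G> \<in> \<M>" if "finite \<G>" "\<G> \<subseteq> \<M>" for \<G>
    using that
  proof (induction \<G>)
    case (insert D \<G>)
    then have "D \<inter> (carrier R \<inter> \<Inter>\<G>) \<in> \<M>" using Int by blast
    moreover have "D \<inter> (carrier R \<inter> \<Inter>\<G>) = carrier R \<inter> \<Inter>(insert D \<G>)" by auto
    ultimately show ?case by simp
  qed (use all in simp)
  have ne: "D \<noteq> {}" if "D \<in> \<M>" for D
    using Mfip[of "{D}"] that by auto
  have "\<exists>y\<in>carrier R. \<forall>D\<in>\<M>. y \<in> D"
  proof (rule maximal_family_has_point[OF Mo _ Int _ ne])
    show "\<M> \<noteq> {}" using all by blast
    fix C assume "C \<in> open_cosets" "\<And>D. D \<in> \<M> \<Longrightarrow> C \<inter> D \<noteq> {}"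
    note * = this
    show "C \<in> \<M>"
    proof (rule max[OF *(1)])
      fix \<G> assume "finite \<G>" "\<G> \<subseteq> \<M>"
      then show "C \<inter> (carrier R \<inter> \<Inter>\<G>) \<noteq> {}" by (intro *(2) fin)
    qed
  qed assumption+
  then obtain y where y: "y \<in> carrier R" "\<And>D. D \<in> \<M> \<Longrightarrow> y \<in> D" by blast
  have "y \<ominus> a t \<in> N t" if "t \<in> T" for t
  proof -
    have "affine_coset (a t) (N t) \<in> \<M>" using M0 that by (auto simp: fam_def)
    then show ?thesis using y(2)[of "affine_coset (a t) (N t)"] by (simp add: affine_coset_def)
  qed
  then show ?thesis using y(1) by blast
qed

end

section \<open>T-nilpotence and perturbed products\<close>

context ring
begin

text \<open>
  Otherwise let \<open>M\<close> be a left ideal that is maximal among those containing no partial product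
  \<open>p n = z (n - 1) \<cdots> z 0\<close>, and let \<open>y\<close> be simple over \<open>M\<close>. By maximality \<open>M + R y\<close> contains some
  \<open>p n\<close>; as the radical kills simple modules, \<open>p (n + 1) = z n p n\<close> is in \<open>M\<close>.
\<close>
lemma Jac_T_nilpotent:
  assumes semi: "left_semiartinian R" and z: "\<And>i. z i \<in> Jac R"
  shows "\<exists>n. desc_prod R z n = \<zero>"
proof (rule ccontr)
  assume ne: "\<nexists>n. desc_prod R z n = \<zero>"
  have zc: "z i \<in> carrier R" for i using z Jac_subset by blast
  define P where "P = range (desc_prod R z)"
  have "{\<zero>} \<inter> P = {}" using ne by (auto simp: P_def)
  then obtain M where M: "left_ideal M R" "M \<inter> P = {}" and
    max: "\<And>L. left_ideal L R \<Longrightarrow> M \<subset> L \<Longrightarrow> L \<inter> P \<noteq> {}"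
    by (rule left_ideal_maximal_avoiding[OF left_ideal_zero]) (rule that)
  have "desc_prod R z 0 \<in> P" unfolding P_def by (rule rangeI)
  then have "\<one> \<notin> M" using M(2) by auto
  then have "M \<noteq> carrier R" by auto
  then obtain y where y: "y \<in> carrier R" "y \<notin> M" "simple_over M y"
    by (rule left_semiartinian_simple_over[OF semi M(1)])
  let ?L = "{u \<oplus> v | u v. u \<in> M \<and> v \<in> (\<lambda>b. b \<otimes> y) ` carrier R}"
  have L: "left_ideal ?L R" using left_ideal_sum[OF M(1) left_ideal_principal[OF y(1)]] .
  have mem: "u \<oplus> b \<otimes> y \<in> ?L" if "u \<in> M" "b \<in> carrier R" for u b using that by blast
  have "y \<in> ?L" using mem[OF li_zero[OF M(1)] one_closed] y(1) by simp
  moreover have "u \<in> ?L" if "u \<in> M" for u using mem[OF that zero_closed] li_carr[OF M(1) that] y(1) by simp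
  ultimately have "M \<subset> ?L" using y(2) by blast
  then have "?L \<inter> P \<noteq> {}" by (rule max[OF L])
  then obtain w where w: "w \<in> ?L" "w \<in> P" by blast
  from w(2) obtain n where wn: "w = desc_prod R z n" unfolding P_def by (rule rangeE)
  from w(1) obtain u b where "w = u \<oplus> b \<otimes> y" and u: "u \<in> M" and b: "b \<in> carrier R" by blast
  then have n: "desc_prod R z n = u \<oplus> b \<otimes> y" using wn by simp
  have uc: "u \<in> carrier R" using li_carr[OF M(1) u] .
  have "z n \<otimes> b \<in> Jac R" using ideal.I_r_closed[OF ideal_Jac z b] .
  then have "(z n \<otimes> b) \<otimes> y \<in> M" using Jac_mult_simple[OF M(1) y(3)] by blast
  moreover have "z n \<otimes> u \<in> M" using li_mult[OF M(1) zc u] .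
  ultimately have "z n \<otimes> u \<oplus> (z n \<otimes> b) \<otimes> y \<in> M" using li_add[OF M(1)] by blast
  moreover have "z n \<otimes> u \<oplus> (z n \<otimes> b) \<otimes> y = desc_prod R z (Suc n)"
    using n uc b y(1) zc by (simp add: r_distr m_assoc)
  ultimately have "desc_prod R z (Suc n) \<in> M \<inter> P" unfolding P_def by (metis IntI rangeI)
  then show False using M(2) by blast
qed

lemma desc_prod_fun_upd_add:
  assumes "\<And>i. z i \<in> carrier R" "a \<in> carrier R" "b \<in> carrier R" "j < k"
  shows "desc_prod R (z(j := a \<oplus> b)) k = desc_prod R (z(j := a)) k \<oplus> desc_prod R (z(j := b)) k"
  using \<open>j < k\<close>
proof (induction k)
  case (Suc k)
  have c: "desc_prod R (z(j := d)) k \<in> carrier R" if "d \<in> carrier R" for d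
    using assms that by (intro desc_prod_closed) auto
  show ?case
  proof (cases "j = k")
    case True
    have same: "desc_prod R (z(j := d)) k = desc_prod R z k" for d
      using True by (intro desc_prod_cong) auto
    have eq: "desc_prod R (z(j := d)) (Suc k) = d \<otimes> desc_prod R z k" for d
      unfolding desc_prod.simps same using True by simp
    show ?thesis unfolding eq using assms(2,3) desc_prod_closed[of z k, OF assms(1)] by (rule l_distr)
  next
    case False
    then have "j < k" using Suc.prems by simp
    with Suc.IH have IH: "desc_prod R (z(j := a \<oplus> b)) k = desc_prod R (z(j := a)) k \<oplus> desc_prod R (z(j := b)) k" .
    have eq: "desc_prod R (z(j := d)) (Suc k) = z k \<otimes> desc_prod R (z(j := d)) k" for d
      using False by simp
    show ?thesis unfolding eq IH by (rule r_distr[OF c[OF assms(2)] c[OF assms(3)] assms(1)])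
  qed
qed simp

text \<open>
  Take differences in one factor at a time: products with factors \<open>x j + u j\<close> and \<open>x j + 0\<close>
  vanish, and so does the product with factor \<open>u j\<close>.
\<close>
lemma desc_prod_polarization:
  assumes x: "\<And>i. x i \<in> carrier R" and V: "V \<subseteq> carrier R" "\<zero> \<in> V"
    and zero: "\<And>u. (\<And>i. u i \<in> V) \<Longrightarrow> desc_prod R (\<lambda>i. x i \<oplus> u i) k = \<zero>"
    and u: "\<And>i. u i \<in> V"
  shows "desc_prod R u k = \<zero>"
proof -
  \<comment> \<open>\<open>j\<close> counts the factors that have been replaced.\<close>
  have "desc_prod R (\<lambda>i. if i < j then u i else x i \<oplus> u i) k = \<zero>" if "\<And>i. u i \<in> V" for j u
    using that
  proof (induction j arbitrary: u)
    case 0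
    then show ?case using zero by simp
  next
    case (Suc j)
    have uc: "u i \<in> carrier R" for i using Suc.prems V by blast
    define z where "z = (\<lambda>i. if i < j then u i else x i \<oplus> u i)"
    have zc: "z i \<in> carrier R" for i using uc x by (simp add: z_def)
    have z: "desc_prod R z k = \<zero>" using Suc.IH[OF Suc.prems] by (simp add: z_def)
    have eq: "(\<lambda>i. if i < Suc j then u i else x i \<oplus> u i) = z(j := u j)"
      by (auto simp: z_def fun_eq_iff less_Suc_eq)
    show ?case
    proof (cases "j < k")
      case True
      have "desc_prod R (\<lambda>i. if i < j then (u(j := \<zero>)) i else x i \<oplus> (u(j := \<zero>)) i) k = \<zero>"
        using Suc.prems V(2) by (intro Suc.IH) simp
      moreover have "(\<lambda>i. if i < j then (u(j := \<zero>)) i else x i \<oplus> (u(j := \<zero>)) i) = z(j := x j)"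
        using x by (auto simp: z_def fun_eq_iff)
      ultimately have xj: "desc_prod R (z(j := x j)) k = \<zero>" by simp
      have "z(j := x j \<oplus> u j) = z" by (auto simp: z_def)
      then have "\<zero> = \<zero> \<oplus> desc_prod R (z(j := u j)) k"
        using desc_prod_fun_upd_add[of z "x j" "u j" j k] zc x uc True z xj by simp
      moreover have "desc_prod R (z(j := u j)) k \<in> carrier R" using zc uc by (intro desc_prod_closed) simp
      ultimately show ?thesis using eq by simp
    next
      case False
      then have "desc_prod R (z(j := u j)) k = desc_prod R z k" by (intro desc_prod_cong) auto
      then show ?thesis using z eq by simp
    qed
  qed
  then have "desc_prod R (\<lambda>i. if i < k then u i else x i \<oplus> u i) k = \<zero>" using u by blast
  moreover have "desc_prod R (\<lambda>i. if i < k then u i else x i \<oplus> u i) k = desc_prod R u k"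
    by (intro desc_prod_cong) simp
  ultimately show ?thesis by simp
qed

lemma desc_prod_cong_ideal:
  assumes V: "ideal V R" and x: "\<And>i. x i \<in> carrier R" and y: "\<And>i. y i \<in> carrier R"
    and xy: "\<And>i. y i \<ominus> x i \<in> V"
  shows "desc_prod R y n \<ominus> desc_prod R x n \<in> V"
proof -
  have li: "left_ideal V R" using ideal_left_ideal[OF V] .
  show ?thesis
  proof (induction n)
    case 0
    then show ?case using li_zero[OF li] by simp
  next
    case (Suc n)
    have c: "desc_prod R y n \<in> carrier R" "desc_prod R x n \<in> carrier R"
      using x y desc_prod_closed by auto
    have "(y n \<ominus> x n) \<otimes> desc_prod R y n \<in> V" using ideal.I_r_closed[OF V xy c(1)] .
    then have 1: "y n \<otimes> desc_prod R y n \<ominus> x n \<otimes> desc_prod R y n \<in> V"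
      using x y c by (simp add: l_diff_distr)
    have "x n \<otimes> (desc_prod R y n \<ominus> desc_prod R x n) \<in> V" using li_mult[OF li x Suc] .
    then have 2: "x n \<otimes> desc_prod R y n \<ominus> x n \<otimes> desc_prod R x n \<in> V"
      using x y c by (simp add: r_diff_distr)
    show ?case using li_diff_trans[OF li _ _ _ 1 2] x y c by simp
  qed
qed

end

section \<open>The radical is open\<close>

context profinite_ring
begin

text \<open>
  Let \<open>C n\<close> be the left ideal of all \<open>x\<close> with \<open>X\<^sup>n x \<subseteq> U i\<close>. These increase, so \<open>C (m + 1) = C m\<close>
  for some \<open>m\<close>. If \<open>C m \<noteq> R\<close>, an element \<open>y\<close> that is simple over \<open>C m\<close> satisfies \<open>X y \<subseteq> C m\<close>, that
  is, \<open>y \<in> C (m + 1)\<close>, a contradiction. So \<open>1 \<in> C m\<close>.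
\<close>
lemma nilpotent_modulo_U:
  assumes semi: "left_semiartinian R" and i: "i \<in> I" and X: "ideal X R"
    and kill: "\<And>N y x. \<lbrakk>left_ideal N R; U i \<subseteq> N; simple_over N y; y \<notin> N; x \<in> X\<rbrakk> \<Longrightarrow> x \<otimes> y \<in> N"
  shows "\<exists>m. \<forall>z. (\<forall>j. z j \<in> X) \<longrightarrow> desc_prod R z m \<in> U i"
proof -
  have Xc: "x \<in> carrier R" if "x \<in> X" for x using ideal.Icarr[OF X that] .
  define colon where "colon N = {x \<in> carrier R. \<forall>j\<in>X. j \<otimes> x \<in> N}" for N
  define C where "C n = (colon ^^ n) (U i)" for n
  have C_Suc: "C (Suc n) = colon (C n)" for n by (simp add: C_def)
  have colon: "left_ideal (colon N) R \<and> N \<subseteq> colon N" if N: "left_ideal N R" for N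
  proof
    show "left_ideal (colon N) R"
    proof (rule left_idealI)
      show "colon N \<subseteq> carrier R" "\<zero> \<in> colon N" using Xc li_zero[OF N] by (auto simp: colon_def)
      show "\<And>x y. x \<in> colon N \<Longrightarrow> y \<in> colon N \<Longrightarrow> x \<oplus> y \<in> colon N"
        using Xc li_add[OF N] by (auto simp: colon_def r_distr)
      show "a \<otimes> x \<in> colon N" if a: "a \<in> carrier R" and x: "x \<in> colon N" for a x
      proof -
        have "j \<otimes> (a \<otimes> x) \<in> N" if j: "j \<in> X" for j
        proof -
          have "(j \<otimes> a) \<otimes> x \<in> N" using x ideal.I_r_closed[OF X j a] by (simp add: colon_def)
          then show ?thesis using a x Xc[OF j] by (simp add: colon_def m_assoc)
        qed
        then show ?thesis using a x by (simp add: colon_def)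
      qed
    qed
    show "N \<subseteq> colon N" using li_carr[OF N] li_mult[OF N Xc] by (auto simp: colon_def)
  qed
  have CI: "left_ideal (C n) R \<and> U i \<subseteq> C n" for n
  proof (induction n)
    case 0
    then show ?case using li_U[OF i] by (simp add: C_def)
  next
    case (Suc n)
    then show ?case using colon[of "C n"] by (auto simp: C_Suc)
  qed
  obtain M where M: "M \<in> range C" "\<And>N. N \<in> range C \<Longrightarrow> \<not> M \<subset> N"
    by (rule bounded_length_maximal[OF length_U[OF i], of "range C"]) (use CI in auto)
  then obtain m where m: "M = C m" by blast
  have stat: "colon (C m) = C m"
  proof -
    have "C (Suc m) \<in> range C" by (rule rangeI)
    then have "\<not> C m \<subset> colon (C m)" using M(2) m C_Suc by metis
    then show ?thesis using colon[of "C m"] CI by blast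
  qed
  have "C m = carrier R"
  proof (rule ccontr)
    assume "C m \<noteq> carrier R"
    then obtain y where y: "y \<in> carrier R" "y \<notin> C m" "simple_over (C m) y"
      using left_semiartinian_simple_over[OF semi] CI by blast
    have "x \<otimes> y \<in> C m" if "x \<in> X" for x using kill[of "C m" y x] CI y that by blast
    then have "y \<in> colon (C m)" using y(1) by (simp add: colon_def)
    then show False using stat y(2) by simp
  qed
  then have one: "\<one> \<in> C m" by simp
  have "desc_prod R z n \<otimes> x \<in> U i" if "\<And>j. z j \<in> X" "x \<in> C n" for z n x
    using that
  proof (induction n arbitrary: z x)
    case 0
    then show ?case using li_carr[OF li_U[OF i]] by (auto simp: C_def)
  next
    case (Suc n)
    have x: "x \<in> carrier R" "z 0 \<otimes> x \<in> C n" using Suc.prems by (auto simp: C_Suc colon_def)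
    have "desc_prod R (\<lambda>j. z (Suc j)) n \<otimes> (z 0 \<otimes> x) \<in> U i"
      using Suc.IH[of "\<lambda>j. z (Suc j)", OF _ x(2)] Suc.prems(1) by blast
    moreover have "desc_prod R z (Suc n) = desc_prod R (\<lambda>j. z (Suc j)) n \<otimes> z 0"
      using desc_prod_Suc_first Suc.prems(1) Xc by blast
    ultimately show ?case using x(1) Xc Suc.prems(1) by (simp add: m_assoc desc_prod_closed)
  qed
  then have "desc_prod R z m \<otimes> \<one> \<in> U i" if "\<forall>j. z j \<in> X" for z using that one by blast
  then show ?thesis using Xc by (intro exI[of _ m]) (auto simp: desc_prod_closed)
qed

text \<open>
  Let \<open>P'\<close> be an ideal that contains \<open>P\<close> properly, and let \<open>D\<close> be a minimal left ideal with
  \<open>P \<subseteq> D\<close> that is not contained in \<open>P'\<close>. Some \<open>a y\<close> is not killed by \<open>D\<close> modulo \<open>N\<close>, and the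
  annihilator of \<open>a y\<close> in \<open>D\<close> lies in \<open>P'\<close> by minimality. By simplicity \<open>P' D a y\<close> covers the
  simple module \<open>R y + N\<close> modulo \<open>N\<close>, so each \<open>r \<in> D\<close> agrees with an element of \<open>P'\<close> up to this
  annihilator; hence \<open>D \<subseteq> P'\<close>, a contradiction.
\<close>
lemma maximalideal_annihilator:
  assumes i: "i \<in> I" and N: "left_ideal N R" "U i \<subseteq> N" and y: "simple_over N y" "y \<notin> N"
  defines "P \<equiv> {r \<in> carrier R. \<forall>a\<in>carrier R. r \<otimes> (a \<otimes> y) \<in> N}"
  shows "maximalideal P R" "U i \<subseteq> P"
proof -
  have yc: "y \<in> carrier R" using y by (simp add: simple_over_def)
  have liP: "left_ideal P R"
    by (rule left_idealI)
      (use yc in \<open>auto simp: P_def li_zero[OF N(1)] l_distr m_assoc intro: li_add[OF N(1)] li_mult[OF N(1)]\<close>)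
  have idP: "ideal P R"
  proof (rule left_ideal_idealI[OF liP])
    fix r a assume r: "r \<in> P" and a: "a \<in> carrier R"
    have "(r \<otimes> a) \<otimes> (b \<otimes> y) \<in> N" if b: "b \<in> carrier R" for b
    proof -
      have "r \<otimes> ((a \<otimes> b) \<otimes> y) \<in> N" using r a b by (simp add: P_def)
      then show ?thesis using r a b yc by (simp add: P_def m_assoc)
    qed
    then show "r \<otimes> a \<in> P" using r a by (simp add: P_def)
  qed
  show UP: "U i \<subseteq> P"
    using N(2) ideal.I_r_closed[OF ideal_U[OF i]] ideal.Icarr[OF ideal_U[OF i]] yc by (auto simp: P_def)
  show "maximalideal P R"
  proof (rule maximalidealI[OF idP])
    have "\<one> \<notin> P"
    proof
      assume "\<one> \<in> P"
      then have "\<one> \<otimes> (\<one> \<otimes> y) \<in> N" unfolding P_def by blast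
      then show False using y(2) yc by simp
    qed
    then show "carrier R \<noteq> P" by blast
    fix P' assume P': "ideal P' R" "P \<subseteq> P'" "P' \<subseteq> carrier R"
    have liP': "left_ideal P' R" using ideal_left_ideal[OF P'(1)] .
    show "P' = P \<or> P' = carrier R"
    proof (rule ccontr)
      assume neg: "\<not> ?thesis"
      let ?\<D> = "{D. left_ideal D R \<and> P \<subseteq> D \<and> \<not> D \<subseteq> P'}"
      have "carrier R \<in> ?\<D>" using left_ideal_carrier li_subset[OF liP] neg P'(3) by blast
      then have ne: "?\<D> \<noteq> {}" by blast
      have sub: "?\<D> \<subseteq> {N. left_ideal N R \<and> U i \<subseteq> N}" using UP by blast
      obtain D where D: "D \<in> ?\<D>" "\<And>D'. D' \<in> ?\<D> \<Longrightarrow> \<not> D' \<subset> D"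
        by (rule bounded_length_minimal[OF length_U[OF i] sub ne]) (rule that)
      have liD: "left_ideal D R" using D by blast
      have Dc: "r \<in> carrier R" if "r \<in> D" for r using li_carr[OF liD that] .
      obtain d where d: "d \<in> D" "d \<notin> P" using D(1) P'(2) by blast
      then obtain a where a: "a \<in> carrier R" "d \<otimes> (a \<otimes> y) \<notin> N" using Dc by (auto simp: P_def)
      have ay: "a \<otimes> y \<in> carrier R" using a yc by simp
      define D' where "D' = {r \<in> D. r \<otimes> (a \<otimes> y) \<in> N}"
      have D'_Int: "D' = D \<inter> {r \<in> carrier R. r \<otimes> (a \<otimes> y) \<in> N}" using Dc by (auto simp: D'_def)
      have "left_ideal D' R" unfolding D'_Int using left_ideal_Int[OF liD left_ideal_colon[OF N(1) ay]] .
      moreover have "P \<subseteq> D'" using D(1) a(1) by (auto simp: D'_def P_def)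
      moreover have "D' \<subset> D" using d a(2) by (auto simp: D'_def)
      ultimately have D'P': "D' \<subseteq> P'" using D(2)[of D'] by blast
      obtain p where p: "p \<in> P'" "p \<notin> P" using neg P'(2) by blast
      have pc: "p \<in> carrier R" using p P'(3) by blast
      then obtain c where c: "c \<in> carrier R" "p \<otimes> (c \<otimes> y) \<notin> N" using p(2) by (auto simp: P_def)
      have simple: "\<exists>b\<in>carrier R. b \<otimes> (r \<otimes> y) \<ominus> y \<in> N" if "r \<in> carrier R" "r \<otimes> y \<notin> N" for r
        using y(1) that by (auto simp: simple_over_def)
      obtain s where s: "s \<in> carrier R" "s \<otimes> ((p \<otimes> c) \<otimes> y) \<ominus> y \<in> N"
        using simple[of "p \<otimes> c"] c pc yc by (auto simp: m_assoc)
      have dc: "d \<in> carrier R" using Dc[OF d(1)] .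
      obtain b where b: "b \<in> carrier R" "b \<otimes> ((d \<otimes> a) \<otimes> y) \<ominus> y \<in> N"
        using simple[of "d \<otimes> a"] a dc yc by (auto simp: m_assoc)
      have "r \<in> P'" if r: "r \<in> D" for r
      proof -
        have rc: "r \<in> carrier R" using Dc[OF r] .
        define q where "q = r \<otimes> a \<otimes> (s \<otimes> p \<otimes> c)"
        define p' where "p' = q \<otimes> b"
        have qc: "q \<in> carrier R" using rc a s pc c by (simp add: q_def)
        have "s \<otimes> p \<otimes> c \<in> P'"
          using p(1) s(1) c(1) ideal.I_l_closed[OF P'(1)] ideal.I_r_closed[OF P'(1)] by blast
        then have "q \<in> P'" unfolding q_def using ideal.I_l_closed[OF P'(1)] rc a by simp
        then have p'P: "p' \<in> P'" unfolding p'_def using ideal.I_r_closed[OF P'(1)] b(1) by blast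
        have p'c: "p' \<in> carrier R" using qc b by (simp add: p'_def)
        \<comment> \<open>\<open>p' d a y = q (b d a y) = q y = r a (s p c y) = r a y\<close> modulo \<open>N\<close>\<close>
        have "q \<otimes> (b \<otimes> ((d \<otimes> a) \<otimes> y) \<ominus> y) \<in> N" using li_mult[OF N(1) qc b(2)] .
        moreover have "q \<otimes> (b \<otimes> ((d \<otimes> a) \<otimes> y) \<ominus> y) = p' \<otimes> d \<otimes> (a \<otimes> y) \<ominus> q \<otimes> y"
          using qc b(1) dc a(1) yc by (simp add: r_diff_distr p'_def m_assoc)
        ultimately have 1: "p' \<otimes> d \<otimes> (a \<otimes> y) \<ominus> q \<otimes> y \<in> N" by simp
        have "(r \<otimes> a) \<otimes> (s \<otimes> ((p \<otimes> c) \<otimes> y) \<ominus> y) \<in> N" using li_mult[OF N(1) _ s(2)] rc a by simp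
        moreover have "(r \<otimes> a) \<otimes> (s \<otimes> ((p \<otimes> c) \<otimes> y) \<ominus> y) = q \<otimes> y \<ominus> r \<otimes> (a \<otimes> y)"
          using rc a(1) s(1) pc c(1) yc by (simp add: r_diff_distr q_def m_assoc)
        ultimately have 2: "q \<otimes> y \<ominus> r \<otimes> (a \<otimes> y) \<in> N" by simp
        have "p' \<otimes> d \<otimes> (a \<otimes> y) \<ominus> r \<otimes> (a \<otimes> y) \<in> N"
          using li_diff_trans[OF N(1) _ _ _ 1 2] p'c dc ay qc yc rc by simp
        then have "(p' \<otimes> d \<ominus> r) \<otimes> (a \<otimes> y) \<in> N" using p'c dc rc ay by (simp add: l_diff_distr)
        moreover have "p' \<otimes> d \<ominus> r \<in> D" using li_diff[OF liD li_mult[OF liD p'c d(1)] r] .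
        ultimately have "p' \<otimes> d \<ominus> r \<in> P'" using D'P' by (auto simp: D'_def)
        moreover have "p' \<otimes> d \<in> P'" using ideal.I_r_closed[OF P'(1) p'P dc] .
        ultimately show ?thesis using li_diff_right[OF liP', of "p' \<otimes> d" r] p'c dc rc by simp
      qed
      then show False using D(1) by blast
    qed
  qed
qed

definition open_maximal_ideals :: "'a set set" where
  "open_maximal_ideals = {P. maximalideal P R \<and> open_left_ideal P}"

lemma maximalideal_comaximal:
  assumes P: "maximalideal P R" and Q: "maximalideal Q R" and ne: "P \<noteq> Q"
  shows "\<exists>a\<in>P. \<one> \<ominus> a \<in> Q"
proof -
  interpret P: maximalideal P R by (rule P)
  interpret Q: maximalideal Q R by (rule Q)
  have lP: "left_ideal P R" and lQ: "left_ideal Q R" using ideal_left_ideal P.ideal_axioms Q.ideal_axioms by auto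
  let ?S = "{x \<oplus> y | x y. x \<in> P \<and> y \<in> Q}"
  have S: "ideal ?S R"
  proof (rule left_ideal_idealI[OF left_ideal_sum[OF lP lQ]])
    fix u a assume "u \<in> ?S" and a: "a \<in> carrier R"
    then obtain x y where *: "u = x \<oplus> y" "x \<in> P" "y \<in> Q" by blast
    then have "u \<otimes> a = x \<otimes> a \<oplus> y \<otimes> a" using a by (simp add: l_distr)
    moreover have "x \<otimes> a \<in> P" "y \<otimes> a \<in> Q" using P.I_r_closed Q.I_r_closed * a by auto
    ultimately show "u \<otimes> a \<in> ?S" by blast
  qed
  have PS: "x \<in> ?S" if "x \<in> P" for x
  proof -
    have "x = x \<oplus> \<zero>" using that by simp
    then show ?thesis using that li_zero[OF lQ] by blast
  qed
  have QS: "x \<in> ?S" if "x \<in> Q" for x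
  proof -
    have "x = \<zero> \<oplus> x" using that by simp
    then show ?thesis using that li_zero[OF lP] by blast
  qed
  have "?S = carrier R"
  proof (rule ccontr)
    assume neq: "?S \<noteq> carrier R"
    have sub: "?S \<subseteq> carrier R" by auto
    have "P \<subseteq> ?S" "Q \<subseteq> ?S" using PS QS by (simp_all only: subset_iff) blast+
    then have "?S = P" "?S = Q" using P.I_maximal[OF S _ sub] Q.I_maximal[OF S _ sub] neq by blast+
    then show False using ne by simp
  qed
  then have "\<one> \<in> ?S" by simp
  then obtain a b where ab: "\<one> = a \<oplus> b" "a \<in> P" "b \<in> Q" by blast
  have "\<one> \<ominus> a = (b \<oplus> a) \<ominus> a" using ab a_comm[of a b] by simp
  also have "\<dots> = b" using ab(2,3) by (simp add: minus_eq a_assoc r_neg)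
  finally show ?thesis using ab(2,3) by (intro bexI[of _ a]) simp_all
qed

text \<open>
  Any finite number of the congruences can be solved, as distinct maximal ideals are comaximal;
  linear compactness solves all of them.
\<close>
lemma chinese_remainder_sequence:
  assumes P: "\<And>n::nat. P n \<in> open_maximal_ideals" and inj: "inj P" and c: "\<And>n. c n \<in> carrier R"
  shows "\<exists>x\<in>carrier R. \<forall>n. x \<ominus> c n \<in> P n"
proof -
  have mx: "maximalideal (P n) R" and op: "open_left_ideal (P n)" for n
    using P by (auto simp: open_maximal_ideals_def)
  have id: "ideal (P n) R" for n using mx maximalideal_def by blast
  have li: "left_ideal (P n) R" for n using ideal_left_ideal id by blast
  have idem: "\<exists>e\<in>carrier R. (\<forall>k<m. k \<noteq> n \<longrightarrow> e \<in> P k) \<and> \<one> \<ominus> e \<in> P n" for n m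
  proof (induction m)
    case 0
    show ?case using li_zero[OF li] by (intro bexI[of _ \<one>]) auto
  next
    case (Suc m)
    then obtain e where e: "e \<in> carrier R" "\<forall>k<m. k \<noteq> n \<longrightarrow> e \<in> P k" "\<one> \<ominus> e \<in> P n" by blast
    show ?case
    proof (cases "m = n")
      case True
      then show ?thesis using e by (intro bexI[of _ e]) (auto simp: less_Suc_eq)
    next
      case False
      then have "P m \<noteq> P n" using inj by (auto dest: injD)
      then obtain a where a: "a \<in> P m" "\<one> \<ominus> a \<in> P n" using maximalideal_comaximal[OF mx mx] by blast
      have ac: "a \<in> carrier R" using li_carr[OF li a(1)] .
      have "e \<ominus> e \<otimes> a \<in> P n" using li_mult[OF li e(1) a(2)] e(1) ac by (simp add: r_diff_distr)
      then have "\<one> \<ominus> e \<otimes> a \<in> P n" using li_diff_trans[OF li _ _ _ e(3)] e(1) ac by simp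
      moreover have "e \<otimes> a \<in> P k" if "k < Suc m" "k \<noteq> n" for k
        using that e li_mult[OF li e(1) a(1)] ideal.I_r_closed[OF id _ ac] by (cases "k = m") auto
      ultimately show ?thesis using e(1) ac by (intro bexI[of _ "e \<otimes> a"]) auto
    qed
  qed
  have fin: "\<exists>x\<in>carrier R. \<forall>k<n. x \<ominus> c k \<in> P k" for n
  proof (induction n)
    case (Suc n)
    then obtain x where x: "x \<in> carrier R" "\<forall>k<n. x \<ominus> c k \<in> P k" by blast
    obtain e where e: "e \<in> carrier R" "\<forall>k<n. k \<noteq> n \<longrightarrow> e \<in> P k" "\<one> \<ominus> e \<in> P n" using idem by blast
    define w where "w = x \<oplus> (c n \<ominus> x) \<otimes> e"
    have wc: "w \<in> carrier R" using x e c by (simp add: w_def)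
    have "w \<ominus> c k \<in> P k" if k: "k < Suc n" for k
    proof (cases "k = n")
      case True
      have "(c n \<ominus> x) \<otimes> (\<one> \<ominus> e) \<in> P n" using li_mult[OF li _ e(3)] c x by simp
      moreover have "c n \<ominus> w = (c n \<ominus> x) \<otimes> (\<one> \<ominus> e)"
      proof -
        have "(c n \<ominus> x) \<otimes> (\<one> \<ominus> e) = (c n \<ominus> x) \<ominus> (c n \<ominus> x) \<otimes> e"
          using c x e by (simp add: r_diff_distr)
        also have "\<dots> = c n \<ominus> w" unfolding w_def using c x e by (simp add: minus_eq minus_add a_assoc)
        finally show ?thesis by simp
      qed
      ultimately have "c n \<ominus> w \<in> P n" by simp
      then show ?thesis using li_diff_swap[OF li c wc] True by blast
    next
      case False
      then have kn: "k < n" using k by simp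
      have "(c n \<ominus> x) \<otimes> e \<in> P k" using li_mult[OF li] e(2) kn c x by simp
      moreover have "w \<ominus> x = (c n \<ominus> x) \<otimes> e"
      proof -
        define t where "t = (c n \<ominus> x) \<otimes> e"
        have tc: "t \<in> carrier R" using c x e by (simp add: t_def)
        have "w \<ominus> x = (t \<oplus> x) \<ominus> x" unfolding w_def t_def[symmetric] using a_comm[OF x(1) tc] by simp
        also have "\<dots> = t" using tc x by (simp add: minus_eq a_assoc r_neg)
        finally show ?thesis by (simp add: t_def)
      qed
      ultimately have "w \<ominus> x \<in> P k" by simp
      then show ?thesis using li_diff_trans[OF li wc x(1) c] x(2) kn by blast
    qed
    then show ?case using wc by blast
  qed (use zero_closed in blast)
  have "\<exists>x\<in>carrier R. \<forall>n\<in>UNIV. x \<ominus> c n \<in> P n"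
  proof (rule linearly_compact)
    fix F :: "nat set" assume "finite F" "F \<subseteq> UNIV"
    then obtain n where "F \<subseteq> {..<n}" using finite_nat_iff_bounded by blast
    then show "\<exists>y\<in>carrier R. \<forall>t\<in>F. y \<ominus> c t \<in> P t" using fin[of n] by (meson lessThan_iff subsetD)
  qed (use c op in auto)
  then show ?thesis by simp
qed

text \<open>
  Semisimple profinite algebras with infinitely many factors are not semiartinian: modulo the
  ideal \<open>F\<close> of elements with finite support, where the support of \<open>x\<close> is the set of \<open>n\<close> with
  \<open>x \<notin> P n\<close>, an element \<open>y\<close> of infinite support decomposes further, by means of an element \<open>e\<close>
  which is the indicator of half of its support.
\<close>
lemma finite_open_maximal_ideals:
  assumes semi: "left_semiartinian R"
  shows "finite open_maximal_ideals"
proof (rule ccontr)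
  assume "infinite open_maximal_ideals"
  then obtain P :: "nat \<Rightarrow> 'a set" where inj: "inj P" and P: "\<And>n. P n \<in> open_maximal_ideals"
    using infinite_countable_subset[of open_maximal_ideals] by blast
  have mx: "maximalideal (P n) R" for n using P by (simp add: open_maximal_ideals_def)
  have li: "left_ideal (P n) R" for n using mx ideal_left_ideal maximalideal_def by blast
  have one: "\<one> \<notin> P n" for n using li_one[OF li] maximalideal.I_notcarr[OF mx] by blast
  define F where "F = {x \<in> carrier R. finite {n. x \<notin> P n}}"
  have F: "left_ideal F R"
  proof (rule left_idealI)
    show "F \<subseteq> carrier R" "\<zero> \<in> F" using li_zero[OF li] by (auto simp: F_def)
    show "x \<oplus> y \<in> F" if "x \<in> F" "y \<in> F" for x y
    proof -
      have "{n. x \<oplus> y \<notin> P n} \<subseteq> {n. x \<notin> P n} \<union> {n. y \<notin> P n}" using li_add[OF li] by blast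
      then show ?thesis using that by (auto simp: F_def intro: finite_subset)
    qed
    show "a \<otimes> x \<in> F" if "a \<in> carrier R" "x \<in> F" for a x
    proof -
      have "{n. a \<otimes> x \<notin> P n} \<subseteq> {n. x \<notin> P n}" using li_mult[OF li] that(1) by blast
      then show ?thesis using that by (auto simp: F_def intro: finite_subset)
    qed
  qed
  have "{n. \<one> \<notin> P n} = UNIV" using one by blast
  then have "\<one> \<notin> F" by (simp add: F_def)
  then have "F \<noteq> carrier R" by auto
  then obtain y where y: "y \<in> carrier R" "y \<notin> F" "simple_over F y"
    by (rule left_semiartinian_simple_over[OF semi F])
  then have "infinite {n. y \<notin> P n}" by (simp add: F_def)
  then obtain S T where ST: "S \<subseteq> {n. y \<notin> P n}" "T \<subseteq> {n. y \<notin> P n}" "infinite S" "infinite T" "S \<inter> T = {}"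
    by (rule infinite_split)
  define c where "c n = (if n \<in> S then \<one> else \<zero>)" for n
  have "c n \<in> carrier R" for n by (simp add: c_def)
  then obtain e where e: "e \<in> carrier R" "\<And>n. e \<ominus> c n \<in> P n"
    using chinese_remainder_sequence[OF P inj, of c] by blast
  have eS: "e \<otimes> y \<notin> P n" if "n \<in> S" for n
  proof
    assume ey: "e \<otimes> y \<in> P n"
    have "e \<ominus> \<one> \<in> P n" using e(2)[of n] that by (simp add: c_def)
    then have "(e \<ominus> \<one>) \<otimes> y \<in> P n" using ideal.I_r_closed[of "P n" R] mx maximalideal_def y(1) by blast
    then have "e \<otimes> y \<ominus> y \<in> P n" using e(1) y(1) by (simp add: l_diff_distr)
    then have "y \<in> P n" using li_diff_right[OF li, of "e \<otimes> y" y] ey e(1) y(1) by blast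
    then show False using ST(1) that by blast
  qed
  have eT: "e \<otimes> y \<in> P n" if "n \<in> T" for n
  proof -
    have "n \<notin> S" using that ST(5) by blast
    then have "e \<in> P n" using e(2)[of n] e(1) by (simp add: c_def)
    then show ?thesis using ideal.I_r_closed[of "P n" R] mx maximalideal_def y(1) by blast
  qed
  have "S \<subseteq> {n. e \<otimes> y \<notin> P n}" using eS by blast
  then have "infinite {n. e \<otimes> y \<notin> P n}" using ST(3) finite_subset by blast
  then have "e \<otimes> y \<notin> F" by (simp add: F_def)
  then obtain b where b: "b \<in> carrier R" "b \<otimes> (e \<otimes> y) \<ominus> y \<in> F"
    using y(3) e(1) by (auto simp: simple_over_def)
  have "T \<subseteq> {n. b \<otimes> (e \<otimes> y) \<ominus> y \<notin> P n}"
  proof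
    fix n assume n: "n \<in> T"
    have "b \<otimes> (e \<otimes> y) \<in> P n" using li_mult[OF li b(1) eT[OF n]] .
    moreover have "y \<notin> P n" using n ST(2) by blast
    ultimately have "b \<otimes> (e \<otimes> y) \<ominus> y \<notin> P n"
      using li_diff_right[OF li, of "b \<otimes> (e \<otimes> y)" y] b(1) e(1) y(1) by blast
    then show "n \<in> {n. b \<otimes> (e \<otimes> y) \<ominus> y \<notin> P n}" by simp
  qed
  then have "infinite {n. b \<otimes> (e \<otimes> y) \<ominus> y \<notin> P n}" using ST(4) finite_subset by blast
  then show False using b(2) by (simp add: F_def)
qed

text \<open>
  Modulo each \<open>U i\<close> the geometric series is finite and gives a left inverse of \<open>1 - q\<close>. The left
  inverses modulo \<open>U i\<close> form a coset of the open left ideal of all \<open>b\<close> with \<open>b (1 - q) \<in> U i\<close>, and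
  these cosets are directed.
\<close>
lemma topologically_nilpotent_left_inverse:
  assumes q: "q \<in> carrier R" and nil: "\<And>i. i \<in> I \<Longrightarrow> \<exists>m. desc_prod R (\<lambda>_. q) m \<in> U i"
  shows "\<exists>b\<in>carrier R. b \<otimes> (\<one> \<ominus> q) = \<one>"
proof -
  have geo: "\<exists>b\<in>carrier R. \<one> \<ominus> b \<otimes> (\<one> \<ominus> q) = desc_prod R (\<lambda>_. q) m" for m
  proof (induction m)
    case 0
    show ?case using q by (intro bexI[of _ \<zero>]) auto
  next
    case (Suc m)
    then obtain b where b: "b \<in> carrier R" "\<one> \<ominus> b \<otimes> (\<one> \<ominus> q) = desc_prod R (\<lambda>_. q) m" by blast
    define t where "t = q \<otimes> (b \<otimes> (\<one> \<ominus> q))"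
    have t: "t \<in> carrier R" using q b by (simp add: t_def)
    have "(\<one> \<oplus> q \<otimes> b) \<otimes> (\<one> \<ominus> q) = (\<one> \<ominus> q) \<oplus> t" using q b by (simp add: l_distr m_assoc t_def)
    then have "\<one> \<ominus> (\<one> \<oplus> q \<otimes> b) \<otimes> (\<one> \<ominus> q) = \<one> \<ominus> ((\<one> \<ominus> q) \<oplus> t)" by simp
    also have "\<dots> = q \<ominus> t" using q t by (simp add: minus_eq minus_add a_assoc[symmetric] r_neg)
    also have "\<dots> = q \<otimes> (\<one> \<ominus> b \<otimes> (\<one> \<ominus> q))" using q b(1) by (simp add: r_diff_distr t_def)
    also have "\<dots> = desc_prod R (\<lambda>_. q) (Suc m)" unfolding b(2) by simp
    finally show ?case using b q by (intro bexI[of _ "\<one> \<oplus> q \<otimes> b"]) simp_all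
  qed
  have "\<exists>b\<in>carrier R. b \<otimes> (\<one> \<ominus> q) \<ominus> \<one> \<in> U i" if i: "i \<in> I" for i
  proof -
    obtain m where m: "desc_prod R (\<lambda>_. q) m \<in> U i" using nil[OF i] by blast
    obtain b where b: "b \<in> carrier R" "\<one> \<ominus> b \<otimes> (\<one> \<ominus> q) = desc_prod R (\<lambda>_. q) m" using geo by blast
    then have "\<one> \<ominus> b \<otimes> (\<one> \<ominus> q) \<in> U i" using m by simp
    then show ?thesis using li_diff_swap[OF li_U[OF i]] b(1) q by (intro bexI[of _ b]) simp_all
  qed
  then obtain a where a: "\<And>i. i \<in> I \<Longrightarrow> a i \<in> carrier R"
    "\<And>i. i \<in> I \<Longrightarrow> a i \<otimes> (\<one> \<ominus> q) \<ominus> \<one> \<in> U i" by metis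
  define N where "N i = {b \<in> carrier R. b \<otimes> (\<one> \<ominus> q) \<in> U i}" for i
  have qc: "\<one> \<ominus> q \<in> carrier R" using q by simp
  have Nmem: "y \<ominus> a i \<in> N i \<longleftrightarrow> y \<otimes> (\<one> \<ominus> q) \<ominus> \<one> \<in> U i" if y: "y \<in> carrier R" and i: "i \<in> I" for y i
  proof -
    have c: "y \<otimes> (\<one> \<ominus> q) \<in> carrier R" "a i \<otimes> (\<one> \<ominus> q) \<in> carrier R" using y a(1)[OF i] qc by auto
    have eq: "(y \<ominus> a i) \<otimes> (\<one> \<ominus> q) = y \<otimes> (\<one> \<ominus> q) \<ominus> a i \<otimes> (\<one> \<ominus> q)"
      using y a(1)[OF i] qc by (simp add: l_diff_distr)
    have "y \<ominus> a i \<in> N i \<longleftrightarrow> y \<otimes> (\<one> \<ominus> q) \<ominus> a i \<otimes> (\<one> \<ominus> q) \<in> U i"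
      using y a(1)[OF i] eq by (simp add: N_def)
    also have "\<dots> \<longleftrightarrow> y \<otimes> (\<one> \<ominus> q) \<ominus> \<one> \<in> U i"
      using li_diff_trans[OF li_U[OF i] c one_closed _ a(2)[OF i]]
        li_diff_trans[OF li_U[OF i] c(1) one_closed c(2) _ li_diff_swap[OF li_U[OF i] c(2) one_closed a(2)[OF i]]]
      by blast
    finally show ?thesis .
  qed
  have "\<exists>y\<in>carrier R. \<forall>i\<in>I. y \<ominus> a i \<in> N i"
  proof (rule linearly_compact)
    show "a i \<in> carrier R" if "i \<in> I" for i using a(1)[OF that] .
    show "open_left_ideal (N i)" if i: "i \<in> I" for i
    proof -
      have "U i \<subseteq> N i"
        using ideal.Icarr[OF ideal_U[OF i]] ideal.I_r_closed[OF ideal_U[OF i] _ qc] by (auto simp: N_def)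
      then show ?thesis using left_ideal_colon[OF li_U[OF i] qc] i by (auto simp: open_left_ideal_def N_def)
    qed
    fix F assume F: "finite F" "F \<subseteq> I"
    have "\<exists>k\<in>I. \<forall>i\<in>F. U k \<subseteq> U i" using F
    proof (induction F)
      case empty
      show ?case using I_nonempty by blast
    next
      case (insert j F)
      then obtain k where k: "k \<in> I" "\<forall>i\<in>F. U k \<subseteq> U i" by blast
      have "j \<in> I" using insert by blast
      then obtain l where "l \<in> I" "U l \<subseteq> U k" "U l \<subseteq> U j" using directed[OF k(1)] by blast
      then show ?case using k(2) by blast
    qed
    then obtain k where k: "k \<in> I" "\<And>i. i \<in> F \<Longrightarrow> U k \<subseteq> U i" by blast
    have "a k \<ominus> a i \<in> N i" if "i \<in> F" for i
    proof -
      have "a k \<otimes> (\<one> \<ominus> q) \<ominus> \<one> \<in> U i" using a(2)[OF k(1)] k(2)[OF that] by blast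
      then show ?thesis using Nmem[OF a(1)[OF k(1)]] that F by blast
    qed
    then show "\<exists>y\<in>carrier R. \<forall>t\<in>F. y \<ominus> a t \<in> N t" using a(1)[OF k(1)] by blast
  qed
  then obtain y where y: "y \<in> carrier R" "\<And>i. i \<in> I \<Longrightarrow> y \<ominus> a i \<in> N i" by blast
  have "y \<otimes> (\<one> \<ominus> q) \<ominus> \<one> = \<zero>"
  proof (rule separated)
    show "y \<otimes> (\<one> \<ominus> q) \<ominus> \<one> \<in> carrier R" using y(1) qc by simp
    show "y \<otimes> (\<one> \<ominus> q) \<ominus> \<one> \<in> U i" if "i \<in> I" for i using Nmem[OF y(1) that] y(2)[OF that] by blast
  qed
  then have "y \<otimes> (\<one> \<ominus> q) = \<one>" using diff_eq_zero_iff[of "y \<otimes> (\<one> \<ominus> q)" \<one>] y(1) qc by simp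
  then show ?thesis using y(1) by blast
qed

text \<open>
  The intersection \<open>Q\<close> of the finitely many open maximal ideals is open. It kills every simple
  module over \<open>R / U i\<close>, so its elements are topologically nilpotent and \<open>Q \<subseteq> Jac R\<close>.
\<close>
theorem Jac_open:
  assumes semi: "left_semiartinian R"
  shows "\<exists>i\<in>I. U i \<subseteq> Jac R"
proof -
  define Q where "Q = carrier R \<inter> \<Inter>open_maximal_ideals"
  have om: "ideal P R \<and> open_left_ideal P" if "P \<in> open_maximal_ideals" for P
    using that maximalideal_def by (auto simp: open_maximal_ideals_def)
  have "finite \<P> \<Longrightarrow> \<P> \<subseteq> open_maximal_ideals \<Longrightarrow> ideal (carrier R \<inter> \<Inter>\<P>) R \<and> open_left_ideal (carrier R \<inter> \<Inter>\<P>)" for \<P>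
  proof (induction \<P> rule: finite_induct)
    case empty
    obtain i where i: "i \<in> I" using I_nonempty by blast
    then have "open_left_ideal (carrier R)"
      using left_ideal_carrier li_subset[OF li_U[OF i]] by (auto simp: open_left_ideal_def)
    then show ?case using oneideal by simp
  next
    case (insert P \<P>)
    have "carrier R \<inter> \<Inter>(insert P \<P>) = P \<inter> (carrier R \<inter> \<Inter>\<P>)" by auto
    moreover have "ideal (P \<inter> (carrier R \<inter> \<Inter>\<P>)) R" "open_left_ideal (P \<inter> (carrier R \<inter> \<Inter>\<P>))"
      using insert om[of P] i_intersect open_left_ideal_Int by auto
    ultimately show ?case by simp
  qed
  then have Q: "ideal Q R" "open_left_ideal Q"
    using finite_open_maximal_ideals[OF semi] unfolding Q_def by blast+
  have nil: "\<exists>m. \<forall>z. (\<forall>j. z j \<in> Q) \<longrightarrow> desc_prod R z m \<in> U i" if i: "i \<in> I" for i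
  proof (rule nilpotent_modulo_U[OF semi i Q(1)])
    fix N y x assume N: "left_ideal N R" "U i \<subseteq> N" and y: "simple_over N y" "y \<notin> N" and x: "x \<in> Q"
    let ?P = "{r \<in> carrier R. \<forall>a\<in>carrier R. r \<otimes> (a \<otimes> y) \<in> N}"
    note P = maximalideal_annihilator[OF i N y]
    have "left_ideal ?P R" using P(1) ideal_left_ideal maximalideal_def by blast
    then have "?P \<in> open_maximal_ideals"
      unfolding open_maximal_ideals_def open_left_ideal_def using P i by blast
    then have "x \<in> ?P" using x by (auto simp: Q_def)
    then have "x \<otimes> (\<one> \<otimes> y) \<in> N" by blast
    then show "x \<otimes> y \<in> N" using y by (simp add: simple_over_def)
  qed
  have "Q \<subseteq> Jac R"
  proof (rule left_quasiregular_subset_Jac)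
    show "left_ideal Q R" using ideal_left_ideal[OF Q(1)] .
    fix q assume q: "q \<in> Q"
    show "\<exists>b\<in>carrier R. b \<otimes> (\<one> \<ominus> q) = \<one>"
    proof (rule topologically_nilpotent_left_inverse)
      show "q \<in> carrier R" using q by (simp add: Q_def)
      show "\<exists>m. desc_prod R (\<lambda>_. q) m \<in> U i" if i: "i \<in> I" for i
      proof -
        obtain m where "\<forall>z. (\<forall>j. z j \<in> Q) \<longrightarrow> desc_prod R z m \<in> U i" using nil[OF i] by blast
        then have "desc_prod R (\<lambda>_. q) m \<in> U i" using q by simp
        then show ?thesis by blast
      qed
    qed
  qed
  then show ?thesis using Q(2) by (auto simp: open_left_ideal_def)
qed

section \<open>The radical is nilpotent\<close>

text \<open>
  A Baire category argument on the sequences in the radical. It constructs ideals \<open>U (i n)\<close>,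
  decreasing, and sequences \<open>x n\<close> such that \<open>x (n + 1)\<close> differs from \<open>x n\<close> by elements of
  \<open>U (i n)\<close> and the product of the first \<open>n\<close> terms of \<open>x n\<close> is not in \<open>U (i n)\<close>. The limit
  sequence then has nonzero partial products and contradicts T-nilpotence.
\<close>
lemma small_ideal_nilpotent:
  assumes semi: "left_semiartinian R"
  shows "\<exists>i\<in>I. \<exists>k. \<forall>z. (\<forall>j. z j \<in> U i) \<longrightarrow> desc_prod R z k = \<zero>"
proof (rule ccontr)
  assume "\<not> ?thesis"
  then have neg: "\<exists>z. (\<forall>j. z j \<in> U i) \<and> desc_prod R z k \<noteq> \<zero>" if "i \<in> I" for i k using that by blast
  obtain i0 where i0: "i0 \<in> I" "U i0 \<subseteq> Jac R" using Jac_open[OF semi] by blast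
  have Uc: "x \<in> carrier R" if "i \<in> I" "x \<in> U i" for i x using li_carr[OF li_U] that by blast
  have small: "\<exists>k\<in>I. U k \<subseteq> U i \<and> x \<notin> U k" if i: "i \<in> I" and x: "x \<in> carrier R" "x \<noteq> \<zero>" for i x
  proof -
    obtain j where j: "j \<in> I" "x \<notin> U j" using separated[OF x(1)] x(2) by blast
    obtain k where "k \<in> I" "U k \<subseteq> U i" "U k \<subseteq> U j" using directed[OF i j(1)] by blast
    then show ?thesis using j(2) by blast
  qed
  \<comment> \<open>\<open>St n (i, x)\<close> is the state after \<open>n\<close> steps and \<open>Tr\<close> relates successive states.  All terms
    stay in \<open>U i0\<close>, so that the limit is a sequence in the radical.\<close>
  define St where "St n s \<longleftrightarrow> fst s \<in> I \<and> U (fst s) \<subseteq> U i0 \<and> (\<forall>m. snd s m \<in> U i0) \<and>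
    desc_prod R (snd s) n \<notin> U (fst s)" for n and s :: "'i \<times> (nat \<Rightarrow> 'a)"
  define Tr where "Tr s t \<longleftrightarrow> U (fst t) \<subseteq> U (fst s) \<and> (\<forall>m. snd t m \<ominus> snd s m \<in> U (fst s))"
    for s t :: "'i \<times> (nat \<Rightarrow> 'a)"
  have start: "\<exists>s. St 0 s"
  proof -
    have "\<one> \<noteq> \<zero>" using neg[OF i0(1), of 0] by auto
    then obtain k where "k \<in> I" "U k \<subseteq> U i0" "\<one> \<notin> U k" using small[OF i0(1)] by blast
    then have "St 0 (k, \<lambda>_. \<zero>)" using li_zero[OF li_U[OF i0(1)]] by (simp add: St_def)
    then show ?thesis by blast
  qed
  have next_step: "\<exists>t. St (Suc n) t \<and> Tr s t" if "St n s" for s n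
  proof -
    obtain i x where s: "s = (i, x)" by fastforce
    have i: "i \<in> I" "U i \<subseteq> U i0" and x: "\<And>m. x m \<in> U i0" using that by (auto simp: St_def s)
    have xc: "x m \<in> carrier R" for m using Uc[OF i0(1) x] .
    obtain z where z: "\<And>j. z j \<in> U i" "desc_prod R z (Suc n) \<noteq> \<zero>" using neg[OF i(1), of "Suc n"] by blast
    obtain u where u: "\<And>m. u m \<in> U i" "desc_prod R (\<lambda>m. x m \<oplus> u m) (Suc n) \<noteq> \<zero>"
      using desc_prod_polarization[of x "U i" "Suc n" z] xc z li_subset[OF li_U[OF i(1)]] li_zero[OF li_U[OF i(1)]]
      by blast
    have uc: "u m \<in> carrier R" for m using Uc[OF i(1) u(1)] .
    let ?x = "\<lambda>m. x m \<oplus> u m"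
    have "desc_prod R ?x (Suc n) \<in> carrier R" using xc uc by (intro desc_prod_closed) simp
    then obtain k where k: "k \<in> I" "U k \<subseteq> U i" "desc_prod R ?x (Suc n) \<notin> U k" using small[OF i(1) _ u(2)] by blast
    have "?x m \<in> U i0" for m using li_add[OF li_U[OF i0(1)] x] u(1) i(2) by blast
    then have "St (Suc n) (k, ?x)" using k i(2) unfolding St_def by auto
    moreover have "?x m \<ominus> x m = u m" for m
    proof -
      have "?x m \<ominus> x m = (u m \<oplus> x m) \<ominus> x m" using a_comm[OF xc uc] by simp
      also have "\<dots> = u m" using xc uc by (simp add: minus_eq a_assoc r_neg)
      finally show ?thesis .
    qed
    then have "Tr s (k, ?x)" using k(2) u(1) by (simp add: Tr_def s)
    ultimately show ?thesis by blast
  qed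
  obtain f where f: "\<And>n. St n (f n)" "\<And>n. Tr (f n) (f (Suc n))"
    using dependent_nat_choice[of St "\<lambda>_. Tr", OF start next_step] by blast
  define i x where "i n = fst (f n)" and "x n = snd (f n)" for n
  have iI: "i n \<in> I" and iU: "U (i n) \<subseteq> U i0" and xU: "x n m \<in> U i0" and nz: "desc_prod R (x n) n \<notin> U (i n)" for n m
    using f(1)[of n] by (auto simp: St_def i_def x_def)
  have step: "U (i (Suc n)) \<subseteq> U (i n)" "x (Suc n) m \<ominus> x n m \<in> U (i n)" for n m
    using f(2)[of n] by (auto simp: Tr_def i_def x_def)
  have xc: "x n m \<in> carrier R" for n m using Uc[OF i0(1) xU] .
  have dec: "U (i (n + k)) \<subseteq> U (i n)" for n k
    by (induction k) (use step(1) in auto)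
  have cauchy: "x (n + k) m \<ominus> x n m \<in> U (i n)" for n k m
  proof (induction k)
    case 0
    show ?case using li_zero[OF li_U[OF iI]] xc by simp
  next
    case (Suc k)
    have "x (Suc (n + k)) m \<ominus> x (n + k) m \<in> U (i n)" using step(2)[of "n + k" m] dec by blast
    then show ?case using li_diff_trans[OF li_U[OF iI] xc xc xc _ Suc] by simp
  qed
  have "\<exists>y\<in>carrier R. \<forall>n\<in>UNIV. y \<ominus> x n m \<in> U (i n)" for m
  proof (rule linearly_compact)
    show "x n m \<in> carrier R" "open_left_ideal (U (i n))" for n using xc open_left_ideal_U[OF iI] by auto
    fix F :: "nat set" assume "finite F" "F \<subseteq> UNIV"
    then obtain b where b: "F \<subseteq> {..<b}" using finite_nat_iff_bounded by blast
    have "x b m \<ominus> x n m \<in> U (i n)" if "n \<in> F" for n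
    proof -
      have "n \<le> b" using b that by auto
      then show ?thesis using cauchy[of n "b - n" m] by simp
    qed
    then show "\<exists>y\<in>carrier R. \<forall>n\<in>F. y \<ominus> x n m \<in> U (i n)" using xc by blast
  qed
  then have "\<forall>m. \<exists>y. y \<in> carrier R \<and> (\<forall>n. y \<ominus> x n m \<in> U (i n))" by (simp add: Bex_def)
  then obtain y where y: "\<And>m. y m \<in> carrier R" "\<And>m n. y m \<ominus> x n m \<in> U (i n)" by metis
  have "y m \<in> Jac R" for m
  proof -
    have "y m \<ominus> x 0 m \<in> U i0" using y(2) iU by blast
    then have "y m \<in> U i0" using li_diff_left[OF li_U[OF i0(1)] y(1) xc] xU by blast
    then show ?thesis using i0(2) by blast
  qed
  then obtain n where n: "desc_prod R y n = \<zero>" using Jac_T_nilpotent[OF semi] by blast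
  have "desc_prod R y n \<ominus> desc_prod R (x n) n \<in> U (i n)"
    by (rule desc_prod_cong_ideal[OF ideal_U[OF iI] xc y(1) y(2)])
  then have "desc_prod R (x n) n \<in> U (i n)"
    using li_diff_right[OF li_U[OF iI], of "desc_prod R y n"] n xc li_zero[OF li_U[OF iI]]
    by (simp add: desc_prod_closed[OF xc])
  then show False by (rule notE[OF nz])
qed

text \<open>
  If products of \<open>k\<close> elements of \<open>U i\<close> vanish and products of \<open>m\<close> elements of the radical lie in
  \<open>U i\<close>, then products of \<open>m k\<close> elements of the radical vanish: group them into blocks.
\<close>
theorem Jac_nilpotent:
  assumes semi: "left_semiartinian R"
  shows "\<exists>n. \<forall>z. (\<forall>j. z j \<in> Jac R) \<longrightarrow> desc_prod R z n = \<zero>"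
proof -
  obtain i k where i: "i \<in> I" and k: "\<forall>z. (\<forall>j. z j \<in> U i) \<longrightarrow> desc_prod R z k = \<zero>"
    using small_ideal_nilpotent[OF semi] by blast
  have "\<exists>m. \<forall>z. (\<forall>j. z j \<in> Jac R) \<longrightarrow> desc_prod R z m \<in> U i"
    by (rule nilpotent_modulo_U[OF semi i ideal_Jac]) (rule Jac_mult_simple)
  then obtain m where m: "\<forall>z. (\<forall>j. z j \<in> Jac R) \<longrightarrow> desc_prod R z m \<in> U i" by blast
  have "desc_prod R z (m * k) = \<zero>" if z: "\<forall>j. z j \<in> Jac R" for z
  proof -
    have zc: "z j \<in> carrier R" for j using z Jac_subset by blast
    have "desc_prod R z (m * k) = desc_prod R (\<lambda>b. desc_prod R (\<lambda>j. z (m * b + j)) m) k"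
      by (rule desc_prod_mult) (rule zc)
    also have "\<dots> = \<zero>" using k m z by simp
    finally show ?thesis .
  qed
  then show ?thesis by blast
qed

end

section \<open>Length of finite dimensional modules\<close>

context left_module
begin

text \<open>
  The span of a list, built up one generator at a time so that induction on the list passes to a
  submodule of codimension at most one.
\<close>
primrec list_span :: "'c list \<Rightarrow> 'c set" where
  "list_span [] = {\<zero>\<^bsub>M\<^esub>}"
| "list_span (s # ss) = {k \<odot>\<^bsub>M\<^esub> s \<oplus>\<^bsub>M\<^esub> w | k w. k \<in> carrier R \<and> w \<in> list_span ss}"

lemma submodule_list_span: "set ss \<subseteq> carrier M \<Longrightarrow> submodule (list_span ss) R M"
proof (induction ss)
  case Nil
  show ?case by (rule submoduleI) auto
next
  case (Cons s ss)
  then have s: "s \<in> carrier M" and IH: "submodule (list_span ss) R M" by auto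
  have c: "w \<in> carrier M" if "w \<in> list_span ss" for w using sub_carr[OF IH that] .
  show ?case
  proof (rule submoduleI)
    show "list_span (s # ss) \<subseteq> carrier M" using s c by auto
    have "\<zero>\<^bsub>M\<^esub> = \<zero> \<odot>\<^bsub>M\<^esub> s \<oplus>\<^bsub>M\<^esub> \<zero>\<^bsub>M\<^esub>" using s by simp
    then show "\<zero>\<^bsub>M\<^esub> \<in> list_span (s # ss)" using sub_zero[OF IH] R.zero_closed by auto
  next
    fix x y assume "x \<in> list_span (s # ss)" "y \<in> list_span (s # ss)"
    then obtain k w l v where *: "x = k \<odot>\<^bsub>M\<^esub> s \<oplus>\<^bsub>M\<^esub> w" "y = l \<odot>\<^bsub>M\<^esub> s \<oplus>\<^bsub>M\<^esub> v" "k \<in> carrier R" "l \<in> carrier R"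
      "w \<in> list_span ss" "v \<in> list_span ss" by auto
    have "x \<oplus>\<^bsub>M\<^esub> y = (k \<oplus> l) \<odot>\<^bsub>M\<^esub> s \<oplus>\<^bsub>M\<^esub> (w \<oplus>\<^bsub>M\<^esub> v)"
      using * s c[of w] c[of v] by (simp add: smult_l_distr M.a_ac)
    moreover have "k \<oplus> l \<in> carrier R" "w \<oplus>\<^bsub>M\<^esub> v \<in> list_span ss" using * sub_add[OF IH] by auto
    ultimately show "x \<oplus>\<^bsub>M\<^esub> y \<in> list_span (s # ss)" by auto
  next
    fix a x assume a: "a \<in> carrier R" and "x \<in> list_span (s # ss)"
    then obtain k w where *: "x = k \<odot>\<^bsub>M\<^esub> s \<oplus>\<^bsub>M\<^esub> w" "k \<in> carrier R" "w \<in> list_span ss" by auto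
    have "a \<odot>\<^bsub>M\<^esub> x = (a \<otimes> k) \<odot>\<^bsub>M\<^esub> s \<oplus>\<^bsub>M\<^esub> a \<odot>\<^bsub>M\<^esub> w"
      using * s a c[of w] by (simp add: smult_r_distr smult_assoc)
    moreover have "a \<otimes> k \<in> carrier R" "a \<odot>\<^bsub>M\<^esub> w \<in> list_span ss" using * a sub_smult[OF IH] by auto
    ultimately show "a \<odot>\<^bsub>M\<^esub> x \<in> list_span (s # ss)" by auto
  qed
qed

lemma finsum_in_list_span:
  assumes "distinct ss" "set ss \<subseteq> carrier M" "c \<in> set ss \<rightarrow> carrier R"
  shows "(\<Oplus>\<^bsub>M\<^esub>s\<in>set ss. c s \<odot>\<^bsub>M\<^esub> s) \<in> list_span ss"
  using assms
proof (induction ss)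
  case (Cons s ss)
  have "(\<Oplus>\<^bsub>M\<^esub>t\<in>set (s # ss). c t \<odot>\<^bsub>M\<^esub> t) = c s \<odot>\<^bsub>M\<^esub> s \<oplus>\<^bsub>M\<^esub> (\<Oplus>\<^bsub>M\<^esub>t\<in>set ss. c t \<odot>\<^bsub>M\<^esub> t)"
    using Cons.prems by (simp add: M.finsum_insert Pi_def subset_iff)
  moreover have "(\<Oplus>\<^bsub>M\<^esub>t\<in>set ss. c t \<odot>\<^bsub>M\<^esub> t) \<in> list_span ss" using Cons by simp
  moreover have "c s \<in> carrier R" using Cons.prems by auto
  ultimately show ?case by auto
qed simp

text \<open>
  The rank of \<open>W\<close> is the rank of its intersection with the span of the remaining generators, plus
  one if \<open>W\<close> is not contained in that span.
\<close>
lemma bounded_length_list_span: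
  assumes K: "field R"
  shows "set ss \<subseteq> carrier M \<Longrightarrow> bounded_length {W. submodule W R M \<and> W \<subseteq> list_span ss}"
proof (induction ss)
  case Nil
  have "W = {\<zero>\<^bsub>M\<^esub>}" if "submodule W R M" "W \<subseteq> {\<zero>\<^bsub>M\<^esub>}" for W using sub_zero[OF that(1)] that(2) by blast
  then have "bounded_length {W. submodule W R M \<and> W \<subseteq> list_span []}"
    unfolding bounded_length_def by (intro exI[of _ "\<lambda>_. 0"] exI[of _ 0]) auto
  then show ?case .
next
  case (Cons s ss)
  interpret K: field R by (rule K)
  let ?V = "list_span ss"
  have s: "s \<in> carrier M" and V: "submodule ?V R M" using Cons.prems submodule_list_span by auto
  obtain l d where ld: "\<forall>N\<in>{W. submodule W R M \<and> W \<subseteq> ?V}. l N \<le> d \<and>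
      (\<forall>N'\<in>{W. submodule W R M \<and> W \<subseteq> ?V}. N \<subset> N' \<longrightarrow> l N < (l N' :: nat))"
    using Cons unfolding bounded_length_def by auto
  have d: "l N \<le> d" if "submodule N R M" "N \<subseteq> ?V" for N using ld that by simp
  have l: "l N < l N'" if "submodule N R M" "N' \<subseteq> ?V" "submodule N' R M" "N \<subset> N'" for N N'
    using ld that by simp
  have Int: "submodule (W \<inter> ?V) R M" if W: "submodule W R M" for W
    by (rule submoduleI) (use sub_carr[OF W] sub_zero[OF W] sub_zero[OF V] sub_add[OF W] sub_add[OF V]
        sub_smult[OF W] sub_smult[OF V] in auto)
  define l' where "l' W = l (W \<inter> ?V) + (if W \<subseteq> ?V then 0 else 1)" for W
  have strict: "l' N < l' N'"
    if N: "submodule N R M" and N': "submodule N' R M" "N' \<subseteq> list_span (s # ss)" and NN': "N \<subset> N'" for N N'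
  proof (cases "N \<inter> ?V = N' \<inter> ?V")
    case False
    then have "N \<inter> ?V \<subset> N' \<inter> ?V" using NN' by blast
    then have "l (N \<inter> ?V) < l (N' \<inter> ?V)" using l[OF Int[OF N] _ Int[OF N'(1)]] by blast
    moreover have "N' \<subseteq> ?V \<longrightarrow> N \<subseteq> ?V" using NN' by blast
    ultimately show ?thesis by (simp add: l'_def)
  next
    case True
    have "\<not> N' \<subseteq> ?V" using True NN' by blast
    moreover have "N \<subseteq> ?V"
    proof (rule ccontr)
      assume "\<not> N \<subseteq> ?V"
      then obtain w where w: "w \<in> N" "w \<notin> ?V" by blast
      have "w \<in> list_span (s # ss)" using w NN' N'(2) by blast
      then obtain k v where kv: "w = k \<odot>\<^bsub>M\<^esub> s \<oplus>\<^bsub>M\<^esub> v" "k \<in> carrier R" "v \<in> ?V" by auto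
      have vc: "v \<in> carrier M" using sub_carr[OF V kv(3)] .
      have "k \<noteq> \<zero>" using kv w(2) s vc by auto
      then have k: "k \<in> Units R" using K.field_Units kv(2) by blast
      have "w' \<in> N" if w': "w' \<in> N'" for w'
      proof -
        obtain k' v' where kv': "w' = k' \<odot>\<^bsub>M\<^esub> s \<oplus>\<^bsub>M\<^esub> v'" "k' \<in> carrier R" "v' \<in> ?V"
          using w' N'(2) by auto
        have vc': "v' \<in> carrier M" using sub_carr[OF V kv'(3)] .
        \<comment> \<open>Subtracting \<open>t w\<close> from \<open>w'\<close> removes the component along \<open>s\<close>.\<close>
        define t where "t = k' \<otimes> inv k"
        have t: "t \<in> carrier R" "t \<otimes> k = k'" using k kv'(2) kv(2) by (auto simp: t_def R.m_assoc)
        define a where "a = k' \<odot>\<^bsub>M\<^esub> s"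
        have a: "a \<in> carrier M" using kv'(2) s by (simp add: a_def)
        have tw: "t \<odot>\<^bsub>M\<^esub> w = a \<oplus>\<^bsub>M\<^esub> t \<odot>\<^bsub>M\<^esub> v"
          unfolding kv(1) a_def using t kv(2) s vc by (simp add: smult_r_distr flip: smult_assoc)
        have tv: "t \<odot>\<^bsub>M\<^esub> v \<in> ?V" using sub_smult[OF V t(1) kv(3)] .
        have tvc: "t \<odot>\<^bsub>M\<^esub> v \<in> carrier M" using t(1) vc by simp
        have "w' \<ominus>\<^bsub>M\<^esub> t \<odot>\<^bsub>M\<^esub> w = (v' \<oplus>\<^bsub>M\<^esub> a) \<ominus>\<^bsub>M\<^esub> (a \<oplus>\<^bsub>M\<^esub> t \<odot>\<^bsub>M\<^esub> v)"
          unfolding tw using kv'(1) M.a_comm[OF a vc'] by (simp add: a_def)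
        also have "\<dots> = v' \<ominus>\<^bsub>M\<^esub> t \<odot>\<^bsub>M\<^esub> v"
          using a vc' tvc by (simp add: M.minus_eq M.minus_add M.a_assoc M.r_neg2)
        finally have eq: "w' \<ominus>\<^bsub>M\<^esub> t \<odot>\<^bsub>M\<^esub> w = v' \<ominus>\<^bsub>M\<^esub> t \<odot>\<^bsub>M\<^esub> v" .
        have twN: "t \<odot>\<^bsub>M\<^esub> w \<in> N" using sub_smult[OF N t(1) w(1)] .
        have "w' \<ominus>\<^bsub>M\<^esub> t \<odot>\<^bsub>M\<^esub> w \<in> ?V" unfolding eq using sub_diff[OF V kv'(3) tv] .
        moreover have "w' \<ominus>\<^bsub>M\<^esub> t \<odot>\<^bsub>M\<^esub> w \<in> N'" using sub_diff[OF N'(1) w'] twN NN' by blast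
        ultimately have "w' \<ominus>\<^bsub>M\<^esub> t \<odot>\<^bsub>M\<^esub> w \<in> N" using True by blast
        then show ?thesis using sub_diff_left[OF N sub_carr[OF N'(1) w'] sub_carr[OF N twN] _ twN] by blast
      qed
      then show False using NN' by blast
    qed
    ultimately show ?thesis using True by (simp add: l'_def)
  qed
  have bound: "l' N \<le> Suc d" if "submodule N R M" for N
    using d[OF Int[OF that]] by (simp add: l'_def)
  show ?case unfolding bounded_length_def
    by (intro exI[of _ l'] exI[of _ "Suc d"]) (use strict bound in blast)
qed

lemma finite_dimensional_bounded_length:
  assumes K: "field R" and fd: "finite_dimensional R M"
  shows "bounded_length {W. submodule W R M}"
proof -
  obtain S where S: "finite S" "S \<subseteq> carrier M"
    "\<forall>v\<in>carrier M. \<exists>c\<in>S \<rightarrow> carrier R. v = (\<Oplus>\<^bsub>M\<^esub>s\<in>S. c s \<odot>\<^bsub>M\<^esub> s)"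
    using fd unfolding finite_dimensional_def by blast
  obtain ss where ss: "set ss = S" "distinct ss" using finite_distinct_list[OF S(1)] by blast
  have "v \<in> list_span ss" if v: "v \<in> carrier M" for v
  proof -
    obtain c where c: "c \<in> S \<rightarrow> carrier R" "v = (\<Oplus>\<^bsub>M\<^esub>s\<in>S. c s \<odot>\<^bsub>M\<^esub> s)" using S(3) v by blast
    then show ?thesis using finsum_in_list_span[of ss c] ss S(2) by simp
  qed
  then have "{W. submodule W R M} \<subseteq> {W. submodule W R M \<and> W \<subseteq> list_span ss}" using sub_carr by blast
  then show ?thesis using bounded_length_subset[OF bounded_length_list_span[OF K]] ss S(2) by blast
qed

text \<open>
  Among the submodules whose image in \<open>M / J\<close> is spanned by finitely many of its elements there is
  a maximal one; it is \<open>M\<close>, since adjoining an element adds only one generator.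
\<close>
lemma finite_dimensional_quot_module:
  assumes J: "submodule J R M" and bl: "bounded_length {N. submodule N R M \<and> J \<subseteq> N}"
  shows "finite_dimensional R (quot_module M J)"
proof -
  let ?Q = "quot_module M J"
  interpret Q: left_module R ?Q by (rule left_module_quot[OF J])
  define spanned where "spanned W \<longleftrightarrow> (\<exists>S. finite S \<and> S \<subseteq> (\<lambda>x. J +>\<^bsub>M\<^esub> x) ` W \<and>
    (\<forall>w\<in>W. \<exists>c\<in>S \<rightarrow> carrier R. J +>\<^bsub>M\<^esub> w = (\<Oplus>\<^bsub>?Q\<^esub>s\<in>S. c s \<odot>\<^bsub>?Q\<^esub> s)))" for W
  let ?\<W> = "{W. submodule W R M \<and> J \<subseteq> W \<and> spanned W}"
  have J0: "J +>\<^bsub>M\<^esub> w = J" if "w \<in> J" for w using coset_zero_iff[OF J sub_carr[OF J that]] that by blast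
  have "spanned J"
    unfolding spanned_def by (intro exI[of _ "{}"]) (use J0 J in simp)
  then have ne: "?\<W> \<noteq> {}" using J by blast
  have sub: "?\<W> \<subseteq> {N. submodule N R M \<and> J \<subseteq> N}" by blast
  obtain W where W: "W \<in> ?\<W>" and max: "\<And>W'. W' \<in> ?\<W> \<Longrightarrow> \<not> W \<subset> W'"
    by (rule bounded_length_maximal[OF bl sub ne]) (rule that)
  have sW: "submodule W R M" and JW: "J \<subseteq> W" using W by auto
  obtain S where S: "finite S" "S \<subseteq> (\<lambda>x. J +>\<^bsub>M\<^esub> x) ` W"
    and span: "\<And>w. w \<in> W \<Longrightarrow> \<exists>c\<in>S \<rightarrow> carrier R. J +>\<^bsub>M\<^esub> w = (\<Oplus>\<^bsub>?Q\<^esub>s\<in>S. c s \<odot>\<^bsub>?Q\<^esub> s)"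
  proof -
    have "spanned W" using W by blast
    then obtain S where S: "finite S" "S \<subseteq> (\<lambda>x. J +>\<^bsub>M\<^esub> x) ` W"
      "\<forall>w\<in>W. \<exists>c\<in>S \<rightarrow> carrier R. J +>\<^bsub>M\<^esub> w = (\<Oplus>\<^bsub>?Q\<^esub>s\<in>S. c s \<odot>\<^bsub>?Q\<^esub> s)"
      unfolding spanned_def by (elim exE conjE)
    show ?thesis by (rule that[OF S(1,2)]) (rule bspec[OF S(3)])
  qed
  have Wc: "w \<in> carrier M" if "w \<in> W" for w using sub_carr[OF sW that] .
  have Sc: "S \<subseteq> carrier ?Q" using S(2) Wc coset_in_quot[OF J] by (auto simp: J)
  have "x \<in> W" if x: "x \<in> carrier M" for x
  proof (rule ccontr)
    assume xW: "x \<notin> W"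
    have xS: "J +>\<^bsub>M\<^esub> x \<notin> S"
    proof
      assume "J +>\<^bsub>M\<^esub> x \<in> S"
      then obtain w where w: "w \<in> W" "J +>\<^bsub>M\<^esub> x = J +>\<^bsub>M\<^esub> w" using S(2) by blast
      then have "x \<ominus>\<^bsub>M\<^esub> w \<in> W" using coset_eq_iff[OF J x Wc[OF w(1)]] JW by blast
      then show False using sub_diff_left[OF sW x Wc[OF w(1)] _ w(1)] xW by blast
    qed
    define W' where "W' = {w \<oplus>\<^bsub>M\<^esub> k \<odot>\<^bsub>M\<^esub> x | w k. w \<in> W \<and> k \<in> carrier R}"
    have memI: "w \<oplus>\<^bsub>M\<^esub> k \<odot>\<^bsub>M\<^esub> x \<in> W'" if "w \<in> W" "k \<in> carrier R" for w k
      using that unfolding W'_def by blast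
    have WW': "w \<in> W'" if "w \<in> W" for w using memI[OF that R.zero_closed] Wc[OF that] x by simp
    have xW': "x \<in> W'" using memI[OF sub_zero[OF sW] R.one_closed] x by simp
    have "submodule W' R M"
    proof (rule submoduleI)
      show "W' \<subseteq> carrier M" using Wc x by (auto simp: W'_def)
      show "\<zero>\<^bsub>M\<^esub> \<in> W'" using WW' sub_zero[OF sW] by blast
    next
      fix u v assume "u \<in> W'" "v \<in> W'"
      then obtain w k w' k' where *: "u = w \<oplus>\<^bsub>M\<^esub> k \<odot>\<^bsub>M\<^esub> x" "v = w' \<oplus>\<^bsub>M\<^esub> k' \<odot>\<^bsub>M\<^esub> x"
        "w \<in> W" "w' \<in> W" "k \<in> carrier R" "k' \<in> carrier R" unfolding W'_def by blast
      have "u \<oplus>\<^bsub>M\<^esub> v = (w \<oplus>\<^bsub>M\<^esub> w') \<oplus>\<^bsub>M\<^esub> (k \<oplus> k') \<odot>\<^bsub>M\<^esub> x"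
        using * x Wc[of w] Wc[of w'] by (simp add: smult_l_distr M.a_ac)
      then show "u \<oplus>\<^bsub>M\<^esub> v \<in> W'" using memI sub_add[OF sW] * by simp
    next
      fix a u assume a: "a \<in> carrier R" and "u \<in> W'"
      then obtain w k where *: "u = w \<oplus>\<^bsub>M\<^esub> k \<odot>\<^bsub>M\<^esub> x" "w \<in> W" "k \<in> carrier R" unfolding W'_def by blast
      have "a \<odot>\<^bsub>M\<^esub> u = a \<odot>\<^bsub>M\<^esub> w \<oplus>\<^bsub>M\<^esub> (a \<otimes> k) \<odot>\<^bsub>M\<^esub> x"
        using * x a Wc[of w] by (simp add: smult_r_distr smult_assoc)
      then show "a \<odot>\<^bsub>M\<^esub> u \<in> W'" using memI sub_smult[OF sW] * a by simp
    qed
    moreover have "spanned W'"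
      unfolding spanned_def
    proof (intro exI[of _ "insert (J +>\<^bsub>M\<^esub> x) S"] conjI ballI)
      show "finite (insert (J +>\<^bsub>M\<^esub> x) S)" using S(1) by simp
      have "(\<lambda>x. J +>\<^bsub>M\<^esub> x) ` W \<subseteq> (\<lambda>x. J +>\<^bsub>M\<^esub> x) ` W'" using WW' by (intro image_mono) blast
      then show "insert (J +>\<^bsub>M\<^esub> x) S \<subseteq> (\<lambda>x. J +>\<^bsub>M\<^esub> x) ` W'" using S(2) xW' by blast
      fix u assume "u \<in> W'"
      then obtain w k where *: "u = w \<oplus>\<^bsub>M\<^esub> k \<odot>\<^bsub>M\<^esub> x" "w \<in> W" "k \<in> carrier R" unfolding W'_def by blast
      obtain c where c: "c \<in> S \<rightarrow> carrier R" "J +>\<^bsub>M\<^esub> w = (\<Oplus>\<^bsub>?Q\<^esub>s\<in>S. c s \<odot>\<^bsub>?Q\<^esub> s)" using span[OF *(2)] by blast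
      let ?X = "J +>\<^bsub>M\<^esub> x"
      let ?c = "c(?X := k)"
      have cS: "?c \<in> insert ?X S \<rightarrow> carrier R" using c(1) *(3) by auto
      have X: "?X \<in> carrier ?Q" using coset_in_quot[OF J x] by (simp add: J)
      have in_c: "?c s \<odot>\<^bsub>?Q\<^esub> s \<in> carrier ?Q" if "s \<in> insert ?X S" for s
      proof (rule Q.smult_closed)
        show "?c s \<in> carrier R" using cS that by (rule funcset_mem)
        show "s \<in> carrier ?Q" using that X Sc by blast
      qed
      have "(\<Oplus>\<^bsub>?Q\<^esub>s\<in>insert ?X S. ?c s \<odot>\<^bsub>?Q\<^esub> s) = ?c ?X \<odot>\<^bsub>?Q\<^esub> ?X \<oplus>\<^bsub>?Q\<^esub> (\<Oplus>\<^bsub>?Q\<^esub>s\<in>S. ?c s \<odot>\<^bsub>?Q\<^esub> s)"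
      proof (rule Q.M.finsum_insert[OF S(1) xS])
        show "(\<lambda>s. ?c s \<odot>\<^bsub>?Q\<^esub> s) \<in> S \<rightarrow> carrier ?Q" using in_c by (intro Pi_I) blast
        show "?c ?X \<odot>\<^bsub>?Q\<^esub> ?X \<in> carrier ?Q" using in_c by blast
      qed
      also have "(\<Oplus>\<^bsub>?Q\<^esub>s\<in>S. ?c s \<odot>\<^bsub>?Q\<^esub> s) = (\<Oplus>\<^bsub>?Q\<^esub>s\<in>S. c s \<odot>\<^bsub>?Q\<^esub> s)"
      proof (rule Q.M.finsum_cong')
        show "(\<lambda>s. c s \<odot>\<^bsub>?Q\<^esub> s) \<in> S \<rightarrow> carrier ?Q"
          using c(1) Sc by (intro Pi_I Q.smult_closed) blast+
        show "?c s \<odot>\<^bsub>?Q\<^esub> s = c s \<odot>\<^bsub>?Q\<^esub> s" if "s \<in> S" for s using that xS by (cases "s = ?X") simp_all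
      qed simp
      also have "\<dots> = J +>\<^bsub>M\<^esub> w" using c(2) by simp
      also have "?c ?X \<odot>\<^bsub>?Q\<^esub> ?X = J +>\<^bsub>M\<^esub> (k \<odot>\<^bsub>M\<^esub> x)" using quot_smult[OF J *(3) x] by simp
      also have "(J +>\<^bsub>M\<^esub> (k \<odot>\<^bsub>M\<^esub> x)) \<oplus>\<^bsub>?Q\<^esub> (J +>\<^bsub>M\<^esub> w) = J +>\<^bsub>M\<^esub> u"
        using coset_add[OF J, of "k \<odot>\<^bsub>M\<^esub> x" w] * x Wc[of w] by (simp add: J M.a_comm)
      finally show "\<exists>c\<in>insert ?X S \<rightarrow> carrier R. J +>\<^bsub>M\<^esub> u = (\<Oplus>\<^bsub>?Q\<^esub>s\<in>insert ?X S. c s \<odot>\<^bsub>?Q\<^esub> s)"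
        using cS by (intro bexI[of _ ?c]) simp_all
    qed
    moreover have "J \<subseteq> W'" using JW WW' by blast
    ultimately have "\<not> W \<subset> W'" using max by blast
    then show False using WW' xW' xW by blast
  qed
  then have all: "\<exists>c\<in>S \<rightarrow> carrier R. J +>\<^bsub>M\<^esub> w = (\<Oplus>\<^bsub>?Q\<^esub>s\<in>S. c s \<odot>\<^bsub>?Q\<^esub> s)" if "w \<in> carrier M" for w
    using span that by blast
  show ?thesis
    unfolding finite_dimensional_def
  proof (intro exI[of _ S] conjI ballI S(1) Sc)
    fix v assume "v \<in> carrier ?Q"
    then have "v \<in> a_rcosets\<^bsub>M\<^esub> J" by (simp add: J)
    then obtain w where "w \<in> carrier M" "v = J +>\<^bsub>M\<^esub> w" using coset_rep[OF J] by blast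
    then show "\<exists>c\<in>S \<rightarrow> carrier R. v = (\<Oplus>\<^bsub>?Q\<^esub>s\<in>S. c s \<odot>\<^bsub>?Q\<^esub> s)" using all by blast
  qed
qed

end

lemma (in module) left_module: "left_module R M"
  by (intro left_module.intro left_module_axioms.intro R.ring_axioms M.abelian_group_axioms)
     (auto simp: smult_l_distr smult_r_distr smult_assoc1)

section \<open>Profinite algebras\<close>

lemma (in assoc_algebra) left_ideal_submodule:
  assumes N: "left_ideal N A" shows "submodule N K A"
proof -
  interpret AM: left_module K A by (rule left_module)
  show ?thesis
  proof (rule AM.submoduleI)
    fix k x assume k: "k \<in> carrier K" and x: "x \<in> N"
    have xc: "x \<in> carrier A" using A.li_carr[OF N x] .
    have "(k \<odot>\<^bsub>A\<^esub> \<one>\<^bsub>A\<^esub>) \<otimes>\<^bsub>A\<^esub> x \<in> N" using A.li_mult[OF N _ x] k by simp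
    moreover have "(k \<odot>\<^bsub>A\<^esub> \<one>\<^bsub>A\<^esub>) \<otimes>\<^bsub>A\<^esub> x = k \<odot>\<^bsub>A\<^esub> x" using smult_mult_left[OF k A.one_closed xc] xc by simp
    ultimately show "k \<odot>\<^bsub>A\<^esub> x \<in> N" by simp
  qed (use A.li_subset[OF N] A.li_zero[OF N] A.li_add[OF N] in auto)
qed

lemma (in assoc_algebra) right_ideal_submodule:
  assumes N: "left_ideal N (opposite_ring A)" shows "submodule N K A"
proof -
  interpret AM: left_module K A by (rule left_module)
  interpret op: ring "opposite_ring A" by (rule ring_opposite_ring) (rule A.ring_axioms)
  show ?thesis
  proof (rule AM.submoduleI)
    fix k x assume k: "k \<in> carrier K" and x: "x \<in> N"
    have xc: "x \<in> carrier A" using op.li_carr[OF N x] by simp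
    have "x \<otimes>\<^bsub>A\<^esub> (k \<odot>\<^bsub>A\<^esub> \<one>\<^bsub>A\<^esub>) \<in> N" using op.li_mult[OF N _ x, of "k \<odot>\<^bsub>A\<^esub> \<one>\<^bsub>A\<^esub>"] k by simp
    moreover have "x \<otimes>\<^bsub>A\<^esub> (k \<odot>\<^bsub>A\<^esub> \<one>\<^bsub>A\<^esub>) = k \<odot>\<^bsub>A\<^esub> x" using smult_mult_right[OF k xc A.one_closed] xc by simp
    ultimately show "k \<odot>\<^bsub>A\<^esub> x \<in> N" by simp
  qed (use op.li_subset[OF N] op.li_zero[OF N] op.li_add[OF N] in auto)
qed

text \<open>
  The transition maps need not be surjective, so \<open>A / U i\<close> is only isomorphic to a subalgebra of
  \<open>B i\<close>, and submodules that contain \<open>U i\<close> are compared through their images in \<open>B i\<close>.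
\<close>
lemma profinite_algebra_ring:
  fixes K :: "('k, 'c) ring_scheme" and A :: "('k, 'a, 'd) module_scheme"
  assumes K: "field K" and prof: "profinite_algebra TYPE('i) TYPE('b) K A"
  obtains I :: "'i set" and U where "profinite_ring A I U"
    "\<And>i. i \<in> I \<Longrightarrow> bounded_length {N. submodule N K A \<and> U i \<subseteq> N}"
proof -
  interpret assoc_algebra K A using prof by (simp add: profinite_algebra_def)
  interpret AM: left_module K A by (rule left_module)
  obtain I :: "'i set" and r and B :: "'i \<Rightarrow> ('k, 'b) module" and f h
    where sys: "fd_inverse_system K I r B f"
      and h: "h \<in> algebra_hom K A (inverse_limit I r B f)"
      and bij: "bij_betw h (carrier A) (carrier (inverse_limit I r B f))"
    using prof unfolding profinite_algebra_def by blast
  interpret sys: fd_inverse_system K I r B f by (rule sys)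
  let ?L = "inverse_limit I r B f"
  have rI: "i \<in> I" "j \<in> I" if "(i, j) \<in> r" for i j
    using sys.poset that by (auto simp: partial_order_on_def preorder_on_def refl_on_def)
  have alg: "assoc_algebra K (B i)" if "i \<in> I" for i using sys.fd_algebra[OF that] by simp
  have ringB: "ring (B i)" if "i \<in> I" for i using alg[OF that] assoc_algebra_def by blast
  have modB: "left_module K (B i)" if "i \<in> I" for i
    using alg[OF that] assoc_algebra_def module.left_module by blast
  have hL: "h x \<in> carrier ?L" if "x \<in> carrier A" for x using bij that bij_betwE by blast
  have hB: "h x i \<in> carrier (B i)" if "x \<in> carrier A" "i \<in> I" for x i
    using hL[OF that(1)] that(2) by (auto simp: inverse_limit_def)
  have compat: "f i j (h x j) = h x i" if "x \<in> carrier A" "(i, j) \<in> r" for x i j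
    using hL[OF that(1)] that(2) by (auto simp: inverse_limit_def)
  have hom: "ring_hom_ring A (B i) (\<lambda>x. h x i)" if i: "i \<in> I" for i
  proof (rule ring_hom_ringI2[OF A.ring_axioms ringB[OF i]])
    have rh: "h \<in> ring_hom A ?L" using h by (simp add: algebra_hom_def)
    show "(\<lambda>x. h x i) \<in> ring_hom A (B i)"
      by (rule ring_hom_memI)
        (use i hB ring_hom_mult[OF rh] ring_hom_add[OF rh] ring_hom_one[OF rh] in \<open>auto simp: inverse_limit_def\<close>)
  qed
  have hs: "h (k \<odot>\<^bsub>A\<^esub> x) i = k \<odot>\<^bsub>B i\<^esub> h x i" if "k \<in> carrier K" "x \<in> carrier A" "i \<in> I" for k x i
    using h that by (auto simp: algebra_hom_def inverse_limit_def)
  define U where "U i = {x \<in> carrier A. h x i = \<zero>\<^bsub>B i\<^esub>}" for i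
  have idU: "ideal (U i) A" if i: "i \<in> I" for i
    using ring_hom_ring.kernel_is_ideal[OF hom[OF i]] by (simp add: U_def a_kernel_def')
  have diffU: "x \<ominus>\<^bsub>A\<^esub> y \<in> U i \<longleftrightarrow> h x i = h y i" if "x \<in> carrier A" "y \<in> carrier A" "i \<in> I" for x y i
  proof -
    interpret hi: ring_hom_ring A "B i" "\<lambda>x. h x i" by (rule hom[OF that(3)])
    have "h (x \<ominus>\<^bsub>A\<^esub> y) i = h x i \<ominus>\<^bsub>B i\<^esub> h y i" using that by (simp add: a_minus_def)
    then show ?thesis using that hi.S.diff_eq_zero_iff[of "h x i" "h y i"] by (simp add: U_def)
  qed
  have decU: "U j \<subseteq> U i" if ij: "(i, j) \<in> r" for i j
  proof
    fix x assume x: "x \<in> U j"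
    have "f i j \<in> ring_hom (B j) (B i)" using sys.transition_hom[OF ij] by (simp add: algebra_hom_def)
    then have "f i j (\<zero>\<^bsub>B j\<^esub>) = \<zero>\<^bsub>B i\<^esub>"
      using ring_hom_zero ringB rI[OF ij] by blast
    then show "x \<in> U i" using compat[of x i j] x ij by (simp add: U_def)
  qed
  have len: "bounded_length {N. submodule N K A \<and> U i \<subseteq> N}" if i: "i \<in> I" for i
  proof -
    interpret Bi: left_module K "B i" by (rule modB[OF i])
    interpret hi: ring_hom_ring A "B i" "\<lambda>x. h x i" by (rule hom[OF i])
    have "bounded_length {W. submodule W K (B i)}"
      using Bi.finite_dimensional_bounded_length[OF K] sys.fd_algebra[OF i] by blast
    then show ?thesis
    proof (rule bounded_length_image[where f = "\<lambda>N. (\<lambda>x. h x i) ` N"])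
      fix N assume "N \<in> {N. submodule N K A \<and> U i \<subseteq> N}"
      then have N: "submodule N K A" by blast
      have Nc: "x \<in> carrier A" if "x \<in> N" for x using AM.sub_carr[OF N that] .
      have "submodule ((\<lambda>x. h x i) ` N) K (B i)"
      proof (rule Bi.submoduleI)
        show "(\<lambda>x. h x i) ` N \<subseteq> carrier (B i)" using Nc hB i by blast
        show "\<zero>\<^bsub>B i\<^esub> \<in> (\<lambda>x. h x i) ` N" using AM.sub_zero[OF N] hi.hom_zero by (metis imageI)
        show "x \<oplus>\<^bsub>B i\<^esub> y \<in> (\<lambda>x. h x i) ` N" if xy: "x \<in> (\<lambda>x. h x i) ` N" "y \<in> (\<lambda>x. h x i) ` N" for x y
        proof -
          obtain u v where uv: "u \<in> N" "v \<in> N" "x = h u i" "y = h v i" using xy by blast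
          then have "x \<oplus>\<^bsub>B i\<^esub> y = h (u \<oplus>\<^bsub>A\<^esub> v) i" using hi.hom_add Nc by simp
          then show ?thesis using AM.sub_add[OF N uv(1,2)] by blast
        qed
        show "k \<odot>\<^bsub>B i\<^esub> x \<in> (\<lambda>x. h x i) ` N" if k: "k \<in> carrier K" and x: "x \<in> (\<lambda>x. h x i) ` N" for k x
        proof -
          obtain u where u: "u \<in> N" "x = h u i" using x by blast
          then have "k \<odot>\<^bsub>B i\<^esub> x = h (k \<odot>\<^bsub>A\<^esub> u) i" using hs[OF k Nc i] by simp
          then show ?thesis using AM.sub_smult[OF N k u(1)] by blast
        qed
      qed
      then show "(\<lambda>x. h x i) ` N \<in> {W. submodule W K (B i)}" by blast
      fix N' assume "N' \<in> {N. submodule N K A \<and> U i \<subseteq> N}" and NN': "N \<subset> N'"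
      then have N': "submodule N' K A" by blast
      have UN: "U i \<subseteq> N" using \<open>N \<in> _\<close> by blast
      obtain x where x: "x \<in> N'" "x \<notin> N" using NN' by blast
      have xc: "x \<in> carrier A" using AM.sub_carr[OF N' x(1)] .
      have "h x i \<notin> (\<lambda>x. h x i) ` N"
      proof
        assume "h x i \<in> (\<lambda>x. h x i) ` N"
        then obtain n where n: "n \<in> N" "h x i = h n i" by blast
        then have "x \<ominus>\<^bsub>A\<^esub> n \<in> N" using diffU[OF xc Nc i] UN by blast
        then show False using AM.sub_diff_left[OF N xc Nc[OF n(1)] _ n(1)] x(2) by blast
      qed
      then show "(\<lambda>x. h x i) ` N \<subset> (\<lambda>x. h x i) ` N'" using x(1) NN' by blast
    qed
  qed
  have "profinite_ring A I U"
  proof (intro profinite_ring.intro profinite_ring_axioms.intro A.ring_axioms)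
    show "ideal (U i) A" if "i \<in> I" for i using idU[OF that] .
    show "I \<noteq> {}" by (rule sys.nonempty)
    show "\<exists>k\<in>I. U k \<subseteq> U i \<and> U k \<subseteq> U j" if ij: "i \<in> I" "j \<in> I" for i j
    proof -
      obtain k where "k \<in> I" "(i, k) \<in> r" "(j, k) \<in> r" using sys.directed[OF ij] by blast
      then show ?thesis using decU by blast
    qed
    show "x = \<zero>\<^bsub>A\<^esub>" if x: "x \<in> carrier A" "\<And>i. i \<in> I \<Longrightarrow> x \<in> U i" for x
    proof -
      have "h x = h \<zero>\<^bsub>A\<^esub>"
      proof (rule PiE_ext)
        show "h x \<in> (\<Pi>\<^sub>E i\<in>I. carrier (B i))" "h \<zero>\<^bsub>A\<^esub> \<in> (\<Pi>\<^sub>E i\<in>I. carrier (B i))"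
          using hL[OF x(1)] hL[OF M.zero_closed] by (auto simp: inverse_limit_def)
        show "h x i = h \<zero>\<^bsub>A\<^esub> i" if i: "i \<in> I" for i
          using diffU[OF x(1) M.zero_closed i] x(2)[OF i] x(1) by simp
      qed
      from inj_onD[OF bij_betw_imp_inj_on[OF bij] this x(1) M.zero_closed] show ?thesis .
    qed
    show "bounded_length {N. left_ideal N A \<and> U i \<subseteq> N}" if "i \<in> I" for i
      by (rule bounded_length_subset[OF len[OF that]]) (use left_ideal_submodule in auto)
    fix c :: "'i \<Rightarrow> 'a" assume c: "\<And>i. i \<in> I \<Longrightarrow> c i \<in> carrier A"
      and cc: "\<And>i j. i \<in> I \<Longrightarrow> j \<in> I \<Longrightarrow> U j \<subseteq> U i \<Longrightarrow> c j \<ominus>\<^bsub>A\<^esub> c i \<in> U i"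
    define b where "b = (\<lambda>i\<in>I. h (c i) i)"
    have "f i j (b j) = b i" if ij: "(i, j) \<in> r" for i j
    proof -
      note I = rI[OF ij]
      have "f i j (b j) = h (c j) i" using compat[OF c[OF I(2)] ij] I by (simp add: b_def)
      also have "\<dots> = h (c i) i" using diffU[OF c[OF I(2)] c[OF I(1)] I(1)] cc[OF I decU[OF ij]] by blast
      finally show ?thesis using I by (simp add: b_def)
    qed
    moreover have "b \<in> (\<Pi>\<^sub>E i\<in>I. carrier (B i))" using hB c by (auto simp: b_def)
    ultimately have "b \<in> carrier ?L" by (auto simp: inverse_limit_def)
    then have "b \<in> h ` carrier A" using bij_betw_imp_surj_on[OF bij] by simp
    then obtain y where y: "y \<in> carrier A" "h y = b" by blast
    have "y \<ominus>\<^bsub>A\<^esub> c i \<in> U i" if "i \<in> I" for i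
      using diffU[OF y(1) c[OF that] that] y(2) that by (simp add: b_def)
    then show "\<exists>y\<in>carrier A. \<forall>i\<in>I. y \<ominus>\<^bsub>A\<^esub> c i \<in> U i" using y(1) by blast
  qed
  then show ?thesis using that len by blast
qed

theorem theorem0p1:
  fixes K :: "('k, 'c) ring_scheme" and A :: "('k, 'a, 'd) module_scheme"
  assumes "field K"
    and "profinite_algebra TYPE('i) TYPE('b) K A"
    and "left_semiartinian A"
  shows "nilpotent_ideal (Jac A) A
    \<and> semisimple_ring (A Quot Jac A)
    \<and> finite_dimensional K (quot_module A (Jac A))
    \<and> right_semiartinian A"
proof -
  interpret assoc_algebra K A using assms(2) by (simp add: profinite_algebra_def)
  interpret AM: left_module K A by (rule left_module)
  interpret op: ring "opposite_ring A" by (rule ring_opposite_ring) (rule A.ring_axioms)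
  obtain I :: "'i set" and U where prof: "profinite_ring A I U"
    and len: "\<And>i. i \<in> I \<Longrightarrow> bounded_length {N. submodule N K A \<and> U i \<subseteq> N}"
    by (rule profinite_algebra_ring[OF assms(1,2)]) (rule that)
  interpret prof: profinite_ring A I U by (rule prof)
  have op_Jac: "Jac (opposite_ring A) = Jac A" by (rule Jac_opposite_ring) (rule A.ring_axioms)
  obtain i where i: "i \<in> I" "U i \<subseteq> Jac A" using prof.Jac_open[OF assms(3)] by blast
  have lenJ: "bounded_length {N. submodule N K A \<and> Jac A \<subseteq> N}"
    by (rule bounded_length_subset[OF len[OF i(1)]]) (use i(2) in blast)
  have one: "\<one>\<^bsub>A\<^esub> \<in> generate (add_monoid A) (Collect (A.simple_over (Jac A)))"
    by (rule A.one_in_simple_sum_Jac[OF bounded_length_subset[OF lenJ]])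
      (use left_ideal_submodule in blast)
  have op_len: "bounded_length {N. left_ideal N (opposite_ring A) \<and> Jac (opposite_ring A) \<subseteq> N}"
    unfolding op_Jac by (rule bounded_length_subset[OF lenJ]) (use right_ideal_submodule in blast)
  obtain n where n: "\<forall>z. (\<forall>j. z j \<in> Jac A) \<longrightarrow> desc_prod A z n = \<zero>\<^bsub>A\<^esub>"
    using prof.Jac_nilpotent[OF assms(3)] by blast
  have "right_semiartinian A"
    unfolding right_semiartinian_def
  proof (rule op.semiartinian_if_Jac_nilpotent[OF op.left_module_regular
        op.one_in_simple_sum_Jac[OF op_len]])
    fix z :: "nat \<Rightarrow> 'a" assume "\<And>j. z j \<in> Jac (opposite_ring A)"
    then have z: "z j \<in> Jac A" for j using op_Jac by simp
    then have "desc_prod (opposite_ring A) z n = desc_prod A (\<lambda>j. z (n - Suc j)) n"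
      using A.Jac_subset by (intro A.desc_prod_opposite_ring) blast
    then show "desc_prod (opposite_ring A) z n = \<zero>\<^bsub>opposite_ring A\<^esub>" using n z by simp
  qed
  moreover have "nilpotent_ideal (Jac A) A" using A.nilpotent_idealI[OF A.ideal_Jac n] .
  moreover have "semisimple_ring (A Quot Jac A)" by (rule A.semisimple_ring_quot_Jac[OF one])
  moreover have "finite_dimensional K (quot_module A (Jac A))"
    by (rule AM.finite_dimensional_quot_module[OF _ lenJ])
      (rule left_ideal_submodule[OF A.ideal_left_ideal[OF A.ideal_Jac]])
  ultimately show ?thesis by blast
qed

end
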